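(* Let $(M,g)$ and $(N,h)$ be Riemannian manifolds and let $f:(M,g)\to(N,h)$ be a R.-N.-lipschitz map. Then the pullback induces an $\mathcal L^2$-bounded operator $f^*:\mathcal L^2(N)\to\mathcal L^2(M)$. In particular the norm of $f^*$ is less than or equal to $K_f\cdot\sqrt{C_{Vol}}$.
   Context: $\mathcal L^2(M)$ is the Hilbert space of square integrable complex differential forms of all degrees. The map $f$ is R.-N.-lipschitz if it is lipschitz, the pushforward $f_\star\mu_M$ of the Riemannian measure is absolutely continuous with respect to $\mu_N$ and the Fiber Volume $\partial(f_\star\mu_M)/\partial\mu_N$ is bounded; $C_{Vol}$ denotes the (essential) supremum of the Fiber Volume. $K_f=\max\{1,C_f,C_f^{\,n}\}$ with $C_f$ the lipschitz constant of $f$ and $n=\dim N$. *)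

theory Defs
  imports "HOL-Analysis.Analysis" "HOL-Probability.Essential_Supremum"
begin

section \<open>Smooth manifolds\<close>

primrec Ck_on :: "nat \<Rightarrow> 'v::real_normed_vector set \<Rightarrow> ('v \<Rightarrow> 'w::real_normed_vector) \<Rightarrow> bool" where
  "Ck_on 0 S f \<longleftrightarrow> continuous_on S f"
| "Ck_on (Suc k) S f \<longleftrightarrow>
     (\<forall>x\<in>S. f differentiable (at x)) \<and> (\<forall>v. Ck_on k S (\<lambda>x. frechet_derivative f (at x) v))"

text \<open>Used for open sets \<open>S\<close> only.\<close>
definition smooth_on :: "'v::real_normed_vector set \<Rightarrow> ('v \<Rightarrow> 'w::real_normed_vector) \<Rightarrow> bool" where
  "smooth_on S f \<longleftrightarrow> (\<forall>k. Ck_on k S f)"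

text \<open>A chart \<open>(U, \<phi>)\<close>. The values of \<open>\<phi>\<close> outside \<open>U\<close> are irrelevant.\<close>
type_synonym ('a, 'm) chart = "'a set \<times> ('a \<Rightarrow> real^'m)"

definition chart_inv :: "('a, 'm::finite) chart \<Rightarrow> real^'m \<Rightarrow> 'a" where
  "chart_inv c = inv_into (fst c) (snd c)"

definition is_chart :: "('a::topological_space, 'm::finite) chart \<Rightarrow> bool" where
  "is_chart c \<longleftrightarrow> open (fst c) \<and> open (snd c ` fst c) \<and>
     homeomorphism (fst c) (snd c ` fst c) (snd c) (chart_inv c)"

definition smooth_atlas :: "('a::topological_space, 'm::finite) chart set \<Rightarrow> bool" where
  "smooth_atlas A \<longleftrightarrow> (\<forall>c\<in>A. is_chart c) \<and> (\<Union>c\<in>A. fst c) = UNIV \<and>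
     (\<forall>c\<in>A. \<forall>d\<in>A. smooth_on (snd c ` (fst c \<inter> fst d)) (snd d \<circ> chart_inv c))"

text \<open>A tangent vector is the family of its coordinate vectors with respect to all charts around
  its base point, related by the derivatives of the transition maps. The family is \<open>0\<close> at all
  other charts, so that a tangent vector is determined by its components.\<close>
type_synonym ('a, 'm) tvec = "('a, 'm) chart \<Rightarrow> real^'m"

text \<open>The points of the manifold are all elements of the type \<open>'a\<close>; its dimension is
  \<open>CARD('m)\<close>.\<close>
record ('a, 'm) riem =
  atlas :: "('a, 'm) chart set"
  metric :: "'a \<Rightarrow> ('a, 'm) tvec \<Rightarrow> ('a, 'm) tvec \<Rightarrow> real"

definition charts_at :: "('a, 'm::finite) riem \<Rightarrow> 'a \<Rightarrow> ('a, 'm) chart set" where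
  "charts_at M p = {c \<in> atlas M. p \<in> fst c}"

definition tangent_space :: "('a, 'm::finite) riem \<Rightarrow> 'a \<Rightarrow> ('a, 'm) tvec set" where
  "tangent_space M p = {v.
     (\<forall>c\<in>charts_at M p. \<forall>d\<in>charts_at M p.
        v d = frechet_derivative (snd d \<circ> chart_inv c) (at (snd c p)) (v c)) \<and>
     (\<forall>c. c \<notin> charts_at M p \<longrightarrow> v c = 0)}"

definition tlin :: "real \<Rightarrow> ('a, 'm::finite) tvec \<Rightarrow> real \<Rightarrow> ('a, 'm) tvec \<Rightarrow> ('a, 'm) tvec" where
  "tlin a u b v = (\<lambda>c. a *\<^sub>R u c + b *\<^sub>R v c)"

definition coord_field :: "('a, 'm::finite) riem \<Rightarrow> ('a, 'm) chart \<Rightarrow> 'm \<Rightarrow> 'a \<Rightarrow> ('a, 'm) tvec" where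
  "coord_field M c i p = (\<lambda>d. if d \<in> charts_at M p
     then frechet_derivative (snd d \<circ> chart_inv c) (at (snd c p)) (axis i 1) else 0)"

section \<open>Riemannian manifolds\<close>

definition riemannian_metric :: "('a::topological_space, 'm::finite) riem \<Rightarrow> bool" where
  "riemannian_metric M \<longleftrightarrow>
     (\<forall>p. \<forall>u\<in>tangent_space M p. \<forall>v\<in>tangent_space M p. metric M p u v = metric M p v u) \<and>
     (\<forall>p. \<forall>u\<in>tangent_space M p. \<forall>v\<in>tangent_space M p. \<forall>w\<in>tangent_space M p. \<forall>a b.
        metric M p (tlin a u b v) w = a * metric M p u w + b * metric M p v w) \<and>
     (\<forall>p. \<forall>v\<in>tangent_space M p. v \<noteq> (\<lambda>c. 0) \<longrightarrow> metric M p v v > 0) \<and>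
     (\<forall>c\<in>atlas M. \<forall>i j. smooth_on (snd c ` fst c)
        (\<lambda>x. metric M (chart_inv c x) (coord_field M c i (chart_inv c x))
               (coord_field M c j (chart_inv c x))))"

definition riemannian_manifold ::
    "('a::{t2_space, second_countable_topology}, 'm::finite) riem \<Rightarrow> bool" where
  "riemannian_manifold M \<longleftrightarrow> smooth_atlas (atlas M) \<and> riemannian_metric M"

text \<open>The Riemannian measure, as a Borel measure: in every chart it has density
  \<open>sqrt (det (g\<^sub>i\<^sub>j))\<close> with respect to Lebesgue measure.\<close>
definition rvol :: "('a::topological_space, 'm::finite) riem \<Rightarrow> 'a measure" where
  "rvol M = (THE \<mu>. sets \<mu> = sets borel \<and>
     (\<forall>c\<in>atlas M. \<forall>B\<in>sets borel. B \<subseteq> fst c \<longrightarrow>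
        emeasure \<mu> B = (\<integral>\<^sup>+x\<in>snd c ` B. ennreal (sqrt (det
          (\<chi> i j. metric M (chart_inv c x) (coord_field M c i (chart_inv c x))
                    (coord_field M c j (chart_inv c x))))) \<partial>lborel)))"

definition velocity :: "('a, 'm::finite) riem \<Rightarrow> (real \<Rightarrow> 'a) \<Rightarrow> real \<Rightarrow> ('a, 'm) tvec" where
  "velocity M \<gamma> t =
     (\<lambda>c. if c \<in> charts_at M (\<gamma> t) then vector_derivative (snd c \<circ> \<gamma>) (at t) else 0)"

text \<open>Here \<open>piecewise_C1_differentiable_on\<close> does not require the derivative to have one-sided
  limits at the exceptional points. This does not affect the infimum of the lengths below.\<close>
definition piecewise_C1_curve :: "('a::topological_space, 'm::finite) riem \<Rightarrow> (real \<Rightarrow> 'a) \<Rightarrow> bool" where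
  "piecewise_C1_curve M \<gamma> \<longleftrightarrow> continuous_on {0..1} \<gamma> \<and>
     (\<forall>c\<in>atlas M. \<forall>a b. {a..b} \<subseteq> {0..1} \<and> \<gamma> ` {a..b} \<subseteq> fst c \<longrightarrow>
        (snd c \<circ> \<gamma>) piecewise_C1_differentiable_on {a..b})"

definition curve_length :: "('a, 'm::finite) riem \<Rightarrow> (real \<Rightarrow> 'a) \<Rightarrow> ennreal" where
  "curve_length M \<gamma> =
     (\<integral>\<^sup>+t\<in>{0..1}. ennreal (sqrt (metric M (\<gamma> t) (velocity M \<gamma> t) (velocity M \<gamma> t))) \<partial>lborel)"

text \<open>The distance of points in different components is \<open>\<infinity>\<close>.\<close>
definition riem_dist :: "('a::topological_space, 'm::finite) riem \<Rightarrow> 'a \<Rightarrow> 'a \<Rightarrow> ennreal" where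
  "riem_dist M p q = Inf (curve_length M ` {\<gamma>. piecewise_C1_curve M \<gamma> \<and> \<gamma> 0 = p \<and> \<gamma> 1 = q})"

section \<open>Square integrable complex differential forms of all degrees\<close>

text \<open>A complex form at \<open>p\<close> with components of all degrees: its value on lists of length \<open>k\<close> is its
  component of degree \<open>k\<close>, a real-multilinear alternating map into \<open>\<complex>\<close>. The components of degree
  greater than \<open>CARD('m)\<close> vanish automatically.\<close>
definition alternating_form ::
    "('a, 'm::finite) riem \<Rightarrow> 'a \<Rightarrow> (('a, 'm) tvec list \<Rightarrow> complex) \<Rightarrow> bool" where
  "alternating_form M p \<alpha> \<longleftrightarrow>
     (\<forall>vs. \<not> set vs \<subseteq> tangent_space M p \<longrightarrow> \<alpha> vs = 0) \<and>
     (\<forall>us ws u v a b. set us \<union> set ws \<union> {u, v} \<subseteq> tangent_space M p \<longrightarrow>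
        \<alpha> (us @ tlin a u b v # ws) =
          complex_of_real a * \<alpha> (us @ u # ws) + complex_of_real b * \<alpha> (us @ v # ws)) \<and>
     (\<forall>vs. set vs \<subseteq> tangent_space M p \<and> \<not> distinct vs \<longrightarrow> \<alpha> vs = 0)"

definition orthonormal_basis :: "('a, 'm::finite) riem \<Rightarrow> 'a \<Rightarrow> ('a, 'm) tvec list \<Rightarrow> bool" where
  "orthonormal_basis M p es \<longleftrightarrow> length es = CARD('m) \<and> set es \<subseteq> tangent_space M p \<and>
     (\<forall>i<CARD('m). \<forall>j<CARD('m). metric M p (es ! i) (es ! j) = (if i = j then 1 else 0))"

text \<open>The squared pointwise norm of \<open>\<alpha>\<close>, for which the forms \<open>e\<^sup>i \<and> \<dots> \<and> e\<^sup>j\<close> with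
  \<open>i < \<dots> < j\<close> are orthonormal; it does not depend on the orthonormal basis.\<close>
definition form_norm_sq ::
    "('a, 'm::finite) riem \<Rightarrow> 'a \<Rightarrow> (('a, 'm) tvec list \<Rightarrow> complex) \<Rightarrow> real" where
  "form_norm_sq M p \<alpha> = (let es = (SOME es. orthonormal_basis M p es) in
     \<Sum>I\<in>Pow {..<CARD('m)}. (cmod (\<alpha> (nths es I)))\<^sup>2)"

type_synonym ('a, 'm) dform = "'a \<Rightarrow> ('a, 'm) tvec list \<Rightarrow> complex"

definition measurable_forms :: "('a::topological_space, 'm::finite) riem \<Rightarrow> ('a, 'm) dform set" where
  "measurable_forms M = {\<omega>. (\<forall>p. alternating_form M p (\<omega> p)) \<and>
     (\<forall>c\<in>atlas M. \<forall>is. (\<lambda>p. \<omega> p (map (\<lambda>i. coord_field M c i p) is))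
        \<in> borel_measurable (restrict_space (completion (rvol M)) (fst c)))}"

definition form_energy :: "('a::topological_space, 'm::finite) riem \<Rightarrow> ('a, 'm) dform \<Rightarrow> ennreal" where
  "form_energy M \<omega> = (\<integral>\<^sup>+p. ennreal (form_norm_sq M p (\<omega> p)) \<partial>completion (rvol M))"

definition sq_int_forms :: "('a::topological_space, 'm::finite) riem \<Rightarrow> ('a, 'm) dform set" where
  "sq_int_forms M = {\<omega> \<in> measurable_forms M. form_energy M \<omega> < \<infinity>}"

definition ae_eq :: "('a::topological_space, 'm::finite) riem \<Rightarrow> (('a, 'm) dform \<times> ('a, 'm) dform) set" where
  "ae_eq M = {(\<omega>, \<eta>). \<omega> \<in> sq_int_forms M \<and> \<eta> \<in> sq_int_forms M \<and>
     (AE p in completion (rvol M). \<omega> p = \<eta> p)}"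

definition L2 :: "('a::topological_space, 'm::finite) riem \<Rightarrow> ('a, 'm) dform set set" where
  "L2 M = sq_int_forms M // ae_eq M"

definition L2_class :: "('a::topological_space, 'm::finite) riem \<Rightarrow> ('a, 'm) dform \<Rightarrow> ('a, 'm) dform set" where
  "L2_class M \<omega> = ae_eq M `` {\<omega>}"

definition L2_add :: "('a::topological_space, 'm::finite) riem \<Rightarrow>
    ('a, 'm) dform set \<Rightarrow> ('a, 'm) dform set \<Rightarrow> ('a, 'm) dform set" where
  "L2_add M X Y = (\<Union>\<omega>\<in>X. \<Union>\<eta>\<in>Y. L2_class M (\<lambda>p vs. \<omega> p vs + \<eta> p vs))"

definition L2_scale :: "('a::topological_space, 'm::finite) riem \<Rightarrow>
    complex \<Rightarrow> ('a, 'm) dform set \<Rightarrow> ('a, 'm) dform set" where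
  "L2_scale M z X = (\<Union>\<omega>\<in>X. L2_class M (\<lambda>p vs. z * \<omega> p vs))"

definition L2_norm :: "('a::topological_space, 'm::finite) riem \<Rightarrow> ('a, 'm) dform set \<Rightarrow> real" where
  "L2_norm M X = the_elem ((\<lambda>\<omega>. sqrt (enn2real (form_energy M \<omega>))) ` X)"

definition L2_bounded_operator ::
    "('b::topological_space, 'n::finite) riem \<Rightarrow> ('a::topological_space, 'm::finite) riem \<Rightarrow>
     (('b, 'n) dform set \<Rightarrow> ('a, 'm) dform set) \<Rightarrow> bool" where
  "L2_bounded_operator N M T \<longleftrightarrow>
     (\<forall>X\<in>L2 N. T X \<in> L2 M) \<and>
     (\<forall>X\<in>L2 N. \<forall>Y\<in>L2 N. T (L2_add N X Y) = L2_add M (T X) (T Y)) \<and>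
     (\<forall>X\<in>L2 N. \<forall>z. T (L2_scale N z X) = L2_scale M z (T X)) \<and>
     (\<exists>B. \<forall>X\<in>L2 N. L2_norm M (T X) \<le> B * L2_norm N X)"

definition L2_onorm ::
    "('b::topological_space, 'n::finite) riem \<Rightarrow> ('a::topological_space, 'm::finite) riem \<Rightarrow>
     (('b, 'n) dform set \<Rightarrow> ('a, 'm) dform set) \<Rightarrow> real" where
  "L2_onorm N M T = Inf {B. 0 \<le> B \<and> (\<forall>X\<in>L2 N. L2_norm M (T X) \<le> B * L2_norm N X)}"

section \<open>Pullback along Lipschitz maps\<close>

definition mfd_differentiable :: "('a::t2_space, 'm::finite) riem \<Rightarrow> ('b::t2_space, 'n::finite) riem \<Rightarrow>
    ('a \<Rightarrow> 'b) \<Rightarrow> 'a \<Rightarrow> bool" where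
  "mfd_differentiable M N f p \<longleftrightarrow> isCont f p \<and>
     (\<forall>c\<in>charts_at M p. \<forall>d\<in>charts_at N (f p).
        (snd d \<circ> f \<circ> chart_inv c) differentiable (at (snd c p)))"

text \<open>The differential of \<open>f\<close> at \<open>p\<close>, which does not depend on the chart \<open>c\<close>. It is set to \<open>0\<close> where
  \<open>f\<close> is not differentiable; for a Lipschitz map this is a null set by Rademacher's theorem.\<close>
definition differential :: "('a::t2_space, 'm::finite) riem \<Rightarrow> ('b::t2_space, 'n::finite) riem \<Rightarrow>
    ('a \<Rightarrow> 'b) \<Rightarrow> 'a \<Rightarrow> ('a, 'm) tvec \<Rightarrow> ('b, 'n) tvec" where
  "differential M N f p v = (\<lambda>d.
     if mfd_differentiable M N f p \<and> d \<in> charts_at N (f p)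
     then let c = (SOME c. c \<in> charts_at M p)
          in frechet_derivative (snd d \<circ> f \<circ> chart_inv c) (at (snd c p)) (v c)
     else 0)"

definition pullback :: "('a::t2_space, 'm::finite) riem \<Rightarrow> ('b::t2_space, 'n::finite) riem \<Rightarrow>
    ('a \<Rightarrow> 'b) \<Rightarrow> ('b, 'n) dform \<Rightarrow> ('a, 'm) dform" where
  "pullback M N f \<omega> = (\<lambda>p vs. if set vs \<subseteq> tangent_space M p
     then \<omega> (f p) (map (differential M N f p) vs) else 0)"

definition L2_pullback :: "('a::t2_space, 'm::finite) riem \<Rightarrow> ('b::t2_space, 'n::finite) riem \<Rightarrow>
    ('a \<Rightarrow> 'b) \<Rightarrow> ('b, 'n) dform set \<Rightarrow> ('a, 'm) dform set" where
  "L2_pullback M N f X = (\<Union>\<omega>\<in>X. L2_class M (pullback M N f \<omega>))"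

section \<open>R.-N.-Lipschitz maps\<close>

definition riem_lipschitz_const :: "('a::topological_space, 'm::finite) riem \<Rightarrow>
    ('b::topological_space, 'n::finite) riem \<Rightarrow> ('a \<Rightarrow> 'b) \<Rightarrow> real \<Rightarrow> bool" where
  "riem_lipschitz_const M N f C \<longleftrightarrow> 0 \<le> C \<and>
     (\<forall>x y. riem_dist N (f x) (f y) \<le> ennreal C * riem_dist M x y)"

definition riem_lipschitz :: "('a::topological_space, 'm::finite) riem \<Rightarrow>
    ('b::topological_space, 'n::finite) riem \<Rightarrow> ('a \<Rightarrow> 'b) \<Rightarrow> bool" where
  "riem_lipschitz M N f \<longleftrightarrow> (\<exists>C. riem_lipschitz_const M N f C)"

definition lipschitz_constant :: "('a::topological_space, 'm::finite) riem \<Rightarrow>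
    ('b::topological_space, 'n::finite) riem \<Rightarrow> ('a \<Rightarrow> 'b) \<Rightarrow> real" where
  "lipschitz_constant M N f = Inf {C. riem_lipschitz_const M N f C}"

definition pushforward_measure :: "('a::topological_space, 'm::finite) riem \<Rightarrow>
    ('b::topological_space, 'n::finite) riem \<Rightarrow> ('a \<Rightarrow> 'b) \<Rightarrow> 'b measure" where
  "pushforward_measure M N f = distr (rvol M) (rvol N) f"

definition fiber_volume :: "('a::topological_space, 'm::finite) riem \<Rightarrow>
    ('b::topological_space, 'n::finite) riem \<Rightarrow> ('a \<Rightarrow> 'b) \<Rightarrow> 'b \<Rightarrow> ennreal" where
  "fiber_volume M N f = RN_deriv (rvol N) (pushforward_measure M N f)"

definition RN_lipschitz :: "('a::topological_space, 'm::finite) riem \<Rightarrow>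
    ('b::topological_space, 'n::finite) riem \<Rightarrow> ('a \<Rightarrow> 'b) \<Rightarrow> bool" where
  "RN_lipschitz M N f \<longleftrightarrow> riem_lipschitz M N f \<and>
     absolutely_continuous (rvol N) (pushforward_measure M N f) \<and>
     esssup (rvol N) (fiber_volume M N f) < \<infinity>"

definition C_Vol :: "('a::topological_space, 'm::finite) riem \<Rightarrow>
    ('b::topological_space, 'n::finite) riem \<Rightarrow> ('a \<Rightarrow> 'b) \<Rightarrow> real" where
  "C_Vol M N f = enn2real (esssup (rvol N) (fiber_volume M N f))"

definition K_const :: "('a::topological_space, 'm::finite) riem \<Rightarrow>
    ('b::topological_space, 'n::finite) riem \<Rightarrow> ('a \<Rightarrow> 'b) \<Rightarrow> real" where
  "K_const M N f =
     Max {1, lipschitz_constant M N f, lipschitz_constant M N f ^ CARD('n)}"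

end

theory Submission
  imports Defs "HOL-Combinatorics.Multiset_Permutations"
begin

text \<open>Comparing the lengths of curves near \<open>f p\<close> with those of coordinate segments near \<open>p\<close> shows
  that a map with Lipschitz constant \<open>C\<close> is continuous and that its differential, wherever it exists,
  has operator norm at most \<open>C\<close>. The squared norm of a \<open>k\<close>-form is \<open>1 / k!\<close> times the sum of its
  squared values over all \<open>k\<close>-tuples (not only the increasing ones) from an orthonormal basis, and
  this sum can be estimated slot by slot; hence it does not depend on the basis, and the pullback
  multiplies it by at most \<open>C ^ (2 * k)\<close>. So \<open>\<bar>f\<^sup>* \<omega>\<bar>\<^sup>2 \<le> K\<^sup>2 * (\<bar>\<omega>\<bar>\<^sup>2 \<circ> f)\<close> pointwise, and
  integrating against the Fiber Volume yields the bound. Rademacher's theorem is not needed: where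
  \<open>f\<close> is not differentiable the estimate is trivial, and the set of these points is Borel.\<close>

text \<open>The factor for degree k is C^k, and k matters only up to n = dim N because forms of
  higher degree vanish on N; the largest of these powers sits at k = 0 or k = n, hence the shape of
  \<open>K_const\<close>. Summing over all tuples keeps the slots independent of each other, so that
  no minors of the differential appear. The remaining obstacles are measure theoretic.
  \<open>rvol\<close> is a definite description, so the chart densities must first be glued to a
  unique measure; its sigma-finiteness on N opens the way to the Radon-Nikodym derivative.
  \<open>form_norm_sq\<close> chooses a basis at each point with no regularity in the point, so its
  measurability has to come from Gram-Schmidt frames over chart domains, inserted by basis
  independence. Forms are measurable only for the completed measure; composing them with f requires
  preimages of null sets to be null, which is the absolute continuity of the pushforward. The same
  fact makes the pullback well defined on classes.\<close>

definition multilin :: "('v::real_vector list \<Rightarrow> complex) \<Rightarrow> bool" where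
  "multilin a \<longleftrightarrow> (\<forall>us ws u v x y. a (us @ (x *\<^sub>R u + y *\<^sub>R v) # ws) =
     complex_of_real x * a (us @ u # ws) + complex_of_real y * a (us @ v # ws))"

definition alternating :: "('v::real_vector list \<Rightarrow> complex) \<Rightarrow> bool" where
  "alternating a \<longleftrightarrow> multilin a \<and> (\<forall>vs. \<not> distinct vs \<longrightarrow> a vs = 0)"

text \<open>A predicate instead of a type class, because one coordinate space \<open>real^'m\<close>
  carries a different inner product at every point of a chart.\<close>

definition inner_form :: "('v::real_vector \<Rightarrow> 'v \<Rightarrow> real) \<Rightarrow> bool" where
  "inner_form G \<longleftrightarrow> (\<forall>u v. G u v = G v u) \<and>
     (\<forall>u v w a b. G (a *\<^sub>R u + b *\<^sub>R v) w = a * G u w + b * G v w) \<and> (\<forall>v. v \<noteq> 0 \<longrightarrow> 0 < G v v)"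

definition lists_over :: "'i set \<Rightarrow> nat \<Rightarrow> 'i list set" where
  "lists_over J k = {js. set js \<subseteq> J \<and> length js = k}"

text \<open>For an orthonormal basis \<open>e\<close> this is the squared Hilbert-Schmidt norm of
  the k-linear part of \<open>a\<close>; on alternating \<open>a\<close> it is k! times the norm
  that makes increasing wedge products orthonormal.\<close>

definition tensor_norm_sq :: "('v list \<Rightarrow> complex) \<Rightarrow> ('i \<Rightarrow> 'v) \<Rightarrow> 'i set \<Rightarrow> nat \<Rightarrow> real" where
  "tensor_norm_sq a e J k = (\<Sum>js\<in>lists_over J k. (cmod (a (map e js)))\<^sup>2)"

section \<open>Alternating forms on an inner product space\<close>

lemma inner_form_sym: "inner_form G \<Longrightarrow> G u v = G v u"
  unfolding inner_form_def by blast

lemma inner_form_left: "inner_form G \<Longrightarrow> G (a *\<^sub>R u + b *\<^sub>R v) w = a * G u w + b * G v w"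
  unfolding inner_form_def by blast

lemma inner_form_pos: "inner_form G \<Longrightarrow> v \<noteq> 0 \<Longrightarrow> 0 < G v v"
  unfolding inner_form_def by blast

lemma inner_form_linear_left:
  assumes "inner_form G" shows "linear (\<lambda>u. G u w)"
  using inner_form_left[OF assms, of 1 _ 1 _ w] inner_form_left[OF assms, of _ _ 0 0 w]
  by (intro linearI) simp_all

lemma inner_form_linear_right:
  assumes "inner_form G" shows "linear (\<lambda>u. G w u)"
proof -
  have "(\<lambda>u. G w u) = (\<lambda>u. G u w)" by (rule ext) (rule inner_form_sym[OF assms])
  then show ?thesis using inner_form_linear_left[OF assms, of w] by simp
qed

lemma inner_form_nonneg:
  assumes "inner_form G" shows "0 \<le> G v v"
proof (cases "v = 0")
  case True
  then show ?thesis using linear_0[OF inner_form_linear_left[OF assms]] by simp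
qed (use inner_form_pos[OF assms] in force)

lemma inner_form_zero:
  assumes "inner_form G" shows "G 0 v = 0" "G v 0 = 0"
  using linear_0[OF inner_form_linear_left[OF assms]] linear_0[OF inner_form_linear_right[OF assms]]
  by auto

lemma inner_form_sum_left:
  assumes "inner_form G" shows "G (\<Sum>i\<in>I. x i *\<^sub>R u i) w = (\<Sum>i\<in>I. x i * G (u i) w)"
  by (simp add: linear_sum[OF inner_form_linear_left[OF assms]]
      linear_scale[OF inner_form_linear_left[OF assms]])

lemma inner_form_sum_right:
  assumes "inner_form G" shows "G w (\<Sum>i\<in>I. x i *\<^sub>R u i) = (\<Sum>i\<in>I. x i * G w (u i))"
  by (simp add: linear_sum[OF inner_form_linear_right[OF assms]]
      linear_scale[OF inner_form_linear_right[OF assms]])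

lemma inner_form_orthonormal_sum:
  assumes "inner_form G" "finite I"
    and "\<And>i j. i \<in> I \<Longrightarrow> j \<in> I \<Longrightarrow> G (e i) (e j) = (if i = j then 1 else 0)"
  shows "G (\<Sum>i\<in>I. x i *\<^sub>R e i) (\<Sum>i\<in>I. y i *\<^sub>R e i) = (\<Sum>i\<in>I. x i * y i)"
proof -
  have "G (\<Sum>i\<in>I. x i *\<^sub>R e i) (\<Sum>i\<in>I. y i *\<^sub>R e i)
      = (\<Sum>i\<in>I. x i * (\<Sum>j\<in>I. y j * G (e i) (e j)))"
    by (subst inner_form_sum_left[OF assms(1)]) (simp only: inner_form_sum_right[OF assms(1)])
  also have "\<dots> = (\<Sum>i\<in>I. x i * y i)"
  proof (intro sum.cong refl)
    fix i assume "i \<in> I"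
    then have "(\<Sum>j\<in>I. y j * G (e i) (e j)) = (\<Sum>j\<in>I. if i = j then y j else 0)"
      by (intro sum.cong) (auto simp: assms(3))
    then show "x i * (\<Sum>j\<in>I. y j * G (e i) (e j)) = x i * y i"
      using \<open>i \<in> I\<close> \<open>finite I\<close> by simp
  qed
  finally show ?thesis .
qed

text \<open>Write S and B for the two sums, the squared dual norms of \<beta> o A and of \<beta>.
  The vector \<open>s\<close> represents \<beta> o A on the span of the \<open>e i\<close>, so both
  its squared length and \<beta> (A s) equal S. Cauchy-Schwarz at A s together with
  \<open>AC\<close> gives S^2 \<le> C S B, and S cancels.\<close>

lemma slot_bound_real:
  fixes A :: "'v::real_vector \<Rightarrow> 'w::real_vector"
  assumes G: "inner_form G" and H: "inner_form H" and A: "linear A"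
    and AC: "\<And>v. H (A v) (A v) \<le> C * G v v"
    and I: "finite I" "\<And>i j. i \<in> I \<Longrightarrow> j \<in> I \<Longrightarrow> G (e i) (e j) = (if i = j then 1 else 0)"
    and J: "finite J" "\<And>i j. i \<in> J \<Longrightarrow> j \<in> J \<Longrightarrow> H (f i) (f j) = (if i = j then 1 else 0)"
    and exp: "\<And>y. y = (\<Sum>j\<in>J. H y (f j) *\<^sub>R f j)"
    and \<beta>: "linear \<beta>" and C: "0 \<le> C"
  shows "(\<Sum>i\<in>I. (\<beta> (A (e i)))\<^sup>2) \<le> C * (\<Sum>j\<in>J. (\<beta> (f j) :: real)\<^sup>2)" (is "?S \<le> C * ?B")
proof -
  define s where "s = (\<Sum>i\<in>I. \<beta> (A (e i)) *\<^sub>R e i)"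
  have Gs: "G s s = ?S"
    unfolding s_def by (subst inner_form_orthonormal_sum[OF G I]) (simp_all add: power2_eq_square)
  have \<beta>s: "\<beta> (A s) = ?S"
    by (simp add: s_def linear_sum[OF A] linear_sum[OF \<beta>] linear_scale[OF A] linear_scale[OF \<beta>]
        power2_eq_square)
  define y where "y = A s"
  have "\<beta> y = (\<Sum>j\<in>J. H y (f j) * \<beta> (f j))"
    by (subst exp[of y]) (simp add: linear_sum[OF \<beta>] linear_scale[OF \<beta>])
  then have "(\<beta> y)\<^sup>2 \<le> (\<Sum>j\<in>J. (H y (f j))\<^sup>2) * ?B"
    using Cauchy_Schwarz_ineq_sum[of "\<lambda>j. H y (f j)" "\<lambda>j. \<beta> (f j)" J] by simp
  also have "(\<Sum>j\<in>J. (H y (f j))\<^sup>2) = H y y"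
  proof -
    have "H y y = H (\<Sum>j\<in>J. H y (f j) *\<^sub>R f j) (\<Sum>j\<in>J. H y (f j) *\<^sub>R f j)"
      using exp[of y] by simp
    then show ?thesis
      by (subst (asm) inner_form_orthonormal_sum[OF H J]) (simp_all add: power2_eq_square)
  qed
  also have "H y y * ?B \<le> (C * ?S) * ?B"
    using AC[of s] by (intro mult_right_mono) (auto simp: y_def Gs sum_nonneg)
  finally have "?S * ?S \<le> ?S * (C * ?B)"
    by (simp add: y_def \<beta>s power2_eq_square mult_ac)
  moreover have "0 \<le> ?S" "0 \<le> ?B" by (auto intro: sum_nonneg)
  ultimately show ?thesis
    using C by (cases "?S = 0") (auto simp: mult_le_cancel_left)
qed

text \<open>Real and imaginary parts are real functionals, and the squared modulus is the sum of
  their squares.\<close>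

lemma slot_bound_complex:
  fixes A :: "'v::real_vector \<Rightarrow> 'w::real_vector"
  assumes G: "inner_form G" and H: "inner_form H" and A: "linear A"
    and AC: "\<And>v. H (A v) (A v) \<le> C * G v v"
    and I: "finite I" "\<And>i j. i \<in> I \<Longrightarrow> j \<in> I \<Longrightarrow> G (e i) (e j) = (if i = j then 1 else 0)"
    and J: "finite J" "\<And>i j. i \<in> J \<Longrightarrow> j \<in> J \<Longrightarrow> H (f i) (f j) = (if i = j then 1 else 0)"
    and exp: "\<And>y. y = (\<Sum>j\<in>J. H y (f j) *\<^sub>R f j)"
    and \<beta>: "\<And>u v x y. \<beta> (x *\<^sub>R u + y *\<^sub>R v) = complex_of_real x * \<beta> u + complex_of_real y * \<beta> v"
    and C: "0 \<le> C"
  shows "(\<Sum>i\<in>I. (cmod (\<beta> (A (e i))))\<^sup>2) \<le> C * (\<Sum>j\<in>J. (cmod (\<beta> (f j)))\<^sup>2)"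
proof -
  have "linear (\<lambda>u. Re (\<beta> u))" "linear (\<lambda>u. Im (\<beta> u))"
    using \<beta>[of 1 _ 1] \<beta>[of _ _ 0 0] by (auto intro!: linearI)
  moreover have "(\<Sum>i\<in>I. (\<gamma> (A (e i)))\<^sup>2) \<le> C * (\<Sum>j\<in>J. (\<gamma> (f j))\<^sup>2)"
    if "linear \<gamma>" for \<gamma> :: "'w \<Rightarrow> real"
    by (rule slot_bound_real[OF G H A _ I(1) _ J(1) _ exp that C]) (use AC I J in auto)
  ultimately have "(\<Sum>i\<in>I. (Re (\<beta> (A (e i))))\<^sup>2) \<le> C * (\<Sum>j\<in>J. (Re (\<beta> (f j)))\<^sup>2)"
    "(\<Sum>i\<in>I. (Im (\<beta> (A (e i))))\<^sup>2) \<le> C * (\<Sum>j\<in>J. (Im (\<beta> (f j)))\<^sup>2)"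
    by blast+
  then show ?thesis by (simp add: cmod_power2 sum.distrib algebra_simps)
qed

section \<open>Tensor norms as sums over tuples of basis indices\<close>

lemma lists_over_0 [simp]: "lists_over J 0 = {[]}"
  by (auto simp: lists_over_def)

lemma finite_lists_over [simp]: "finite J \<Longrightarrow> finite (lists_over J k)"
  unfolding lists_over_def by (rule finite_lists_length_eq)

lemma sum_lists_over_Suc:
  "(\<Sum>js\<in>lists_over J (Suc k). g js) = (\<Sum>j\<in>J. \<Sum>js\<in>lists_over J k. g (j # js))"
proof -
  have "lists_over J (Suc k) = (\<lambda>(j, js). j # js) ` (J \<times> lists_over J k)"
    by (auto simp: lists_over_def length_Suc_conv image_iff)
  moreover have "inj_on (\<lambda>(j, js). j # js) (J \<times> lists_over J k)"
    by (auto simp: inj_on_def)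
  ultimately show ?thesis
    by (simp add: sum.reindex sum.cartesian_product case_prod_unfold)
qed

lemma multilin_Cons: "multilin a \<Longrightarrow> multilin (\<lambda>vs. a (v # vs))"
  unfolding multilin_def by (metis append_Cons)

text \<open>Every slot costs one factor \<open>C\<close>. The induction hypothesis removes
  \<open>A\<close> from the last k slots with the first one frozen at \<open>A (e i)\<close>; after
  exchanging the sums, the first slot is treated with the others frozen at vectors of
  \<open>f\<close>.\<close>

lemma tensor_norm_sq_bound:
  fixes A :: "'v::real_vector \<Rightarrow> 'w::real_vector"
  assumes G: "inner_form G" and H: "inner_form H" and A: "linear A"
    and AC: "\<And>v. H (A v) (A v) \<le> C * G v v"
    and I: "finite I" "\<And>i j. i \<in> I \<Longrightarrow> j \<in> I \<Longrightarrow> G (e i) (e j) = (if i = j then 1 else 0)"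
    and J: "finite J" "\<And>i j. i \<in> J \<Longrightarrow> j \<in> J \<Longrightarrow> H (f i) (f j) = (if i = j then 1 else 0)"
    and exp: "\<And>y. y = (\<Sum>j\<in>J. H y (f j) *\<^sub>R f j)"
    and C: "0 \<le> C" and a: "multilin a"
  shows "tensor_norm_sq (\<lambda>vs. a (map A vs)) e I k \<le> C ^ k * tensor_norm_sq a f J k"
  using a
proof (induction k arbitrary: a)
  case 0
  then show ?case by (simp add: tensor_norm_sq_def)
next
  case (Suc k)
  have "tensor_norm_sq (\<lambda>vs. a (map A vs)) e I (Suc k)
      = (\<Sum>i\<in>I. tensor_norm_sq (\<lambda>vs. a (A (e i) # map A vs)) e I k)"
    by (simp add: tensor_norm_sq_def sum_lists_over_Suc)
  also have "\<dots> \<le> (\<Sum>i\<in>I. C ^ k * tensor_norm_sq (\<lambda>vs. a (A (e i) # vs)) f J k)"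
    by (intro sum_mono Suc.IH multilin_Cons Suc.prems)
  also have "\<dots> = C ^ k * (\<Sum>js\<in>lists_over J k. \<Sum>i\<in>I. (cmod (a (A (e i) # map f js)))\<^sup>2)"
    unfolding tensor_norm_sq_def sum_distrib_left[symmetric] by (subst sum.swap) simp
  also have "\<dots> \<le> C ^ k * (\<Sum>js\<in>lists_over J k. C * (\<Sum>j\<in>J. (cmod (a (f j # map f js)))\<^sup>2))"
  proof (intro mult_left_mono sum_mono)
    fix js
    show "(\<Sum>i\<in>I. (cmod (a (A (e i) # map f js)))\<^sup>2) \<le> C * (\<Sum>j\<in>J. (cmod (a (f j # map f js)))\<^sup>2)"
    proof (rule slot_bound_complex[OF G H A _ I(1) _ J(1) _ exp _ C, where \<beta> = "\<lambda>v. a (v # map f js)"])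
      fix u v x y
      show "a ((x *\<^sub>R u + y *\<^sub>R v) # map f js)
          = complex_of_real x * a (u # map f js) + complex_of_real y * a (v # map f js)"
        using Suc.prems[unfolded multilin_def, rule_format, of "[]"] by simp
    qed (use AC I J in auto)
  qed (use C in simp)
  also have "\<dots> = C ^ Suc k * tensor_norm_sq a f J (Suc k)"
    unfolding tensor_norm_sq_def sum_lists_over_Suc sum_distrib_left[symmetric]
    by (subst sum.swap) (simp add: mult_ac)
  finally show ?case .
qed

text \<open>Polarisation: the form vanishes when x + y stands in both slots, and additivity leaves
  the two mixed terms.\<close>

lemma alternating_swap:
  assumes "alternating a"
  shows "a (us @ x # y # ws) = - a (us @ y # x # ws)"
proof -
  have add: "a (us @ (u + v) # ws) = a (us @ u # ws) + a (us @ v # ws)" for us u v ws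
    using assms unfolding alternating_def multilin_def
    by (metis mult_1 of_real_1 scaleR_one)
  have add': "a (us @ p # (u + v) # ws) = a (us @ p # u # ws) + a (us @ p # v # ws)" for us p u v ws
    using add[of "us @ [p]" u v ws] by simp
  have 0: "a (us @ u # u # ws) = 0" for u
    using assms unfolding alternating_def by simp
  have "a (us @ (x + y) # (x + y) # ws) = a (us @ x # y # ws) + a (us @ y # x # ws)"
    unfolding add add' by (simp add: 0)
  then show ?thesis by (simp add: 0 eq_neg_iff_add_eq_0)
qed

text \<open>Moving an argument past a block is a chain of neighbour swaps. Only moduli are compared,
  here and for general rearrangements, so no permutation sign has to be tracked.\<close>

lemma alternating_move:
  assumes "alternating a"
  shows "cmod (a (us @ x # xs @ ws)) = cmod (a (us @ xs @ x # ws))"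
proof (induction xs arbitrary: us)
  case (Cons y xs)
  have "cmod (a (us @ x # (y # xs) @ ws)) = cmod (a ((us @ [y]) @ x # xs @ ws))"
    using alternating_swap[OF assms, of us x y "xs @ ws"] by simp
  then show ?case using Cons[of "us @ [y]"] by simp
qed simp

lemma alternating_mset:
  assumes "alternating a" "mset xs = mset ys"
  shows "cmod (a (us @ xs)) = cmod (a (us @ ys))"
  using assms(2)
proof (induction xs arbitrary: us ys)
  case (Cons x xs)
  then have "x \<in> set ys" by (metis list.set_intros(1) set_mset_mset)
  then obtain as bs where ys: "ys = as @ x # bs" by (meson split_list)
  then have "cmod (a ((us @ [x]) @ xs)) = cmod (a ((us @ [x]) @ as @ bs))"
    using Cons.prems by (intro Cons.IH) simp
  then show ?case using alternating_move[OF assms(1), of us x as bs] by (simp add: ys)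
qed simp

text \<open>Exhibits a sublist as the image of an increasing list of indices, which can then be
  compared with any other ordering of the same index set.\<close>

lemma nths_eq_map_filter: "nths xs I = map ((!) xs) (filter (\<lambda>i. i \<in> I) [0..<length xs])"
proof -
  have "zip xs [0..<length xs] = map (\<lambda>i. (xs ! i, i)) [0..<length xs]"
    by (intro nth_equalityI) simp_all
  then show ?thesis
    unfolding nths_def by (simp only: filter_map map_map o_def fst_conv snd_conv)
qed

text \<open>Group the k-tuples of indices by their underlying set. Tuples with a repetition
  contribute 0, and each k-element set I has k! orderings, all with the modulus belonging to
  \<open>nths es I\<close>.\<close>

lemma sum_nths_eq_tensor_norm_sq:
  assumes a: "alternating a" and m: "length es = m"
  shows "(\<Sum>I\<in>Pow {..<m}. (cmod (a (nths es I)))\<^sup>2)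
    = (\<Sum>k\<le>m. tensor_norm_sq a ((!) es) {..<m} k / fact k)"
proof -
  let ?P = "\<lambda>k. {I\<in>Pow {..<m}. card I = k}"
  have "tensor_norm_sq a ((!) es) {..<m} k = (\<Sum>I\<in>?P k. fact k * (cmod (a (nths es I)))\<^sup>2)" for k
  proof -
    have "tensor_norm_sq a ((!) es) {..<m} k
        = (\<Sum>js\<in>(\<Union>I\<in>?P k. permutations_of_set I). (cmod (a (map ((!) es) js)))\<^sup>2)"
      unfolding tensor_norm_sq_def
    proof (intro sum.mono_neutral_right ballI)
      show "(\<Union>I\<in>?P k. permutations_of_set I) \<subseteq> lists_over {..<m} k"
        by (auto simp: permutations_of_set_def lists_over_def distinct_card)
      fix js assume js: "js \<in> lists_over {..<m} k - (\<Union>I\<in>?P k. permutations_of_set I)"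
      have "\<not> distinct js"
      proof
        assume "distinct js"
        with js have "js \<in> permutations_of_set (set js)" "set js \<in> ?P k"
          by (auto simp: permutations_of_set_def lists_over_def distinct_card)
        with js show False by blast
      qed
      then have "\<not> distinct (map ((!) es) js)" by (simp add: distinct_map)
      then show "(cmod (a (map ((!) es) js)))\<^sup>2 = 0" using a by (simp add: alternating_def)
    qed simp
    also have "\<dots> = (\<Sum>I\<in>?P k. \<Sum>js\<in>permutations_of_set I. (cmod (a (map ((!) es) js)))\<^sup>2)"
      by (intro sum.UNION_disjoint) (auto dest: permutations_of_setD)
    also have "\<dots> = (\<Sum>I\<in>?P k. fact k * (cmod (a (nths es I)))\<^sup>2)"
    proof (intro sum.cong refl)
      fix I assume I: "I \<in> ?P k"
      have "cmod (a (map ((!) es) js)) = cmod (a (nths es I))" if "js \<in> permutations_of_set I" for js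
      proof -
        have "set (filter (\<lambda>i. i \<in> I) [0..<length es]) = I" using I m by auto
        with that have "mset js = mset (filter (\<lambda>i. i \<in> I) [0..<length es])"
          by (intro iffD1[OF set_eq_iff_mset_eq_distinct]) (auto dest: permutations_of_setD)
        then have "mset (map ((!) es) js) = mset (nths es I)"
          unfolding nths_eq_map_filter mset_map by (rule arg_cong)
        from alternating_mset[OF a this, of "[]"] show ?thesis by simp
      qed
      moreover have "finite I" using I finite_subset by auto
      ultimately show "(\<Sum>js\<in>permutations_of_set I. (cmod (a (map ((!) es) js)))\<^sup>2)
          = fact k * (cmod (a (nths es I)))\<^sup>2"
        using I by (simp)
    qed
    finally show ?thesis .
  qed
  then have "(\<Sum>k\<le>m. tensor_norm_sq a ((!) es) {..<m} k / fact k)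
      = (\<Sum>k\<le>m. \<Sum>I\<in>?P k. (cmod (a (nths es I)))\<^sup>2)"
    by (simp add: sum_divide_distrib)
  also have "\<dots> = (\<Sum>I\<in>Pow {..<m}. (cmod (a (nths es I)))\<^sup>2)"
  proof (rule sum.group)
    show "card ` Pow {..<m} \<subseteq> {..m}"
      using card_mono[of "{..<m}"] by force
  qed auto
  finally show ?thesis by simp
qed

text \<open>Pigeonhole. It removes the degrees above dim N, for which no power of the Lipschitz
  constant is controlled by \<open>K_const\<close>.\<close>

lemma tensor_norm_sq_eq_0:
  assumes "alternating a" "finite J" "card J < k"
  shows "tensor_norm_sq a e J k = 0"
proof -
  have "\<not> distinct (map e js)" if "js \<in> lists_over J k" for js
  proof
    assume "distinct (map e js)"
    then have "card (set js) = k" using that by (auto simp: lists_over_def distinct_map distinct_card)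
    then show False using that assms(2,3) card_mono[of J "set js"] by (auto simp: lists_over_def)
  qed
  then show ?thesis using assms(1) by (simp add: tensor_norm_sq_def alternating_def)
qed

text \<open>An orthonormal family is independent, hence spans by cardinality. The residual
  \<open>z\<close> is orthogonal to the family, so to everything, in particular to itself.\<close>

lemma orthonormal_expansion:
  fixes f :: "'i \<Rightarrow> 'v::euclidean_space"
  assumes H: "inner_form H" and J: "finite J" "card J = DIM('v)"
    and on: "\<And>i j. i \<in> J \<Longrightarrow> j \<in> J \<Longrightarrow> H (f i) (f j) = (if i = j then 1 else 0)"
  shows "y = (\<Sum>j\<in>J. H y (f j) *\<^sub>R f j)"
proof -
  have inj: "inj_on f J"
    using on by (metis inj_on_def zero_neq_one)
  have indep: "independent (f ` J)"
    unfolding independent_explicit_finite_subsets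
  proof (intro allI impI ballI)
    fix A u v assume A: "A \<subseteq> f ` J" "finite A" "(\<Sum>v\<in>A. u v *\<^sub>R v) = 0" "v \<in> A"
    have "H (\<Sum>w\<in>A. u w *\<^sub>R w) v = (\<Sum>w\<in>A. u w * H w v)"
      by (rule inner_form_sum_left[OF H])
    also have "\<dots> = (\<Sum>w\<in>A. if w = v then u v else 0)"
    proof (intro sum.cong refl)
      fix w assume "w \<in> A"
      then obtain i j where "i \<in> J" "j \<in> J" "w = f i" "v = f j" using A by blast
      then show "u w * H w v = (if w = v then u v else 0)"
        using on[of i j] on[of j j] by (auto dest: inj_onD[OF inj])
    qed
    finally show "u v = 0" using A by (simp add: inner_form_zero[OF H])
  qed
  have "span (f ` J) = UNIV"
    using indep inj J card_eq_dim[of "f ` J" UNIV] by (auto simp: card_image)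
  define z where "z = y - (\<Sum>j\<in>J. H y (f j) *\<^sub>R f j)"
  have zf: "H z (f i) = 0" if "i \<in> J" for i
  proof -
    have "H z (f i) = H y (f i) - (\<Sum>j\<in>J. H y (f j) * H (f j) (f i))"
      by (simp add: z_def linear_diff[OF inner_form_linear_left[OF H]] inner_form_sum_left[OF H])
    also have "(\<Sum>j\<in>J. H y (f j) * H (f j) (f i)) = (\<Sum>j\<in>J. if j = i then H y (f i) else 0)"
      by (intro sum.cong) (auto simp: on that)
    finally show ?thesis using that J by simp
  qed
  have "H z x = 0" if "x \<in> span (f ` J)" for x
    using that
    by (induction rule: span_induct_alt)
      (auto simp: inner_form_zero[OF H] linear_add[OF inner_form_linear_right[OF H]]
        linear_scale[OF inner_form_linear_right[OF H]] zf)
  then have "H z z = 0" using \<open>span (f ` J) = UNIV\<close> by simp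
  then have "z = 0" using inner_form_pos[OF H, of z] by force
  then show ?thesis by (simp add: z_def)
qed

section \<open>Measurable fields of forms\<close>

lemma borel_measurable_vec_nth:
  fixes f :: "'x \<Rightarrow> real^'m"
  assumes "f \<in> borel_measurable X" shows "(\<lambda>x. f x $ i) \<in> borel_measurable X"
  using assms by (simp add: cart_eq_inner_axis)

lemma vec_expansion: "(v :: real^'m) = (\<Sum>i\<in>UNIV. v $ i *\<^sub>R axis i 1)"
  by (simp add: vec_eq_iff axis_def if_distrib cong: if_cong)

lemma multilin_sum:
  fixes u :: "'i \<Rightarrow> 'v::real_vector"
  assumes "multilin a" "finite I"
  shows "a (us @ (\<Sum>i\<in>I. x i *\<^sub>R u i) # ws) = (\<Sum>i\<in>I. complex_of_real (x i) * a (us @ u i # ws))"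
  using assms(2)
proof (induction I rule: finite_induct)
  case empty
  have "a (us @ (0 *\<^sub>R 0 + 0 *\<^sub>R 0) # ws) = 0"
    using assms(1) unfolding multilin_def by (metis add_0 mult_zero_left of_real_0)
  then show ?case by simp
next
  case (insert i I)
  have "a (us @ (x i *\<^sub>R u i + 1 *\<^sub>R (\<Sum>i\<in>I. x i *\<^sub>R u i)) # ws)
      = complex_of_real (x i) * a (us @ u i # ws) + complex_of_real 1 * a (us @ (\<Sum>i\<in>I. x i *\<^sub>R u i) # ws)"
    using assms(1) unfolding multilin_def by blast
  then show ?case using insert by simp
qed

text \<open>By multilinearity the value is a polynomial in the components of the vector fields
  \<open>vs\<close>, with the values on tuples of unit vectors as coefficients.\<close>

lemma borel_measurable_multilin:
  fixes a :: "'x \<Rightarrow> (real^'m) list \<Rightarrow> complex"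
  assumes a: "\<And>x. x \<in> space X \<Longrightarrow> multilin (a x)"
    and meas: "\<And>js. (\<lambda>x. a x (map (\<lambda>j. axis j 1) js)) \<in> borel_measurable X"
    and vs: "\<And>v. v \<in> set vs \<Longrightarrow> v \<in> borel_measurable X"
  shows "(\<lambda>x. a x (map (\<lambda>v. v x) vs)) \<in> borel_measurable X"
proof -
  \<comment> \<open>Generalised by a prefix \<open>js\<close> of unit vectors: the induction expands
    the leading field and appends the resulting index to the prefix.\<close>
  have "(\<lambda>x. a x (map (\<lambda>j. axis j 1) js @ map (\<lambda>v. v x) vs)) \<in> borel_measurable X" for js
    using vs
  proof (induction vs arbitrary: js)
    case Nil
    then show ?case using meas by simp
  next
    case (Cons v vs)
    have eq: "a x (map (\<lambda>j. axis j 1) js @ map (\<lambda>v. v x) (v # vs))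
        = (\<Sum>i\<in>UNIV. complex_of_real (v x $ i) * a x (map (\<lambda>j. axis j 1) (js @ [i]) @ map (\<lambda>v. v x) vs))"
      if "x \<in> space X" for x
      using multilin_sum[OF a[OF that], of UNIV "map (\<lambda>j. axis j 1) js" "\<lambda>i. v x $ i" "\<lambda>i. axis i 1" "map (\<lambda>v. v x) vs"]
      by (simp add: vec_expansion[of "v x", symmetric])
    have "(\<lambda>x. v x $ i) \<in> borel_measurable X" for i
      using Cons.prems[of v] by (intro borel_measurable_vec_nth) simp
    moreover have "(\<lambda>x. a x (map (\<lambda>j. axis j 1) (js @ [i]) @ map (\<lambda>v. v x) vs)) \<in> borel_measurable X" for i
      by (rule Cons.IH) (use Cons.prems in simp)
    ultimately show ?case
      by (subst measurable_cong[OF eq])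
        (auto intro!: borel_measurable_sum borel_measurable_times)
  qed
  from this[of "[]"] show ?thesis by simp
qed

lemma inner_form_expand:
  fixes G :: "real^'m \<Rightarrow> real^'m \<Rightarrow> real"
  assumes "inner_form G"
  shows "G u v = (\<Sum>i\<in>UNIV. u $ i * (\<Sum>j\<in>UNIV. v $ j * G (axis i 1) (axis j 1)))"
  by (subst vec_expansion[of u], subst inner_form_sum_left[OF assms],
      subst vec_expansion[of v], simp only: inner_form_sum_right[OF assms])

lemma borel_measurable_inner_form:
  fixes G :: "'x \<Rightarrow> real^'m \<Rightarrow> real^'m \<Rightarrow> real"
  assumes G: "\<And>x. x \<in> space X \<Longrightarrow> inner_form (G x)"
    and meas: "\<And>i j. (\<lambda>x. G x (axis i 1) (axis j 1)) \<in> borel_measurable X"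
    and uv: "u \<in> borel_measurable X" "v \<in> borel_measurable X"
  shows "(\<lambda>x. G x (u x) (v x)) \<in> borel_measurable X"
proof -
  note eq = inner_form_expand[OF G]
  have "(\<lambda>x. u x $ i) \<in> borel_measurable X" "(\<lambda>x. v x $ i) \<in> borel_measurable X" for i
    using uv by (auto intro: borel_measurable_vec_nth)
  then show ?thesis
    by (subst measurable_cong[OF eq]) (auto intro!: borel_measurable_sum borel_measurable_times meas)
qed

text \<open>Gram--Schmidt. Requiring the components outside \<open>I\<close> to vanish keeps the next vector nonzero.\<close>
lemma measurable_orthonormal_frame_aux:
  fixes G :: "'x \<Rightarrow> real^'m \<Rightarrow> real^'m \<Rightarrow> real"
  assumes G: "\<And>x. x \<in> space X \<Longrightarrow> inner_form (G x)"
    and meas: "\<And>i j. (\<lambda>x. G x (axis i 1) (axis j 1)) \<in> borel_measurable X"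
    and "finite (I :: 'm set)"
  shows "\<exists>e :: 'm \<Rightarrow> 'x \<Rightarrow> real^'m. (\<forall>i\<in>I. e i \<in> borel_measurable X) \<and>
    (\<forall>x\<in>space X. \<forall>i\<in>I. (\<forall>j\<in>I. G x (e i x) (e j x) = (if i = j then 1 else 0)) \<and>
       (\<forall>l. l \<notin> I \<longrightarrow> e i x $ l = 0))"
  using \<open>finite I\<close>
proof (induction I rule: finite_induct)
  case (insert k I)
  then obtain e :: "'m \<Rightarrow> 'x \<Rightarrow> real^'m" where e: "\<And>i. i \<in> I \<Longrightarrow> e i \<in> borel_measurable X"
    and on: "\<And>x i j. x \<in> space X \<Longrightarrow> i \<in> I \<Longrightarrow> j \<in> I \<Longrightarrow> G x (e i x) (e j x) = (if i = j then 1 else 0)"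
    and tri: "\<And>x i l. x \<in> space X \<Longrightarrow> i \<in> I \<Longrightarrow> l \<notin> I \<Longrightarrow> e i x $ l = 0"
    by metis
  define u where "u x = axis k 1 - (\<Sum>i\<in>I. G x (axis k 1) (e i x) *\<^sub>R e i x)" for x
  have u: "u \<in> borel_measurable X"
    unfolding u_def
    by (intro borel_measurable_diff borel_measurable_sum borel_measurable_scaleR e
        borel_measurable_inner_form[OF G meas]) auto
  define w where "w x = (1 / sqrt (G x (u x) (u x))) *\<^sub>R u x" for x
  have w: "w \<in> borel_measurable X"
    unfolding w_def
    by (intro borel_measurable_scaleR u borel_measurable_divide borel_measurable_const
        measurable_compose[OF borel_measurable_inner_form[OF G meas u u] borel_measurable_sqrt])
  have uk: "u x $ k = 1" if "x \<in> space X" for x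
    using that insert.hyps by (simp add: u_def tri)
  have upos: "0 < G x (u x) (u x)" if "x \<in> space X" for x
    using uk[OF that] by (intro inner_form_pos[OF G[OF that]]) auto
  have ue: "G x (u x) (e i x) = 0" if "x \<in> space X" "i \<in> I" for x i
  proof -
    note g = G[OF that(1)]
    have "G x (u x) (e i x) = G x (axis k 1) (e i x) - (\<Sum>j\<in>I. G x (axis k 1) (e j x) * G x (e j x) (e i x))"
      by (simp add: u_def linear_diff[OF inner_form_linear_left[OF g]] inner_form_sum_left[OF g])
    also have "(\<Sum>j\<in>I. G x (axis k 1) (e j x) * G x (e j x) (e i x))
        = (\<Sum>j\<in>I. if j = i then G x (axis k 1) (e i x) else 0)"
      by (intro sum.cong) (auto simp: on that)
    finally show ?thesis using that insert.hyps by simp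
  qed
  have we: "G x (w x) (e i x) = 0" "G x (e i x) (w x) = 0" if "x \<in> space X" "i \<in> I" for x i
    using ue[OF that] inner_form_sym[OF G[OF that(1)], of "e i x"]
    by (simp_all add: w_def linear_scale[OF inner_form_linear_left[OF G[OF that(1)]]])
  have ww: "G x (w x) (w x) = 1" if "x \<in> space X" for x
    using upos[OF that] unfolding w_def
    by (simp add: linear_scale[OF inner_form_linear_left[OF G[OF that]]]
        linear_scale[OF inner_form_linear_right[OF G[OF that]]] real_sqrt_mult[symmetric] field_simps)
  have wt: "w x $ l = 0" if "x \<in> space X" "l \<notin> insert k I" for x l
    using that by (simp add: w_def u_def tri axis_def)
  show ?case
  proof (intro exI[of _ "e(k := w)"] conjI ballI)
    show "(e(k := w)) i \<in> borel_measurable X" if "i \<in> insert k I" for i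
      using that e w by auto
    show "G x ((e(k := w)) i x) ((e(k := w)) j x) = (if i = j then 1 else 0)"
      if "x \<in> space X" "i \<in> insert k I" "j \<in> insert k I" for x i j
      using that insert.hyps by (auto simp: on we ww)
    show "\<forall>l. l \<notin> insert k I \<longrightarrow> (e(k := w)) i x $ l = 0"
      if "x \<in> space X" "i \<in> insert k I" for x i
      using that wt[OF that(1)] tri[OF that(1)] by auto
  qed
qed simp

lemma measurable_orthonormal_frame:
  fixes G :: "'x \<Rightarrow> real^'m \<Rightarrow> real^'m \<Rightarrow> real"
  assumes "\<And>x. x \<in> space X \<Longrightarrow> inner_form (G x)"
    and "\<And>i j. (\<lambda>x. G x (axis i 1) (axis j 1)) \<in> borel_measurable X"
  obtains e :: "'m \<Rightarrow> 'x \<Rightarrow> real^'m" where "\<And>i. e i \<in> borel_measurable X"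
    and "\<And>x i j. x \<in> space X \<Longrightarrow> G x (e i x) (e j x) = (if i = j then 1 else 0)"
  using measurable_orthonormal_frame_aux[OF assms finite] by (metis UNIV_I)

section \<open>Change of variables for nonnegative integrals\<close>

text \<open>The theorem applied here equates absolute integrability and the integral on both sides.
  For nonnegative integrands this covers every case: if one side is integrable, the values agree; if
  not, finiteness of either integral would force integrability, so both are infinite.\<close>

lemma nn_integral_change_of_variables_wellorder:
  fixes g :: "real^'m::{finite,wellorder} \<Rightarrow> real^'m::_" and f :: "real^'m::_ \<Rightarrow> real"
  assumes S: "S \<in> sets borel"
    and der: "\<And>x. x \<in> S \<Longrightarrow> (g has_derivative g' x) (at x within S)"
    and inj: "inj_on g S"
    and nonneg: "\<And>y. y \<in> g ` S \<Longrightarrow> 0 \<le> f y"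
    and F: "(\<lambda>y. indicator (g ` S) y * f y) \<in> borel_measurable borel"
    and P: "(\<lambda>x. indicator S x * (\<bar>det (matrix (g' x))\<bar> * f (g x))) \<in> borel_measurable borel"
  shows "(\<integral>\<^sup>+y. ennreal (indicator (g ` S) y * f y) \<partial>lborel)
    = (\<integral>\<^sup>+x. ennreal (indicator S x * (\<bar>det (matrix (g' x))\<bar> * f (g x))) \<partial>lborel)"
proof -
  let ?D = "\<lambda>x. \<bar>det (matrix (g' x))\<bar> * f (g x)"
  have cv: "?D absolutely_integrable_on S \<and> integral S ?D = b \<longleftrightarrow>
      f absolutely_integrable_on (g ` S) \<and> integral (g ` S) f = b" for b
  proof -
    \<comment> \<open>The theorem is stated for vector-valued integrands, so the real function is
      wrapped as a function into \<open>real^1\<close>.\<close>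
    have "(\<lambda>x. \<bar>det (matrix (g' x))\<bar> *\<^sub>R (vec (f (g x)) :: real^1)) absolutely_integrable_on S \<and>
          integral S (\<lambda>x. \<bar>det (matrix (g' x))\<bar> *\<^sub>R (vec (f (g x)) :: real^1)) = vec b
       \<longleftrightarrow> (\<lambda>x. vec (f x) :: real^1) absolutely_integrable_on (g ` S)
          \<and> integral (g ` S) (\<lambda>x. vec (f x) :: real^1) = vec b"
      using S der inj by (intro has_absolute_integral_change_of_variables) auto
    then show ?thesis by (simp add: absolutely_integrable_on_1_iff integral_on_1_eq)
  qed
  have eqI: "integral\<^sup>N lborel (\<lambda>y. ennreal (indicator T y * h y)) = ennreal (integral T h)"
    if "h absolutely_integrable_on T" "\<And>y. y \<in> T \<Longrightarrow> 0 \<le> h y" for T and h :: "real^'m::_ \<Rightarrow> real"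
    using that by (intro nn_integral_has_integral_lebesgue integrable_integral)
      (auto simp: absolutely_integrable_on_def)
  have abs: "h absolutely_integrable_on T"
    if "(\<lambda>y. indicator T y * h y) \<in> borel_measurable borel" "\<And>y. y \<in> T \<Longrightarrow> 0 \<le> h y"
      "(\<integral>\<^sup>+y. ennreal (indicator T y * h y) \<partial>lborel) < \<infinity>" for T and h :: "real^'m::_ \<Rightarrow> real"
  proof -
    have "(\<lambda>y. indicator T y * h y) integrable_on UNIV"
      using that by (intro nn_integral_integrable_on) (auto simp: indicator_def)
    then have "h integrable_on T"
    proof (subst integrable_restrict_UNIV[symmetric])
      have "(\<lambda>y. if y \<in> T then h y else 0) = (\<lambda>y. indicator T y * h y)" by (simp add: fun_eq_iff)
      then show "(\<lambda>y. if y \<in> T then h y else 0) integrable_on UNIV"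
        using \<open>(\<lambda>y. indicator T y * h y) integrable_on UNIV\<close> by (simp only:)
    qed
    then show ?thesis using that(2) by (rule nonnegative_absolutely_integrable_1)
  qed
  have nonneg': "0 \<le> ?D x" if "x \<in> S" for x using nonneg that by simp
  show ?thesis
  proof (cases "f absolutely_integrable_on (g ` S)")
    case True
    then have "?D absolutely_integrable_on S" "integral S ?D = integral (g ` S) f"
      using cv by blast+
    then show ?thesis
      using eqI[OF True nonneg] eqI[of S ?D] nonneg' by simp
  next
    case False
    then have "\<not> ?D absolutely_integrable_on S" using cv by blast
    then have "\<not> (\<integral>\<^sup>+x. ennreal (indicator S x * ?D x) \<partial>lborel) < \<infinity>"
      using abs[OF P nonneg'] by blast
    moreover have "\<not> (\<integral>\<^sup>+y. ennreal (indicator (g ` S) y * f y) \<partial>lborel) < \<infinity>"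
      using abs[OF F nonneg] False by blast
    ultimately show ?thesis by (simp add: less_top[symmetric])
  qed
qed

text \<open>The change of variables theorems of the library need a well-ordered index type, so we
  transport them along a bijection to the following copy of \<open>'a\<close>.\<close>
typedef 'a idx = "{..<CARD('a::finite)}"
  by (rule exI[of _ 0]) simp

instance idx :: (finite) finite
proof
  have "(UNIV :: 'a idx set) = Abs_idx ` {..<CARD('a)}"
    using type_definition.univ[OF type_definition_idx] by simp
  then show "finite (UNIV :: 'a idx set)" by (metis finite_imageI finite_lessThan)
qed

instantiation idx :: (finite) wellorder
begin

definition less_eq_idx :: "'a idx \<Rightarrow> 'a idx \<Rightarrow> bool" where "less_eq_idx x y \<longleftrightarrow> Rep_idx x \<le> Rep_idx y"

definition less_idx :: "'a idx \<Rightarrow> 'a idx \<Rightarrow> bool" where "less_idx x y \<longleftrightarrow> Rep_idx x < Rep_idx y"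

instance
proof
  fix P :: "'a idx \<Rightarrow> bool" and a
  assume step: "\<And>x. (\<And>y. y < x \<Longrightarrow> P y) \<Longrightarrow> P x"
  show "P a"
    by (induction a rule: measure_induct_rule[of Rep_idx]) (rule step, simp add: less_idx_def)
qed (auto simp: less_eq_idx_def less_idx_def Rep_idx_inject[symmetric])

end

lemma card_idx: "CARD('a::finite idx) = CARD('a)"
  using type_definition.card[OF type_definition_idx] by simp

text \<open>For bijective \<tau> this renames coordinates and thereby identifies the Euclidean
  spaces over two index types.\<close>

definition reindex :: "('k \<Rightarrow> 'm) \<Rightarrow> real^'m \<Rightarrow> real^'k" where
  "reindex \<tau> x = (\<chi> k. x $ \<tau> k)"

lemma reindex_nth [simp]: "reindex \<tau> x $ k = x $ \<tau> k"
  by (simp add: reindex_def)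

lemma linear_reindex: "linear (reindex \<tau> :: real^'m \<Rightarrow> real^'k)"
  by (intro linearI) (simp_all add: vec_eq_iff)

lemma reindex_inv:
  assumes "bij \<tau>" shows "reindex \<tau> (reindex (inv \<tau>) x) = x" "reindex (inv \<tau>) (reindex \<tau> y) = y"
  using assms by (simp_all add: vec_eq_iff bij_is_inj bij_is_surj surj_f_inv_f)

lemma measurable_reindex: "(reindex \<tau> :: real^'m \<Rightarrow> real^'k) \<in> borel_measurable borel"
  by (intro borel_measurable_continuous_onI linear_continuous_on linear_conv_bounded_linear[THEN iffD1]
      linear_reindex)

text \<open>Lebesgue measure is determined by its values on boxes, and renaming coordinates turns a
  box into a box with the same side lengths.\<close>

lemma lborel_distr_reindex:
  fixes \<tau> :: "'k::finite \<Rightarrow> 'm::finite"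
  assumes "bij \<tau>"
  shows "distr lborel borel (reindex \<tau>) = lborel"
proof (rule lborel_eqI[symmetric])
  have prod: "(\<Prod>b\<in>Basis. v \<bullet> b) = (\<Prod>i\<in>UNIV. v $ i)" for v :: "real^'i::finite"
  proof -
    have "(\<Prod>b\<in>Basis. v \<bullet> b) = (\<Prod>b\<in>range (\<lambda>i. axis i 1). v \<bullet> b)"
      by (rule prod.cong) (auto simp: Basis_vec_def)
    also have "\<dots> = (\<Prod>i\<in>UNIV. v $ i)"
      by (subst prod.reindex) (auto simp: inj_on_def axis_eq_axis inner_axis)
    finally show ?thesis .
  qed
  fix l u :: "real^'k" assume le: "\<And>b. b \<in> Basis \<Longrightarrow> l \<bullet> b \<le> u \<bullet> b"
  then have le': "l $ k \<le> u $ k" for k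
    using le[of "axis k 1"] by (simp add: inner_axis axis_in_Basis_iff)
  have "reindex \<tau> -` box l u = box (reindex (inv \<tau>) l) (reindex (inv \<tau>) u)"
    using assms by (auto simp: mem_box_cart bij_is_surj surj_f_inv_f) (metis bij_inv_eq_iff)+
  then have "emeasure (distr lborel borel (reindex \<tau>)) (box l u)
      = emeasure lborel (box (reindex (inv \<tau>) l) (reindex (inv \<tau>) u))"
    by (subst emeasure_distr) (auto intro: measurable_reindex)
  also have "\<dots> = (\<Prod>b\<in>Basis. (reindex (inv \<tau>) u - reindex (inv \<tau>) l) \<bullet> b)"
    by (rule emeasure_lborel_box) (auto simp: Basis_vec_def inner_axis le')
  also have "(\<Prod>b\<in>Basis. (reindex (inv \<tau>) u - reindex (inv \<tau>) l) \<bullet> b) = (\<Prod>i\<in>UNIV. (u - l) $ inv \<tau> i)"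
    unfolding prod by simp
  also have "\<dots> = (\<Prod>k\<in>UNIV. (u - l) $ k)"
    by (rule prod.reindex_bij_betw) (rule bij_imp_bij_inv[OF assms])
  also have "\<dots> = (\<Prod>b\<in>Basis. (u - l) \<bullet> b)" unfolding prod ..
  finally show "emeasure (distr lborel borel (reindex \<tau>)) (box l u) = (\<Prod>b\<in>Basis. (u - l) \<bullet> b)" .
qed simp

lemma nn_integral_reindex:
  fixes \<tau> :: "'k::finite \<Rightarrow> 'm::finite"
  assumes "bij \<tau>" "h \<in> borel_measurable borel"
  shows "(\<integral>\<^sup>+y. h y \<partial>lborel) = (\<integral>\<^sup>+x. h (reindex \<tau> x) \<partial>lborel)"
  by (subst lborel_distr_reindex[OF assms(1), symmetric], subst nn_integral_distr)
    (auto intro: measurable_reindex assms(2))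

text \<open>Conjugation by \<tau> is a sign-preserving bijection between the permutations of the two
  index types, and it matches the two Leibniz sums term by term.\<close>

lemma det_reindex:
  fixes A :: "real^'m^'m" and \<tau> :: "'k::finite \<Rightarrow> 'm::finite"
  assumes "bij \<tau>"
  shows "det (\<chi> k l. A $ \<tau> k $ \<tau> l) = det A"
proof -
  define \<Phi> where "\<Phi> p = map_permutation UNIV \<tau> p" for p
  have \<Phi>: "\<Phi> p (\<tau> k) = \<tau> (p k)" for p k
    using assms by (simp add: \<Phi>_def map_permutation_def restrict_id_def bij_is_inj)
  have bij: "bij_betw \<Phi> {p. p permutes (UNIV :: 'k set)} {p. p permutes (UNIV :: 'm set)}"
  proof (rule bij_betw_byWitness[where f' = "map_permutation UNIV (inv \<tau>)"])
    have inv: "bij_betw \<tau> UNIV UNIV" "bij_betw (inv \<tau>) UNIV UNIV"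
      using assms bij_imp_bij_inv by auto
    show "\<forall>p\<in>{p. p permutes UNIV}. map_permutation UNIV (inv \<tau>) (\<Phi> p) = p"
      using assms inv by (auto simp: \<Phi>_def map_permutation_def restrict_id_def fun_eq_iff bij_is_inj bij_is_surj bij_imp_bij_inv inv_inv_eq)
    show "\<forall>p\<in>{p. p permutes UNIV}. \<Phi> (map_permutation UNIV (inv \<tau>) p) = p"
      using assms inv by (auto simp: \<Phi>_def map_permutation_def restrict_id_def fun_eq_iff bij_is_inj bij_is_surj bij_imp_bij_inv inv_inv_eq surj_f_inv_f)
    show "\<Phi> ` {p. p permutes UNIV} \<subseteq> {p. p permutes UNIV}"
      using map_permutation_permutes[OF inv(1)] by (auto simp: \<Phi>_def)
    show "map_permutation UNIV (inv \<tau>) ` {p. p permutes UNIV} \<subseteq> {p. p permutes UNIV}"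
      using map_permutation_permutes[OF inv(2)] by auto
  qed
  have "det A = (\<Sum>p\<in>{p. p permutes (UNIV :: 'k set)}.
      of_int (sign (\<Phi> p)) * (\<Prod>i\<in>UNIV. A $ i $ \<Phi> p i))"
    unfolding det_def by (rule sum.reindex_bij_betw[OF bij, symmetric])
  also have "\<dots> = (\<Sum>p\<in>{p. p permutes (UNIV :: 'k set)}.
      of_int (sign p) * (\<Prod>k\<in>UNIV. A $ \<tau> k $ \<tau> (p k)))"
  proof (intro sum.cong refl)
    fix p :: "'k \<Rightarrow> 'k" assume p: "p \<in> {p. p permutes UNIV}"
    have "sign (\<Phi> p) = sign p"
      unfolding \<Phi>_def using p bij_is_inj[OF assms] by (intro sign_map_permutation) auto
    moreover have "(\<Prod>i\<in>UNIV. A $ i $ \<Phi> p i) = (\<Prod>k\<in>UNIV. A $ \<tau> k $ \<Phi> p (\<tau> k))"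
      by (rule prod.reindex_bij_betw[symmetric]) (rule assms)
    ultimately show "of_int (sign (\<Phi> p)) * (\<Prod>i\<in>UNIV. A $ i $ \<Phi> p i)
        = of_int (sign p) * (\<Prod>k\<in>UNIV. A $ \<tau> k $ \<tau> (p k))"
      by (simp add: \<Phi>)
  qed
  finally show ?thesis by (simp add: det_def)
qed

text \<open>Conjugate \<open>g\<close> by the renaming of coordinates: Lebesgue integrals and
  Jacobian determinants are unchanged, and the conjugate lives over a well-ordered index
  type.\<close>

lemma nn_integral_change_of_variables:
  fixes g :: "real^'m::finite \<Rightarrow> real^'m" and f :: "real^'m \<Rightarrow> real"
  assumes S: "S \<in> sets borel"
    and der: "\<And>x. x \<in> S \<Longrightarrow> (g has_derivative g' x) (at x within S)"
    and inj: "inj_on g S"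
    and nonneg: "\<And>y. y \<in> g ` S \<Longrightarrow> 0 \<le> f y"
    and F: "(\<lambda>y. indicator (g ` S) y * f y) \<in> borel_measurable borel"
    and P: "(\<lambda>x. indicator S x * (\<bar>det (matrix (g' x))\<bar> * f (g x))) \<in> borel_measurable borel"
  shows "(\<integral>\<^sup>+y. ennreal (indicator (g ` S) y * f y) \<partial>lborel)
    = (\<integral>\<^sup>+x. ennreal (indicator S x * (\<bar>det (matrix (g' x))\<bar> * f (g x))) \<partial>lborel)"
proof -
  obtain \<tau> :: "'m idx \<Rightarrow> 'm" where \<tau>: "bij \<tau>"
    using finite_same_card_bij[of "UNIV :: 'm idx set" "UNIV :: 'm set"] by (auto simp: card_idx)
  define \<sigma> where "\<sigma> = inv \<tau>"
  have \<sigma>: "bij \<sigma>" unfolding \<sigma>_def by (rule bij_imp_bij_inv[OF \<tau>])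
  have [simp]: "reindex \<tau> (reindex \<sigma> x) = x" "reindex \<sigma> (reindex \<tau> y) = y" for x y
    using reindex_inv[OF \<tau>] by (simp_all add: \<sigma>_def)
  have mem: "y \<in> reindex \<tau> ` T \<longleftrightarrow> reindex \<sigma> y \<in> T" for y T
    by (auto simp: image_iff intro!: bexI[of _ "reindex \<sigma> y"])
  define h where "h = reindex \<tau> \<circ> g \<circ> reindex \<sigma>"
  define h' where "h' y = reindex \<tau> \<circ> g' (reindex \<sigma> y) \<circ> reindex \<sigma>" for y
  let ?S = "reindex \<tau> ` S"
  have hS: "h ` ?S = reindex \<tau> ` g ` S" by (auto simp: h_def image_iff)
  have ind: "indicator (reindex \<tau> ` T) y = (indicator T (reindex \<sigma> y) :: real)" for T y
    by (simp add: indicator_def mem)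
  have "matrix (h' y) $ k $ l = matrix (g' (reindex \<sigma> y)) $ \<tau> k $ \<tau> l" for y k l
  proof -
    have "reindex \<sigma> (axis l 1) = axis (\<tau> l) (1::real)"
    proof -
      have "inv \<tau> i = l \<longleftrightarrow> i = \<tau> l" for i using \<tau> by (metis bij_inv_eq_iff)
      then show ?thesis by (simp add: vec_eq_iff axis_def \<sigma>_def)
    qed
    then show ?thesis by (simp add: matrix_def h'_def)
  qed
  then have "matrix (h' y) = (\<chi> k l. matrix (g' (reindex \<sigma> y)) $ \<tau> k $ \<tau> l)" for y
    by (simp add: vec_eq_iff)
  then have det: "det (matrix (h' y)) = det (matrix (g' (reindex \<sigma> y)))" for y
    using det_reindex[OF \<tau>] by simp
  have bl: "bounded_linear (reindex \<tau> :: real^'m \<Rightarrow> _)" "bounded_linear (reindex \<sigma> :: _ \<Rightarrow> real^'m)"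
    by (simp_all add: linear_reindex linear_conv_bounded_linear[symmetric])
  have "(\<integral>\<^sup>+y. ennreal (indicator (h ` ?S) y * f (reindex \<sigma> y)) \<partial>lborel)
    = (\<integral>\<^sup>+y. ennreal (indicator ?S y * (\<bar>det (matrix (h' y))\<bar> * f (reindex \<sigma> (h y)))) \<partial>lborel)"
  proof (rule nn_integral_change_of_variables_wellorder)
    have "?S = reindex \<sigma> -` S \<inter> space borel" by (auto simp: mem)
    then show "?S \<in> sets borel" using measurable_sets[OF measurable_reindex S] by metis
    show "(h has_derivative h' y) (at y within ?S)" if y: "y \<in> ?S" for y
    proof -
      have "reindex \<sigma> ` ?S = S" by (auto simp: image_iff)
      then have "(g has_derivative g' (reindex \<sigma> y)) (at (reindex \<sigma> y) within reindex \<sigma> ` ?S)"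
        using der[of "reindex \<sigma> y"] y by (simp add: mem)
      then have "(g \<circ> reindex \<sigma> has_derivative g' (reindex \<sigma> y) \<circ> reindex \<sigma>) (at y within ?S)"
        by (intro diff_chain_within bounded_linear_imp_has_derivative bl)
      then have "(reindex \<tau> \<circ> (g \<circ> reindex \<sigma>) has_derivative reindex \<tau> \<circ> (g' (reindex \<sigma> y) \<circ> reindex \<sigma>)) (at y within ?S)"
        by (rule diff_chain_within) (intro bounded_linear_imp_has_derivative bl)
      then show ?thesis by (simp add: h_def h'_def o_assoc)
    qed
    show "inj_on h ?S"
      using inj by (auto simp: inj_on_def h_def) (metis \<open>\<And>x. reindex \<sigma> (reindex \<tau> x) = x\<close>)
    show "0 \<le> f (reindex \<sigma> y)" if "y \<in> h ` ?S" for y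
      using that nonneg unfolding hS mem by blast
    show "(\<lambda>y. indicator (h ` ?S) y * f (reindex \<sigma> y)) \<in> borel_measurable borel"
      unfolding hS ind using measurable_compose[OF measurable_reindex F] .
    show "(\<lambda>y. indicator ?S y * (\<bar>det (matrix (h' y))\<bar> * f (reindex \<sigma> (h y)))) \<in> borel_measurable borel"
      unfolding ind det h_def using measurable_compose[OF measurable_reindex P] by simp
  qed
  from this[unfolded hS ind det] show ?thesis
    using nn_integral_reindex[OF \<sigma>, of "\<lambda>y. ennreal (indicator (g ` S) y * f y)"] F
      nn_integral_reindex[OF \<sigma>, of "\<lambda>x. ennreal (indicator S x * (\<bar>det (matrix (g' x))\<bar> * f (g x)))"] P
    by (simp add: h_def)
qed

section \<open>Charts and tangent spaces\<close>

lemma smooth_on_differentiable: "smooth_on S f \<Longrightarrow> x \<in> S \<Longrightarrow> f differentiable (at x)"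
  unfolding smooth_on_def by (metis Ck_on.simps(2))

lemma smooth_on_continuous: "smooth_on S f \<Longrightarrow> continuous_on S f"
  unfolding smooth_on_def by (metis Ck_on.simps(1))

lemma smooth_on_derivative_continuous:
  "smooth_on S f \<Longrightarrow> continuous_on S (\<lambda>x. frechet_derivative f (at x) v)"
  unfolding smooth_on_def by (metis Ck_on.simps)

definition transition_deriv :: "('a, 'm::finite) chart \<Rightarrow> ('a, 'm) chart \<Rightarrow> 'a \<Rightarrow> real^'m \<Rightarrow> real^'m" where
  "transition_deriv c d p = frechet_derivative (snd d \<circ> chart_inv c) (at (snd c p))"

text \<open>Inverse of the coordinate isomorphism that sends a tangent vector \<open>v\<close> to
  \<open>v c\<close>; through it all linear algebra on the tangent space is done in
  \<open>real^'m\<close>.\<close>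

definition chart_vec :: "('a, 'm::finite) riem \<Rightarrow> ('a, 'm) chart \<Rightarrow> 'a \<Rightarrow> real^'m \<Rightarrow> ('a, 'm) tvec" where
  "chart_vec M c p x = (\<lambda>d. if d \<in> charts_at M p then transition_deriv c d p x else 0)"

text \<open>The metric in the coordinates of \<open>c\<close>, but indexed by the point of the
  manifold, so that values in different charts can be compared at the same point.\<close>

definition chart_metric :: "('a, 'm::finite) riem \<Rightarrow> ('a, 'm) chart \<Rightarrow> 'a \<Rightarrow> real^'m \<Rightarrow> real^'m \<Rightarrow> real" where
  "chart_metric M c p u v = metric M p (chart_vec M c p u) (chart_vec M c p v)"

lemma coord_field_eq: "coord_field M c i p = chart_vec M c p (axis i 1)"
  unfolding coord_field_def chart_vec_def transition_deriv_def ..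

lemma charts_atD: "c \<in> charts_at M p \<Longrightarrow> c \<in> atlas M" "c \<in> charts_at M p \<Longrightarrow> p \<in> fst c"
  by (auto simp: charts_at_def)

locale riem_mfd =
  fixes M :: "('a::{t2_space, second_countable_topology}, 'm::finite) riem"
  assumes mfd: "riemannian_manifold M"
begin

lemma chart:
  assumes "c \<in> atlas M"
  shows "open (fst c)" "open (snd c ` fst c)" "continuous_on (fst c) (snd c)"
    "continuous_on (snd c ` fst c) (chart_inv c)"
    "p \<in> fst c \<Longrightarrow> chart_inv c (snd c p) = p"
    "x \<in> snd c ` fst c \<Longrightarrow> snd c (chart_inv c x) = x"
    "x \<in> snd c ` fst c \<Longrightarrow> chart_inv c x \<in> fst c"
proof -
  have c: "is_chart c" using mfd assms by (auto simp: riemannian_manifold_def smooth_atlas_def)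
  then show "open (fst c)" "open (snd c ` fst c)" by (auto simp: is_chart_def)
  have h: "homeomorphism (fst c) (snd c ` fst c) (snd c) (chart_inv c)"
    using c by (simp add: is_chart_def)
  show "continuous_on (fst c) (snd c)" "continuous_on (snd c ` fst c) (chart_inv c)"
    using h by (auto simp: homeomorphism_def)
  show "p \<in> fst c \<Longrightarrow> chart_inv c (snd c p) = p"
    "x \<in> snd c ` fst c \<Longrightarrow> snd c (chart_inv c x) = x"
    "x \<in> snd c ` fst c \<Longrightarrow> chart_inv c x \<in> fst c"
    using h by (auto simp: homeomorphism_def)
qed

lemma charts_at_nonempty: "\<exists>c. c \<in> charts_at M p"
proof -
  have "p \<in> (\<Union>c\<in>atlas M. fst c)"
    using mfd by (auto simp: riemannian_manifold_def smooth_atlas_def)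
  then show ?thesis by (auto simp: charts_at_def)
qed

lemma open_chart_image:
  assumes c: "c \<in> atlas M" and "open U"
  shows "open (snd c ` (fst c \<inter> U))"
proof -
  have "snd c ` (fst c \<inter> U) = snd c ` fst c \<inter> chart_inv c -` U"
    using chart[OF c] by (auto simp: image_iff)
  then show ?thesis
    using continuous_open_preimage[OF chart(4,2)[OF c] \<open>open U\<close>] by (simp add: Int_commute)
qed

lemma transition_smooth:
  "c \<in> atlas M \<Longrightarrow> d \<in> atlas M \<Longrightarrow> smooth_on (snd c ` (fst c \<inter> fst d)) (snd d \<circ> chart_inv c)"
  using mfd by (auto simp: riemannian_manifold_def smooth_atlas_def)

lemma transition_has_derivative:
  assumes "c \<in> charts_at M p" "d \<in> charts_at M p"
  shows "((snd d \<circ> chart_inv c) has_derivative transition_deriv c d p) (at (snd c p))"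
  unfolding transition_deriv_def
  using assms smooth_on_differentiable[OF transition_smooth, of c d "snd c p"]
  by (auto simp: charts_at_def frechet_derivative_works)

lemma linear_transition_deriv:
  "c \<in> charts_at M p \<Longrightarrow> d \<in> charts_at M p \<Longrightarrow> linear (transition_deriv c d p)"
  using transition_has_derivative has_derivative_linear by blast

text \<open>Chain rule for F o c^-1 = (F o d^-1) o (d o c^-1). The map \<open>F\<close> is
  arbitrary, so the same rule yields the cocycle identity for transition derivatives and the change
  of source chart for \<open>f\<close>.\<close>

lemma has_derivative_chart_change:
  assumes c: "c \<in> charts_at M p" and d: "d \<in> charts_at M p"
    and F: "((F \<circ> chart_inv d) has_derivative D) (at (snd d p))"
  shows "((F \<circ> chart_inv c) has_derivative D \<circ> transition_deriv c d p) (at (snd c p))"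
proof -
  note cd = charts_atD[OF c] charts_atD[OF d]
  have *: "(((F \<circ> chart_inv d) \<circ> (snd d \<circ> chart_inv c)) has_derivative D \<circ> transition_deriv c d p) (at (snd c p))"
    by (rule diff_chain_at[OF transition_has_derivative[OF c d]])
      (simp add: chart(5)[OF cd(1,2)] F)
  show ?thesis
  \<comment> \<open>The factorisation holds only on the image of the overlap of the two chart
    domains, which is an open neighbourhood of \<open>snd c p\<close>.\<close>
  proof (rule has_derivative_transform_within_open[OF *])
    show "open (snd c ` (fst c \<inter> fst d))" using cd chart by (intro open_chart_image) auto
    show "snd c p \<in> snd c ` (fst c \<inter> fst d)" using cd by auto
    fix x assume "x \<in> snd c ` (fst c \<inter> fst d)"
    then show "((F \<circ> chart_inv d) \<circ> (snd d \<circ> chart_inv c)) x = (F \<circ> chart_inv c) x"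
      using chart(5)[OF cd(1)] chart(5)[OF cd(3)] by auto
  qed
qed

lemma transition_deriv_refl:
  assumes "c \<in> charts_at M p" shows "transition_deriv c c p x = x"
proof -
  note c = charts_atD[OF assms]
  have "((snd c \<circ> chart_inv c) has_derivative id) (at (snd c p))"
    unfolding id_def
    by (rule has_derivative_transform_within_open[OF has_derivative_ident, where s = "snd c ` fst c"])
      (use c chart[OF c(1)] in auto)
  then show ?thesis
    using has_derivative_unique[OF transition_has_derivative[OF assms assms]] by auto
qed

lemma transition_deriv_trans:
  assumes "c \<in> charts_at M p" "d \<in> charts_at M p" "e \<in> charts_at M p"
  shows "transition_deriv d e p (transition_deriv c d p x) = transition_deriv c e p x"
  using has_derivative_unique[OF transition_has_derivative[OF assms(1,3)]
      has_derivative_chart_change[OF assms(1,2) transition_has_derivative[OF assms(2,3)]]]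
  by (simp add: fun_eq_iff)

text \<open>The compatibility demanded of a tangent vector is exactly the cocycle identity
  \<open>transition_deriv_trans\<close>.\<close>

lemma chart_vec_in_tangent_space: "c \<in> charts_at M p \<Longrightarrow> chart_vec M c p x \<in> tangent_space M p"
  by (auto simp: tangent_space_def chart_vec_def transition_deriv_trans
      simp flip: transition_deriv_def)

lemma chart_vec_self: "c \<in> charts_at M p \<Longrightarrow> chart_vec M c p x c = x"
  by (simp add: chart_vec_def transition_deriv_refl)

lemma chart_vec_of_tangent:
  assumes "c \<in> charts_at M p" "v \<in> tangent_space M p"
  shows "chart_vec M c p (v c) = v"
proof
  fix d
  show "chart_vec M c p (v c) d = v d"
  proof (cases "d \<in> charts_at M p")
    case True
    then have "v d = frechet_derivative (snd d \<circ> chart_inv c) (at (snd c p)) (v c)"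
      using assms unfolding tangent_space_def by blast
    then show ?thesis using True by (simp only: chart_vec_def transition_deriv_def if_True)
  next
    case False
    then have "v d = 0" using assms unfolding tangent_space_def by blast
    then show ?thesis using False by (simp add: chart_vec_def)
  qed
qed

lemma chart_vec_lin:
  assumes "c \<in> charts_at M p"
  shows "chart_vec M c p (a *\<^sub>R x + b *\<^sub>R y) = tlin a (chart_vec M c p x) b (chart_vec M c p y)"
  using linear_transition_deriv[OF assms]
  by (auto simp: fun_eq_iff chart_vec_def tlin_def linear_add linear_scale)

lemma chart_vec_change:
  assumes "c \<in> charts_at M p" "d \<in> charts_at M p"
  shows "chart_vec M d p (transition_deriv c d p x) = chart_vec M c p x"
  using assms by (auto simp: fun_eq_iff chart_vec_def transition_deriv_trans)

lemma chart_vec_inj: "c \<in> charts_at M p \<Longrightarrow> chart_vec M c p x = chart_vec M c p y \<Longrightarrow> x = y"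
  using chart_vec_self by metis

lemma chart_vec_0: "c \<in> charts_at M p \<Longrightarrow> chart_vec M c p 0 = (\<lambda>d. 0)"
  using chart_vec_lin[of c p 0 0 0 0] by (simp add: tlin_def)

lemma inner_form_chart_metric:
  assumes c: "c \<in> charts_at M p"
  shows "inner_form (chart_metric M c p)"
proof -
  have m: "riemannian_metric M" using mfd by (simp add: riemannian_manifold_def)
  note T = chart_vec_in_tangent_space[OF c]
  show ?thesis
    unfolding inner_form_def chart_metric_def
  proof (intro conjI allI impI)
    show "metric M p (chart_vec M c p u) (chart_vec M c p v) = metric M p (chart_vec M c p v) (chart_vec M c p u)" for u v
      using m T unfolding riemannian_metric_def by blast
    show "metric M p (chart_vec M c p (a *\<^sub>R u + b *\<^sub>R v)) (chart_vec M c p w) =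
       a * metric M p (chart_vec M c p u) (chart_vec M c p w) + b * metric M p (chart_vec M c p v) (chart_vec M c p w)"
      for u v w a b
      using m T unfolding riemannian_metric_def chart_vec_lin[OF c] by blast
    show "0 < metric M p (chart_vec M c p v) (chart_vec M c p v)" if "v \<noteq> 0" for v
    proof -
      have "chart_vec M c p v \<noteq> (\<lambda>c. 0)"
        using that chart_vec_inj[OF c, of v 0] by (auto simp: chart_vec_0[OF c])
      then show ?thesis using m T unfolding riemannian_metric_def by blast
    qed
  qed
qed

lemma metric_eq_chart_metric:
  assumes "c \<in> charts_at M p" "u \<in> tangent_space M p" "v \<in> tangent_space M p"
  shows "metric M p u v = chart_metric M c p (u c) (v c)"
  using assms by (simp add: chart_metric_def chart_vec_of_tangent)

lemma chart_metric_change: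
  assumes "c \<in> charts_at M p" "d \<in> charts_at M p"
  shows "chart_metric M c p x y = chart_metric M d p (transition_deriv c d p x) (transition_deriv c d p y)"
  using assms by (simp add: chart_metric_def chart_vec_change)

lemma continuous_on_chart_metric:
  assumes "c \<in> atlas M"
  shows "continuous_on (snd c ` fst c) (\<lambda>x. chart_metric M c (chart_inv c x) (axis i 1) (axis j 1))"
  using mfd assms
  by (auto simp: riemannian_manifold_def riemannian_metric_def coord_field_eq chart_metric_def
      intro!: smooth_on_continuous)

lemma continuous_on_chart_metric':
  assumes "c \<in> atlas M"
  shows "continuous_on (fst c) (\<lambda>p. chart_metric M c p (axis i 1) (axis j 1))"
proof -
  have "continuous_on (fst c) (\<lambda>p. chart_metric M c (chart_inv c (snd c p)) (axis i 1) (axis j 1))"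
    by (rule continuous_on_compose2[OF continuous_on_chart_metric[OF assms] chart(3)[OF assms]]) auto
  then show ?thesis
    by (rule continuous_on_eq) (simp add: chart(5)[OF assms])
qed

text \<open>Second countability enters through Lindelof; it lets local constructions be glued by
  countable sums and countable covers.\<close>

lemma countable_atlas:
  obtains C where "countable C" "C \<subseteq> atlas M" "(\<Union>c\<in>C. fst c) = UNIV"
proof -
  have "\<And>S. S \<in> fst ` atlas M \<Longrightarrow> open S" using chart(1) by auto
  from Lindelof[OF this] obtain F where F: "F \<subseteq> fst ` atlas M" "countable F" "\<Union>F = \<Union>(fst ` atlas M)"
    by blast
  \<comment> \<open>Several charts may share a domain, so one chart is selected for each domain of
    the countable subcover.\<close>
  from F(1) obtain C where C: "C \<subseteq> atlas M" "inj_on fst C" "F = fst ` C"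
    by (auto simp: subset_image_inj)
  have "\<Union>(fst ` atlas M) = UNIV" using charts_at_nonempty by (fastforce simp: charts_at_def)
  then show ?thesis
    using that[of C] C F by (auto dest: countable_image_inj_on)
qed

end

section \<open>The differential in charts\<close>

locale riem_map = M: riem_mfd M + N: riem_mfd N
  for M :: "('a::{t2_space, second_countable_topology}, 'm::finite) riem"
    and N :: "('b::{t2_space, second_countable_topology}, 'n::finite) riem" +
  fixes f :: "'a \<Rightarrow> 'b"
begin

text \<open>The coordinate expression of \<open>f\<close> is meaningful only where \<open>f\<close>
  stays in the target chart; continuity guarantees this near p.\<close>

lemma eventually_in_chart:
  assumes "isCont f p" "c \<in> charts_at M p" "d \<in> charts_at N (f p)"
  shows "\<forall>\<^sub>F x in nhds (snd c p). f (chart_inv c x) \<in> fst d"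
proof -
  note c = charts_atD[OF assms(2)] and d = charts_atD[OF assms(3)]
  have "isCont (chart_inv c) (snd c p)"
    using M.chart(2,4)[OF c(1)] c(2) by (auto simp: continuous_on_eq_continuous_at)
  then have "isCont (\<lambda>x. f (chart_inv c x)) (snd c p)"
  proof (rule isCont_o2)
    show "isCont f (chart_inv c (snd c p))" using assms(1) M.chart(5)[OF c] by (simp only:)
  qed
  then have "((\<lambda>x. f (chart_inv c x)) \<longlongrightarrow> f p) (nhds (snd c p))"
    using M.chart(5)[OF c] tendsto_at_iff_tendsto_nhds[of "\<lambda>x. f (chart_inv c x)" "snd c p"]
    by (simp add: isCont_def)
  then show ?thesis
    using N.chart(1)[OF d(1)] d(2) by (rule topological_tendstoD)
qed

lemma has_derivative_target_chart_change:
  assumes f: "isCont f p" and c: "c \<in> charts_at M p"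
    and d: "d \<in> charts_at N (f p)" and e: "e \<in> charts_at N (f p)"
    and D: "((snd d \<circ> f \<circ> chart_inv c) has_derivative D) (at (snd c p))"
  shows "((snd e \<circ> f \<circ> chart_inv c) has_derivative transition_deriv d e (f p) \<circ> D) (at (snd c p))"
proof -
  have fp: "f (chart_inv c (snd c p)) = f p" using M.chart(5) charts_atD[OF c] by simp
  have *: "(((snd e \<circ> chart_inv d) \<circ> (snd d \<circ> f \<circ> chart_inv c)) has_derivative transition_deriv d e (f p) \<circ> D) (at (snd c p))"
    by (rule diff_chain_at[OF D]) (simp add: fp N.transition_has_derivative[OF d e])
  have ev: "\<forall>\<^sub>F x in nhds (snd c p). ((snd e \<circ> chart_inv d) \<circ> (snd d \<circ> f \<circ> chart_inv c)) x
      = (snd e \<circ> f \<circ> chart_inv c) x"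
    using eventually_in_chart[OF f c d] by eventually_elim (simp add: N.chart(5)[OF charts_atD(1)[OF d]])
  show ?thesis
    by (rule has_derivative_transform_eventually[OF *])
      (use ev in \<open>auto simp: eventually_nhds_conv_at\<close>)
qed

text \<open>The chain rules for source and target charts carry differentiability from one pair of
  charts to every other. This makes it a condition testable in one fixed pair, as the measurability
  argument requires.\<close>

lemma mfd_differentiable_iff:
  assumes f: "isCont f p" and c: "c \<in> charts_at M p" and d: "d \<in> charts_at N (f p)"
  shows "mfd_differentiable M N f p \<longleftrightarrow> (snd d \<circ> f \<circ> chart_inv c) differentiable (at (snd c p))"
proof
  assume "(snd d \<circ> f \<circ> chart_inv c) differentiable (at (snd c p))"
  then obtain D where D: "((snd d \<circ> f \<circ> chart_inv c) has_derivative D) (at (snd c p))"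
    by (auto simp: differentiable_def)
  show "mfd_differentiable M N f p"
    unfolding mfd_differentiable_def
  proof (intro conjI ballI f)
    fix c' e assume c': "c' \<in> charts_at M p" and e: "e \<in> charts_at N (f p)"
    have "((snd e \<circ> f \<circ> chart_inv c) has_derivative transition_deriv d e (f p) \<circ> D) (at (snd c p))"
      by (rule has_derivative_target_chart_change[OF f c d e D])
    from M.has_derivative_chart_change[OF c' c this]
    show "(snd e \<circ> f \<circ> chart_inv c') differentiable (at (snd c' p))"
      unfolding differentiable_def by blast
  qed
qed (use c d in \<open>auto simp: mfd_differentiable_def\<close>)

text \<open>\<open>differential\<close> uses a source chart picked by \<open>SOME\<close>. Computing
  the derivative in the charts \<open>c\<close>, \<open>e\<close> once through \<open>d\<close> and
  once through the picked chart shows that the choice is immaterial.\<close>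

lemma differential_chart_vec:
  assumes diff: "mfd_differentiable M N f p"
    and c: "c \<in> charts_at M p" and d: "d \<in> charts_at N (f p)"
  shows "differential M N f p (chart_vec M c p x)
    = chart_vec N d (f p) (frechet_derivative (snd d \<circ> f \<circ> chart_inv c) (at (snd c p)) x)"
proof
  fix e
  have f: "isCont f p" using diff by (simp add: mfd_differentiable_def)
  define c' where "c' = (SOME c. c \<in> charts_at M p)"
  have c': "c' \<in> charts_at M p" unfolding c'_def using c by (rule someI)
  show "differential M N f p (chart_vec M c p x) e
    = chart_vec N d (f p) (frechet_derivative (snd d \<circ> f \<circ> chart_inv c) (at (snd c p)) x) e"
  proof (cases "e \<in> charts_at N (f p)")
    case True
    let ?D = "\<lambda>d c. frechet_derivative (snd d \<circ> f \<circ> chart_inv c) (at (snd c p))"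
    have D: "((snd d \<circ> f \<circ> chart_inv c) has_derivative ?D d c) (at (snd c p))"
      if "d \<in> charts_at N (f p)" "c \<in> charts_at M p" for c d
      using diff that by (auto simp: mfd_differentiable_def frechet_derivative_works)
    have "?D e c = transition_deriv d e (f p) \<circ> ?D d c"
      by (rule has_derivative_unique[OF D[OF True c]
            has_derivative_target_chart_change[OF f c d True D[OF d c]]])
    moreover have "?D e c = ?D e c' \<circ> transition_deriv c c' p"
      by (rule has_derivative_unique[OF D[OF True c]
            M.has_derivative_chart_change[OF c c', of "snd e \<circ> f", unfolded o_assoc, OF D[OF True c']]])
    ultimately show ?thesis
      using True c' diff
      by (auto simp: differential_def chart_vec_def Let_def c'_def[symmetric] fun_eq_iff)
  qed (simp add: differential_def chart_vec_def)
qed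

lemma differential_not_differentiable:
  "\<not> mfd_differentiable M N f p \<Longrightarrow> differential M N f p v = (\<lambda>d. 0)"
  by (simp add: differential_def)

end

section \<open>The Riemannian measure\<close>

text \<open>Exchange of a nonnegative double series, with the outer sum read as an integral for
  counting measure.\<close>

lemma (in sigma_algebra) countably_additive_suminf:
  assumes "\<And>n::nat. countably_additive M (\<nu> n)"
  shows "countably_additive M (\<lambda>A. \<Sum>n. \<nu> n A)"
  unfolding countably_additive_def
proof (intro allI impI)
  fix A :: "nat \<Rightarrow> 'a set"
  assume "range A \<subseteq> M" "disjoint_family A" "(\<Union>i. A i) \<in> M"
  then have eq: "(\<Sum>i. \<nu> n (A i)) = \<nu> n (\<Union>i. A i)" for n
    using assms[of n] by (simp add: countably_additive_def)
  have "(\<integral>\<^sup>+n. (\<Sum>i. \<nu> n (A i)) \<partial>count_space UNIV) = (\<Sum>i. \<integral>\<^sup>+n. \<nu> n (A i) \<partial>count_space UNIV)"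
    by (rule nn_integral_suminf) simp
  then show "(\<Sum>i. \<Sum>n. \<nu> n (A i)) = (\<Sum>n. \<nu> n (\<Union>i. A i))"
    by (simp only: nn_integral_count_space_nat eq)
qed

context riem_mfd
begin

definition gram :: "('a, 'm) chart \<Rightarrow> 'a \<Rightarrow> real^'m^'m" where
  "gram c p = (\<chi> i j. chart_metric M c p (axis i 1) (axis j 1))"

definition vol_density :: "('a, 'm) chart \<Rightarrow> real^'m \<Rightarrow> real" where
  "vol_density c x = sqrt (det (gram c (chart_inv c x)))"

definition chart_volume :: "('a, 'm) chart \<Rightarrow> 'a set \<Rightarrow> ennreal" where
  "chart_volume c B = (\<integral>\<^sup>+x\<in>snd c ` B. ennreal (vol_density c x) \<partial>lborel)"

lemma rvol_eq_chart_volume: "rvol M = (THE \<mu>. sets \<mu> = sets borel \<and>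
     (\<forall>c\<in>atlas M. \<forall>B\<in>sets borel. B \<subseteq> fst c \<longrightarrow> emeasure \<mu> B = chart_volume c B))"
  unfolding rvol_def chart_volume_def vol_density_def gram_def chart_metric_def coord_field_eq ..

lemma continuous_on_vol_density:
  assumes "c \<in> atlas M" shows "continuous_on (snd c ` fst c) (vol_density c)"
  unfolding vol_density_def gram_def det_def
  by (auto intro!: continuous_intros continuous_on_chart_metric assms)

lemma chart_measurable:
  assumes "c \<in> atlas M" shows "snd c \<in> borel_measurable (restrict_space borel (fst c))"
  using chart(3)[OF assms] by (rule borel_measurable_continuous_on_restrict)

lemma chart_inv_measurable:
  assumes "c \<in> atlas M"
  shows "chart_inv c \<in> measurable (restrict_space borel (snd c ` fst c)) (restrict_space borel (fst c))"
  using chart(4)[OF assms] chart(7)[OF assms]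
  by (auto simp: measurable_restrict_space2_iff space_restrict_space
      intro!: borel_measurable_continuous_on_restrict)

lemma fst_chart_borel: "c \<in> atlas M \<Longrightarrow> fst c \<in> sets borel"
  using chart(1) by auto

text \<open>The image under a chart is the preimage under the continuous inverse chart.\<close>

lemma chart_image_borel:
  assumes c: "c \<in> atlas M" and B: "B \<in> sets borel" "B \<subseteq> fst c"
  shows "snd c ` B \<in> sets borel"
proof -
  have "snd c ` B = chart_inv c -` B \<inter> snd c ` fst c"
    using chart[OF c] B(2) by (auto simp: image_iff)
  moreover have "B \<in> sets (restrict_space borel (fst c))"
    using B fst_chart_borel[OF c] by (simp add: sets_restrict_space_iff)
  ultimately have "snd c ` B \<in> sets (restrict_space borel (snd c ` fst c))"
    using measurable_sets[OF chart_inv_measurable[OF c]] by (simp add: space_restrict_space)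
  then show ?thesis using chart(2)[OF c] by (simp add: sets_restrict_space_iff)
qed

text \<open>With A the Jacobian matrix of the transition, the Gram matrix in \<open>c\<close> is the
  transpose of A times the Gram matrix in \<open>d\<close> times A; the determinant picks up (det
  A)^2, whose root is \<bar>det A\<bar>.\<close>

lemma vol_density_change:
  assumes c: "c \<in> charts_at M p" and d: "d \<in> charts_at M p"
  shows "vol_density c (snd c p) = \<bar>det (matrix (transition_deriv c d p))\<bar> * vol_density d (snd d p)"
proof -
  let ?T = "transition_deriv c d p"
  define A where "A = matrix ?T"
  have TA: "?T (axis i 1) = (\<Sum>k\<in>UNIV. A $ k $ i *\<^sub>R axis k 1)" for i
    using vec_expansion[of "?T (axis i 1)"] by (simp add: A_def matrix_def)
  note d' = inner_form_chart_metric[OF d]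
  have "gram c p = transpose A ** gram d p ** A"
  proof (simp add: vec_eq_iff, intro allI)
    fix i j
    have "gram c p $ i $ j = chart_metric M d p (?T (axis i 1)) (?T (axis j 1))"
      by (simp add: gram_def chart_metric_change[OF c d])
    also have "\<dots> = (\<Sum>k\<in>UNIV. A $ k $ i * (\<Sum>l\<in>UNIV. A $ l $ j * gram d p $ k $ l))"
      unfolding TA[of i] inner_form_sum_left[OF d'] TA[of j]
      by (simp only: inner_form_sum_right[OF d']) (simp add: gram_def)
    also have "\<dots> = (\<Sum>l\<in>UNIV. \<Sum>k\<in>UNIV. A $ k $ i * (A $ l $ j * gram d p $ k $ l))"
      unfolding sum_distrib_left by (rule sum.swap)
    also have "\<dots> = (transpose A ** gram d p ** A) $ i $ j"
      by (simp add: matrix_matrix_mult_def transpose_def sum_distrib_left sum_distrib_right mult_ac)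
    finally show "gram c p $ i $ j = (transpose A ** gram d p ** A) $ i $ j" .
  qed
  then have "det (gram c p) = (det A)\<^sup>2 * det (gram d p)"
    by (simp add: det_mul power2_eq_square)
  then show ?thesis
    using chart(5) charts_atD[OF c] charts_atD[OF d] by (simp add: vol_density_def A_def real_sqrt_mult)
qed

text \<open>Change of variables along the transition map: its Jacobian is exactly the factor between
  the two densities.\<close>

lemma chart_volume_change:
  assumes c: "c \<in> atlas M" and d: "d \<in> atlas M" and B: "B \<in> sets borel" "B \<subseteq> fst c \<inter> fst d"
  shows "chart_volume c B = chart_volume d B"
proof -
  let ?g = "snd d \<circ> chart_inv c" and ?S = "snd c ` B"
  let ?g' = "\<lambda>x. transition_deriv c d (chart_inv c x)"
  \<comment> \<open>\<open>ennreal\<close> sends negative numbers to 0, so truncation at 0 leaves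
    the integrals as they are and supplies the nonnegative integrand for the change of
    variables.\<close>
  let ?v = "\<lambda>c x. max 0 (vol_density c x)"
  have gS: "?g ` ?S = snd d ` B" using B(2) chart(5)[OF c] by (force simp: image_iff)
  have inv: "chart_inv c (snd c p) = p" if "p \<in> B" for p using that B(2) chart(5)[OF c] by auto
  have at: "c \<in> charts_at M (chart_inv c x)" "d \<in> charts_at M (chart_inv c x)"
      "snd c (chart_inv c x) = x" "chart_inv c x \<in> B" if "x \<in> ?S" for x
    using that c d B(2) inv by (auto simp: charts_at_def)
  have ind: "(\<lambda>x. indicator (snd c ` B) x * ?v c x) \<in> borel_measurable borel" if "c \<in> atlas M" "B \<subseteq> fst c" for c
    using borel_measurable_continuous_on_indicator[OF chart_image_borel[OF that(1) B(1) that(2)]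
        continuous_on_max[OF continuous_on_const continuous_on_subset[OF continuous_on_vol_density[OF that(1)]]],
        of 0] that(2)
    by (simp add: image_mono)
  have eq: "?v c x = \<bar>det (matrix (?g' x))\<bar> * ?v d (?g x)" if "x \<in> ?S" for x
    using vol_density_change[OF at(1,2)[OF that]] at(3)[OF that]
    by (simp add: max_mult_distrib_left)
  have eq': "indicator ?S x * (\<bar>det (matrix (?g' x))\<bar> * ?v d (?g x)) = indicator ?S x * ?v c x" for x
  proof (cases "x \<in> ?S")
    case True
    then show ?thesis by (simp only: eq)
  qed simp
  have "(\<integral>\<^sup>+y. ennreal (indicator (?g ` ?S) y * ?v d y) \<partial>lborel)
     = (\<integral>\<^sup>+x. ennreal (indicator ?S x * (\<bar>det (matrix (?g' x))\<bar> * ?v d (?g x))) \<partial>lborel)"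
  proof (rule nn_integral_change_of_variables)
    show "?S \<in> sets borel" using B by (intro chart_image_borel c) auto
    show "(?g has_derivative ?g' x) (at x within ?S)" if "x \<in> ?S" for x
      using transition_has_derivative[OF at(1,2)[OF that]] at(3)[OF that]
      by (simp add: has_derivative_at_withinI)
    show "inj_on ?g ?S"
    proof (rule inj_onI)
      fix x y assume xy: "x \<in> ?S" "y \<in> ?S" "?g x = ?g y"
      have inv': "chart_inv d (snd d (chart_inv c z)) = chart_inv c z" if "z \<in> ?S" for z
        using at(4)[OF that] B(2) by (intro chart(5)[OF d]) auto
      from arg_cong[OF xy(3), of "chart_inv d"] have "chart_inv c x = chart_inv c y"
        unfolding comp_apply inv'[OF xy(1)] inv'[OF xy(2)] .
      then have "snd c (chart_inv c x) = snd c (chart_inv c y)" by (simp only:)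
      then show "x = y" unfolding at(3)[OF xy(1)] at(3)[OF xy(2)] .
    qed
    show "(\<lambda>y. indicator (?g ` ?S) y * ?v d y) \<in> borel_measurable borel"
      unfolding gS using B by (intro ind d) auto
    show "(\<lambda>x. indicator ?S x * (\<bar>det (matrix (?g' x))\<bar> * ?v d (?g x))) \<in> borel_measurable borel"
      unfolding eq' using B by (intro ind c) auto
  qed simp
  moreover have "ennreal (indicator T y * ?v e y) = ennreal (vol_density e y) * indicator T y" for T e y
    by (cases "y \<in> T"; cases "0 \<le> vol_density e y") (simp_all add: ennreal_neg)
  ultimately show ?thesis unfolding chart_volume_def gS eq' by (simp only:)
qed

text \<open>Intersecting with a fixed piece \<open>D\<close> of the chart domain turns the chart
  volume into a set function on all Borel sets, ready to be summed over pieces. Injectivity of the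
  chart keeps the images disjoint.\<close>

lemma chart_volume_countably_additive:
  assumes c: "c \<in> atlas M" and D: "D \<in> sets borel" "D \<subseteq> fst c"
  shows "countably_additive (sets borel) (\<lambda>B. chart_volume c (B \<inter> D))"
  unfolding countably_additive_def
proof (intro allI impI)
  fix A :: "nat \<Rightarrow> 'a set"
  assume A: "range A \<subseteq> sets borel" "disjoint_family A"
  let ?h = "\<lambda>x. ennreal (vol_density c x)"
  have m: "(\<lambda>x. ?h x * indicator (snd c ` (B \<inter> D)) x) \<in> borel_measurable lborel" if "B \<in> sets borel" for B
  proof -
    have "snd c ` (B \<inter> D) \<in> sets borel" using D that by (intro chart_image_borel c) auto
    moreover have "continuous_on (snd c ` (B \<inter> D)) (vol_density c)"
      using D by (intro continuous_on_subset[OF continuous_on_vol_density[OF c]]) auto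
    ultimately have "(\<lambda>x. indicator (snd c ` (B \<inter> D)) x *\<^sub>R vol_density c x) \<in> borel_measurable borel"
      by (rule borel_measurable_continuous_on_indicator)
    then have "(\<lambda>x. ennreal (indicator (snd c ` (B \<inter> D)) x *\<^sub>R vol_density c x)) \<in> borel_measurable borel"
      by simp
    also have "(\<lambda>x. ennreal (indicator (snd c ` (B \<inter> D)) x *\<^sub>R vol_density c x))
        = (\<lambda>x. ?h x * indicator (snd c ` (B \<inter> D)) x)"
      by (auto simp: indicator_def)
    finally show ?thesis by simp
  qed
  have "inj_on (snd c) (fst c)" using chart(5)[OF c] by (metis inj_onI)
  then have dis: "disjoint_family (\<lambda>i. snd c ` (A i \<inter> D))"
    using A(2) D(2) unfolding disjoint_family_on_def inj_on_def by blast
  have "(\<Sum>i. chart_volume c (A i \<inter> D))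
      = (\<integral>\<^sup>+x. (\<Sum>i. ?h x * indicator (snd c ` (A i \<inter> D)) x) \<partial>lborel)"
    unfolding chart_volume_def using A(1) by (intro nn_integral_suminf[symmetric] m) auto
  also have "\<dots> = (\<integral>\<^sup>+x. ?h x * indicator (snd c ` ((\<Union>i. A i) \<inter> D)) x \<partial>lborel)"
  proof -
    have "(\<Union>i. snd c ` (A i \<inter> D)) = snd c ` ((\<Union>i. A i) \<inter> D)" by auto
    then show ?thesis by (simp add: suminf_indicator[OF dis])
  qed
  finally show "(\<Sum>i. chart_volume c (A i \<inter> D)) = chart_volume c ((\<Union>i. A i) \<inter> D)"
    unfolding chart_volume_def .
qed

text \<open>Every point is assigned to the first chart, in an enumeration of a countable cover,
  whose domain contains it.\<close>

lemma chart_partition: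
  obtains c :: "nat \<Rightarrow> ('a, 'm) chart" and D where "\<And>n. c n \<in> atlas M" "(\<Union>n. fst (c n)) = UNIV"
    "\<And>n. D n \<in> sets borel" "\<And>n. D n \<subseteq> fst (c n)" "disjoint_family D" "(\<Union>n. D n) = UNIV"
proof -
  obtain C where C: "countable C" "C \<subseteq> atlas M" "(\<Union>c\<in>C. fst c) = UNIV"
    by (rule countable_atlas)
  then have "C \<noteq> {}" by auto
  define c where "c = from_nat_into C"
  have c: "range c = C" unfolding c_def using C(1) \<open>C \<noteq> {}\<close> by (rule range_from_nat_into[rotated])
  define D where "D = disjointed (\<lambda>n. fst (c n))"
  have ca: "c n \<in> atlas M" for n using c C(2) by auto
  have "D n \<in> sets borel" for n
    unfolding D_def using sets.range_disjointed_sets[of "\<lambda>n. fst (c n)" borel] ca fst_chart_borel by blast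
  moreover have "(\<Union>n. fst (c n)) = UNIV" using C(3) by (simp flip: c)
  ultimately show ?thesis
    using that[of c D] ca disjointed_subset[of "\<lambda>n. fst (c n)"]
      disjoint_family_disjointed[of "\<lambda>n. fst (c n)"] UN_disjointed_eq[of "\<lambda>n. fst (c n)"]
    by (simp add: D_def)
qed

text \<open>Existence: add up the chart volumes over a countable Borel partition into pieces of
  chart domains; inside any other chart \<open>d\<close> each summand may be recomputed with
  \<open>d\<close>. Uniqueness: the prescribed values on the pieces determine the measure by
  countable additivity.\<close>

lemma rvol_unique_existence:
  "\<exists>!\<mu>. sets \<mu> = sets borel \<and>
     (\<forall>c\<in>atlas M. \<forall>B\<in>sets borel. B \<subseteq> fst c \<longrightarrow> emeasure \<mu> B = chart_volume c B)"
proof -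
  obtain c :: "nat \<Rightarrow> ('a, 'm) chart" and D where c: "\<And>n. c n \<in> atlas M"
    and D: "\<And>n. D n \<in> sets borel" "\<And>n. D n \<subseteq> fst (c n)" "disjoint_family D" "(\<Union>n. D n) = UNIV"
    by (rule chart_partition) blast
  let ?\<mu> = "\<lambda>B. \<Sum>n. chart_volume (c n) (B \<inter> D n)"
  have alg: "sigma_algebra UNIV (sets (borel :: 'a measure))"
    using sets.sigma_algebra_axioms[of "borel :: 'a measure"] by simp
  have "countably_additive (sets borel) ?\<mu>"
    by (intro sigma_algebra.countably_additive_suminf[OF alg] chart_volume_countably_additive c D)
  then have \<mu>: "emeasure (measure_of UNIV (sets borel) ?\<mu>) B = ?\<mu> B" if "B \<in> sets borel" for B
    by (intro emeasure_measure_of_sigma alg that) (auto simp: positive_def chart_volume_def)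
  show ?thesis
  proof (rule ex1I[of _ "measure_of UNIV (sets borel) ?\<mu>"], intro conjI ballI impI)
    show "sets (measure_of UNIV (sets borel) ?\<mu>) = sets borel"
      using sets.sigma_sets_eq[of "borel :: 'a measure"] by simp
    fix d B assume d: "d \<in> atlas M" and B: "B \<in> sets borel" "B \<subseteq> fst d"
    have "emeasure (measure_of UNIV (sets borel) ?\<mu>) B = ?\<mu> B" by (rule \<mu>[OF B(1)])
    also have "\<dots> = (\<Sum>n. chart_volume d (B \<inter> D n))"
      using B D(1,2) by (intro suminf_cong chart_volume_change c d) auto
    \<comment> \<open>Intersecting once more with \<open>B\<close> brings the sum into the form of
      countable additivity for the piece \<open>B\<close> of the chart \<open>d\<close>.\<close>
    also have "\<dots> = (\<Sum>n. chart_volume d ((B \<inter> D n) \<inter> B))"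
      by (simp add: Int_commute Int_left_commute)
    also have "\<dots> = chart_volume d ((\<Union>n. B \<inter> D n) \<inter> B)"
    proof -
      have "range (\<lambda>n. B \<inter> D n) \<subseteq> sets borel" "disjoint_family (\<lambda>n. B \<inter> D n)"
        "(\<Union>n. B \<inter> D n) \<in> sets borel"
        using B(1) D(1,3) by (auto simp: disjoint_family_on_def)
      then show ?thesis
        using chart_volume_countably_additive[OF d B] unfolding countably_additive_def by blast
    qed
    also have "(\<Union>n. B \<inter> D n) \<inter> B = B" using D(4) by auto
    finally show "emeasure (measure_of UNIV (sets borel) ?\<mu>) B = chart_volume d B" .
  next
    fix \<nu> assume \<nu>: "sets \<nu> = sets borel \<and>
      (\<forall>c\<in>atlas M. \<forall>B\<in>sets borel. B \<subseteq> fst c \<longrightarrow> emeasure \<nu> B = chart_volume c B)"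
    show "\<nu> = measure_of UNIV (sets borel) ?\<mu>"
    proof (rule measure_eqI)
      show "sets \<nu> = sets (measure_of UNIV (sets borel) ?\<mu>)"
        using \<nu> sets.sigma_sets_eq[of "borel :: 'a measure"] by simp
      fix B assume "B \<in> sets \<nu>"
      then have B: "B \<in> sets borel" using \<nu> by simp
      have "emeasure \<nu> B = emeasure \<nu> (\<Union>n. B \<inter> D n)" using D(4) by (simp flip: Int_UN_distrib)
      also have "\<dots> = (\<Sum>n. emeasure \<nu> (B \<inter> D n))"
      proof (rule suminf_emeasure[symmetric])
        show "range (\<lambda>n. B \<inter> D n) \<subseteq> sets \<nu>" using \<nu> B D(1) by auto
        show "disjoint_family (\<lambda>n. B \<inter> D n)" using D(3) unfolding disjoint_family_on_def by blast
      qed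
      also have "\<dots> = ?\<mu> B"
      proof (intro suminf_cong)
        fix n
        have "B \<inter> D n \<in> sets borel" "B \<inter> D n \<subseteq> fst (c n)" using B D(1,2) by auto
        then show "emeasure \<nu> (B \<inter> D n) = chart_volume (c n) (B \<inter> D n)" using \<nu> c by blast
      qed
      also have "\<dots> = emeasure (measure_of UNIV (sets borel) ?\<mu>) B"
        by (rule \<mu>[OF B, symmetric])
      finally show "emeasure \<nu> B = emeasure (measure_of UNIV (sets borel) ?\<mu>) B" .
    qed
  qed
qed

lemma sets_rvol [simp, measurable_cong]: "sets (rvol M) = sets borel"
  and emeasure_rvol: "c \<in> atlas M \<Longrightarrow> B \<in> sets borel \<Longrightarrow> B \<subseteq> fst c \<Longrightarrow> emeasure (rvol M) B = chart_volume c B"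
  using theI'[OF rvol_unique_existence] unfolding rvol_eq_chart_volume[symmetric] by blast+

lemma space_rvol [simp]: "space (rvol M) = UNIV"
  using sets_eq_imp_space_eq[OF sets_rvol] by simp

text \<open>On the part of a chart domain where coordinates and density are both at most k, the
  measure is at most k times the volume of a ball. Countably many charts and all k exhaust the
  manifold.\<close>

lemma sigma_finite_rvol: "sigma_finite_measure (rvol M)"
proof -
  obtain C where C: "countable C" "C \<subseteq> atlas M" "(\<Union>c\<in>C. fst c) = UNIV"
    by (rule countable_atlas)
  let ?A = "\<lambda>c (k::nat). {p \<in> fst c. norm (snd c p) \<le> real k \<and> vol_density c (snd c p) \<le> real k}"
  have borel: "?A c k \<in> sets borel" if c: "c \<in> atlas M" for c k
  proof -
    have "continuous_on (fst c) (\<lambda>p. vol_density c (snd c p))"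
      by (rule continuous_on_compose2[OF continuous_on_vol_density[OF c] chart(3)[OF c]]) auto
    then have [measurable]: "(\<lambda>p. vol_density c (snd c p)) \<in> borel_measurable (restrict_space borel (fst c))"
      by (rule borel_measurable_continuous_on_restrict)
    note [measurable] = chart_measurable[OF c]
    have "{p \<in> space (restrict_space borel (fst c)). norm (snd c p) \<le> real k \<and> vol_density c (snd c p) \<le> real k}
        \<in> sets (restrict_space borel (fst c))" by measurable
    then show ?thesis using fst_chart_borel[OF c] by (simp add: space_restrict_space sets_restrict_space_iff)
  qed
  have fin: "emeasure (rvol M) (?A c k) \<noteq> \<infinity>" if c: "c \<in> atlas M" for c k
  proof -
    have "emeasure (rvol M) (?A c k) = chart_volume c (?A c k)"
      by (rule emeasure_rvol[OF c borel[OF c]]) auto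
    also have "\<dots> \<le> (\<integral>\<^sup>+x. ennreal (real k) * indicator (cball (0::real^'m) (real k)) x \<partial>lborel)"
      unfolding chart_volume_def
      by (rule nn_integral_mono) (auto simp: indicator_def intro!: ennreal_leI)
    also have "\<dots> = ennreal (real k) * emeasure lborel (cball (0::real^'m) (real k))"
      by (simp add: nn_integral_cmult_indicator)
    also have "\<dots> < \<infinity>"
      using emeasure_lborel_cball_finite[of "0::real^'m" "real k"] by (simp add: ennreal_mult_less_top)
    finally show ?thesis by simp
  qed
  have cover: "(\<Union>c\<in>C. \<Union>k. ?A c k) = UNIV"
  proof (intro equalityI subsetI UNIV_I)
    fix p :: 'a
    obtain c where c: "c \<in> C" "p \<in> fst c" using C(3) by blast
    obtain k :: nat where "max (norm (snd c p)) (vol_density c (snd c p)) \<le> real k"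
      using real_arch_simple by blast
    then show "p \<in> (\<Union>c\<in>C. \<Union>k. ?A c k)" using c by auto
  qed
  show ?thesis
  proof (intro sigma_finite_measure.intro exI[of _ "\<Union>c\<in>C. range (?A c)"] conjI ballI)
    show "countable (\<Union>c\<in>C. range (?A c))" using C(1) by simp
    show "(\<Union>c\<in>C. range (?A c)) \<subseteq> sets (rvol M)"
      unfolding sets_rvol using borel subsetD[OF C(2)] by blast
    show "\<Union>(\<Union>c\<in>C. range (?A c)) = space (rvol M)"
      unfolding space_rvol cover[symmetric] by blast
    fix a assume "a \<in> (\<Union>c\<in>C. range (?A c))"
    then show "emeasure (rvol M) a \<noteq> \<infinity>" using fin subsetD[OF C(2)] by blast
  qed
qed

end

section \<open>The Riemannian distance in charts\<close>

text \<open>Nonnegativity at u - t v, with \<open>t\<close> the minimiser of this quadratic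
  expression.\<close>

lemma inner_form_Cauchy_Schwarz:
  assumes "inner_form G" shows "(G u v)\<^sup>2 \<le> G u u * G v v"
proof (cases "v = 0")
  case True
  then show ?thesis by (simp add: inner_form_zero[OF assms])
next
  case False
  then have pos: "0 < G v v" by (rule inner_form_pos[OF assms])
  define t where "t = G u v / G v v"
  note lin = linear_diff[OF inner_form_linear_left[OF assms]] linear_diff[OF inner_form_linear_right[OF assms]]
    linear_scale[OF inner_form_linear_left[OF assms]] linear_scale[OF inner_form_linear_right[OF assms]]
  have "0 \<le> G (u - t *\<^sub>R v) (u - t *\<^sub>R v)" by (rule inner_form_nonneg[OF assms])
  also have "\<dots> = G u u - t * G u v - (t * G u v - t * (t * G v v))"
    by (simp add: lin inner_form_sym[OF assms, of v u] algebra_simps)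
  also have "t * G v v = G u v" using pos by (simp add: t_def)
  finally have "t * G u v \<le> G u u" by simp
  then show ?thesis using pos by (simp add: t_def power2_eq_square field_simps)
qed

text \<open>Homogeneity reduces the claim to the unit sphere, where compactness gives a minimum and
  a maximum at nonzero vectors.\<close>

lemma inner_form_norm_equiv:
  fixes G :: "real^'m \<Rightarrow> real^'m \<Rightarrow> real"
  assumes "inner_form G"
  obtains l L where "0 < l" "0 < L" "\<And>y. l * (norm y)\<^sup>2 \<le> G y y" "\<And>y. G y y \<le> L * (norm y)\<^sup>2"
proof -
  let ?S = "sphere (0::real^'m) 1"
  have cont: "continuous_on ?S (\<lambda>y. G y y)"
    by (subst inner_form_expand[OF assms]) (intro continuous_intros)
  have ne: "?S \<noteq> {}" by simp
  obtain a where a: "a \<in> ?S" "\<And>y. y \<in> ?S \<Longrightarrow> G a a \<le> G y y"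
    using continuous_attains_inf[OF compact_sphere ne cont] by blast
  obtain b where b: "b \<in> ?S" "\<And>y. y \<in> ?S \<Longrightarrow> G y y \<le> G b b"
    using continuous_attains_sup[OF compact_sphere ne cont] by blast
  have "a \<noteq> 0" "b \<noteq> 0" using a(1) b(1) by auto
  have *: "G a a * (norm y)\<^sup>2 \<le> G y y \<and> G y y \<le> G b b * (norm y)\<^sup>2" for y
  proof (cases "y = 0")
    case True
    then show ?thesis by (simp add: inner_form_zero[OF assms])
  next
    case False
    define z where "z = (1 / norm y) *\<^sub>R y"
    have z: "z \<in> ?S" "y = norm y *\<^sub>R z" using False by (simp_all add: z_def)
    have "G y y = (norm y)\<^sup>2 * G z z"
      by (subst z(2), subst (2) z(2))
        (simp add: linear_scale[OF inner_form_linear_left[OF assms]]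
          linear_scale[OF inner_form_linear_right[OF assms]] power2_eq_square)
    then show ?thesis
      using mult_right_mono[OF a(2)[OF z(1)], of "(norm y)\<^sup>2"]
        mult_right_mono[OF b(2)[OF z(1)], of "(norm y)\<^sup>2"] by (simp add: mult.commute)
  qed
  show ?thesis
    using that[of "G a a" "G b b"] inner_form_pos[OF assms] \<open>a \<noteq> 0\<close> \<open>b \<noteq> 0\<close> * by blast
qed

context riem_mfd
begin

text \<open>The entries of the metric are continuous, and the fixed form at p dominates a multiple
  of the Euclidean norm. This makes the error relative to the form at p, so lengths compare by
  factors close to 1.\<close>

lemma local_metric_comparison:
  assumes d: "d \<in> charts_at M p" and \<epsilon>: "0 < \<epsilon>" and W: "open W" "p \<in> W"
  obtains r where "0 < r" "cball (snd d p) r \<subseteq> snd d ` (fst d \<inter> W)"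
    "\<And>x y. x \<in> cball (snd d p) r \<Longrightarrow>
       \<bar>chart_metric M d (chart_inv d x) y y - chart_metric M d p y y\<bar> \<le> \<epsilon> * chart_metric M d p y y"
proof -
  note dM = charts_atD[OF d]
  let ?x0 = "snd d p"
  let ?H = "\<lambda>x. chart_metric M d (chart_inv d x)"
  obtain l where l: "0 < l" "\<And>y. l * (norm y)\<^sup>2 \<le> chart_metric M d p y y"
    by (rule inner_form_norm_equiv[OF inner_form_chart_metric[OF d]]) blast
  define m where "m = real CARD('m)"
  have m: "0 < m" by (simp add: m_def)
  \<comment> \<open>There are m * m entries, each off by at most \<eta>, so the quadratic form
    changes by at most m * m * \<eta> = \<epsilon> * l times the squared Euclidean norm.\<close>
  define \<eta> where "\<eta> = \<epsilon> * l / (m * m)"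
  have \<eta>: "0 < \<eta>" using \<epsilon> l(1) m by (simp add: \<eta>_def)
  have p: "chart_inv d ?x0 = p" using chart(5) dM by auto
  have open': "open (snd d ` (fst d \<inter> W))" by (rule open_chart_image[OF dM(1) W(1)])
  have "\<forall>\<^sub>F x in nhds ?x0. x \<in> snd d ` (fst d \<inter> W)"
    using open' dM(2) W(2) by (intro eventually_nhds_in_open) auto
  moreover have "\<forall>\<^sub>F x in nhds ?x0. \<bar>?H x (axis i 1) (axis j 1) - ?H ?x0 (axis i 1) (axis j 1)\<bar> < \<eta>" for i j
  proof -
    have "isCont (\<lambda>x. ?H x (axis i 1) (axis j 1)) ?x0"
      using continuous_on_chart_metric[OF dM(1)] chart(2)[OF dM(1)] dM(2)
      by (auto simp: continuous_on_eq_continuous_at)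
    then have "((\<lambda>x. ?H x (axis i 1) (axis j 1)) \<longlongrightarrow> ?H ?x0 (axis i 1) (axis j 1)) (nhds ?x0)"
      using tendsto_at_iff_tendsto_nhds[of "\<lambda>x. ?H x (axis i 1) (axis j 1)" ?x0] by (simp only: isCont_def)
    from tendstoD[OF this \<eta>] show ?thesis by (simp add: dist_real_def)
  qed
  then have "\<forall>\<^sub>F x in nhds ?x0. \<forall>i\<in>UNIV. \<forall>j\<in>UNIV. \<bar>?H x (axis i 1) (axis j 1) - ?H ?x0 (axis i 1) (axis j 1)\<bar> < \<eta>"
    by (intro eventually_ball_finite ballI finite)
  ultimately have "\<forall>\<^sub>F x in nhds ?x0. x \<in> snd d ` (fst d \<inter> W) \<and>
      (\<forall>i\<in>UNIV. \<forall>j\<in>UNIV. \<bar>?H x (axis i 1) (axis j 1) - ?H ?x0 (axis i 1) (axis j 1)\<bar> < \<eta>)"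
    by (rule eventually_conj)
  then obtain e where e: "0 < e" "\<And>x. dist x ?x0 < e \<Longrightarrow> x \<in> snd d ` (fst d \<inter> W) \<and>
      (\<forall>i\<in>UNIV. \<forall>j\<in>UNIV. \<bar>?H x (axis i 1) (axis j 1) - ?H ?x0 (axis i 1) (axis j 1)\<bar> < \<eta>)"
    unfolding eventually_nhds_metric by blast
  show ?thesis
  proof (rule that[of "e / 2"])
    show "cball ?x0 (e / 2) \<subseteq> snd d ` (fst d \<inter> W)"
      using e by (auto simp: dist_commute)
    fix x y assume x: "x \<in> cball ?x0 (e / 2)"
    then have xe: "dist x ?x0 < e" using e(1) by (simp add: dist_commute)
    have dx: "d \<in> charts_at M (chart_inv d x)"
      using e(2)[OF xe] chart(7)[OF dM(1)] dM(1) by (auto simp: charts_at_def)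
    have "?H x y y - chart_metric M d p y y
        = (\<Sum>i\<in>UNIV. \<Sum>j\<in>UNIV. y $ i * (y $ j * (?H x (axis i 1) (axis j 1) - ?H ?x0 (axis i 1) (axis j 1))))"
      unfolding inner_form_expand[OF inner_form_chart_metric[OF dx], of y y]
        inner_form_expand[OF inner_form_chart_metric[OF d], of y y] p
      by (simp add: sum_subtractf[symmetric] sum_distrib_left right_diff_distrib)
    also have "\<bar>\<dots>\<bar> \<le> (\<Sum>i\<in>(UNIV::'m set). \<Sum>j\<in>(UNIV::'m set). norm y * (norm y * \<eta>))"
    proof (intro order_trans[OF sum_abs] sum_mono)
      fix i j
      show "\<bar>y $ i * (y $ j * (?H x (axis i 1) (axis j 1) - ?H ?x0 (axis i 1) (axis j 1)))\<bar>
          \<le> norm y * (norm y * \<eta>)"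
        unfolding abs_mult using e(2)[OF xe]
        by (intro mult_mono component_le_norm_cart) (auto intro: less_imp_le)
    qed
    also have "\<dots> = \<epsilon> * (l * (norm y)\<^sup>2)"
      using m by (simp add: \<eta>_def m_def[symmetric] power2_eq_square)
    also have "\<dots> \<le> \<epsilon> * chart_metric M d p y y"
      using \<epsilon> l(2) by (intro mult_left_mono) auto
    finally show "\<bar>?H x y y - chart_metric M d p y y\<bar> \<le> \<epsilon> * chart_metric M d p y y" .
  qed (use e(1) in simp)
qed

text \<open>Chain rule: the derivative in one chart determines the components of the velocity in all
  charts around the point.\<close>

lemma velocity_eq_chart_vec:
  assumes d: "d \<in> charts_at M (\<gamma> t)" and cont: "isCont \<gamma> t"
    and D: "((snd d \<circ> \<gamma>) has_vector_derivative D) (at t)"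
  shows "velocity M \<gamma> t = chart_vec M d (\<gamma> t) D"
proof
  fix e
  show "velocity M \<gamma> t e = chart_vec M d (\<gamma> t) D e"
  proof (cases "e \<in> charts_at M (\<gamma> t)")
    case True
    note dM = charts_atD[OF d]
    have "((snd e \<circ> chart_inv d) has_derivative transition_deriv d e (\<gamma> t)) (at ((snd d \<circ> \<gamma>) t))"
      using transition_has_derivative[OF d True] by simp
    then have *: "((snd e \<circ> chart_inv d \<circ> (snd d \<circ> \<gamma>)) has_vector_derivative transition_deriv d e (\<gamma> t) D) (at t)"
      by (rule vector_derivative_diff_chain_within[OF D has_derivative_at_withinI])
    have "\<forall>\<^sub>F s in at t. \<gamma> s \<in> fst d"
      using cont[unfolded isCont_def] chart(1)[OF dM(1)] dM(2) by (rule topological_tendstoD)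
    then have ev: "\<forall>\<^sub>F s in at t. (snd e \<circ> chart_inv d \<circ> (snd d \<circ> \<gamma>)) s = (snd e \<circ> \<gamma>) s"
      by eventually_elim (simp only: comp_apply chart(5)[OF dM(1)])
    have "((snd e \<circ> \<gamma>) has_vector_derivative transition_deriv d e (\<gamma> t) D) (at t)"
      using * unfolding has_vector_derivative_def
      by (rule has_derivative_transform_eventually[OF _ ev]) (simp_all add: chart(5)[OF dM])
    then show ?thesis
      using True by (simp add: velocity_def chart_vec_def vector_derivative_at)
  qed (simp add: velocity_def chart_vec_def)
qed

text \<open>The functional \<open>l\<close> acts as a calibration: by \<open>bound\<close> it grows
  along the curve no faster than arc length, and the fundamental theorem of calculus recovers the
  total growth. Only the portion up to \<open>t1\<close> has to stay in the chart.\<close>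

lemma curve_length_lower_bound:
  assumes \<gamma>: "piecewise_C1_curve M \<gamma>" and d: "d \<in> atlas M" and t1: "0 \<le> t1" "t1 \<le> 1"
    and in_d: "\<gamma> ` {0..t1} \<subseteq> fst d" and l: "linear (l :: real^'m \<Rightarrow> real)"
    and bound: "\<And>t y. t \<in> {0..t1} \<Longrightarrow> \<bar>l y\<bar> \<le> sqrt (chart_metric M d (\<gamma> t) y y)"
  shows "ennreal \<bar>l (snd d (\<gamma> t1) - snd d (\<gamma> 0))\<bar> \<le> curve_length M \<gamma>"
proof -
  have "(snd d \<circ> \<gamma>) piecewise_C1_differentiable_on {0..t1}"
    using \<gamma> d t1 in_d unfolding piecewise_C1_curve_def by auto
  then obtain S where S: "finite S" "(snd d \<circ> \<gamma>) C1_differentiable_on ({0..t1} - S)"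
    and cont: "continuous_on {0..t1} (snd d \<circ> \<gamma>)"
    by (auto simp: piecewise_C1_differentiable_on_def)
  then obtain D where D: "\<And>t. t \<in> {0..t1} - S \<Longrightarrow> ((snd d \<circ> \<gamma>) has_vector_derivative D t) (at t)"
    and contD: "continuous_on ({0..t1} - S) D"
    unfolding C1_differentiable_on_def by blast
  have bl: "bounded_linear l" using l by (simp add: linear_conv_bounded_linear)
  let ?\<Delta> = "l (snd d (\<gamma> t1) - snd d (\<gamma> 0))"
  have FTC: "((\<lambda>t. l (D t)) has_integral ?\<Delta>) {0..t1}"
  proof -
    have "(D has_integral ((snd d \<circ> \<gamma>) t1 - (snd d \<circ> \<gamma>) 0)) {0..t1}"
    proof (rule fundamental_theorem_of_calculus_interior_strong[OF S(1) t1(1) _ cont])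
      show "((snd d \<circ> \<gamma>) has_vector_derivative D t) (at t)" if "t \<in> {0<..<t1} - S" for t
        by (rule D) (use that in auto)
    qed
    from has_integral_linear[OF this bl] show ?thesis by (simp add: o_def)
  qed
  \<comment> \<open>Away from the exceptional points and the end points the curve is continuous from
    both sides, so its velocity is given by \<open>D\<close>; there \<open>D\<close> is also
    continuous, which makes \<open>h\<close> Borel.\<close>
  define E where "E = {0<..<t1} - S"
  define h where "h t = indicator E t *\<^sub>R l (D t)" for t
  have E: "E \<in> sets borel"
    unfolding E_def by (intro borel_open open_Diff finite_imp_closed S(1)) simp
  have "continuous_on E (\<lambda>t. l (D t))"
    by (rule bounded_linear.continuous_on[OF bl continuous_on_subset[OF contD]]) (auto simp: E_def)
  then have h: "h \<in> borel_measurable lborel"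
    unfolding h_def measurable_lborel2 by (rule borel_measurable_continuous_on_indicator[OF E])
  have "(\<integral>\<^sup>+t. ennreal (norm (h t)) \<partial>lborel) \<le> curve_length M \<gamma>"
    unfolding curve_length_def
  proof (rule nn_integral_mono)
    fix t
    show "ennreal (norm (h t)) \<le> ennreal (sqrt (metric M (\<gamma> t) (velocity M \<gamma> t) (velocity M \<gamma> t))) * indicator {0..1} t"
    proof (cases "t \<in> E")
      case True
      then have t: "t \<in> {0..t1} - S" "t \<in> {0<..<1}" using t1 by (auto simp: E_def)
      have "isCont \<gamma> t"
      proof -
        have "continuous_on {0<..<1} \<gamma>"
          using \<gamma> by (auto simp: piecewise_C1_curve_def intro: continuous_on_subset)
        then show ?thesis using t(2) by (simp add: continuous_on_eq_continuous_at)
      qed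
      moreover have dt: "d \<in> charts_at M (\<gamma> t)" using in_d d t(1) by (auto simp: charts_at_def)
      ultimately have "velocity M \<gamma> t = chart_vec M d (\<gamma> t) (D t)"
        using velocity_eq_chart_vec D[OF t(1)] by blast
      then show ?thesis
        using True bound[of t "D t"] t by (auto simp: h_def chart_metric_def intro: ennreal_leI)
    qed (simp add: h_def)
  qed
  \<comment> \<open>If the integral of the norm of \<open>h\<close> is infinite there is nothing to
    show; otherwise \<open>h\<close> is Lebesgue integrable and its integral agrees with the gauge
    integral of \<open>FTC\<close>.\<close>
  moreover have "ennreal \<bar>?\<Delta>\<bar> \<le> (\<integral>\<^sup>+t. ennreal (norm (h t)) \<partial>lborel)"
  proof (cases "(\<integral>\<^sup>+t. ennreal (norm (h t)) \<partial>lborel) = \<infinity>")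
    case False
    then have int: "integrable lborel h"
      using h by (intro integrableI_bounded) (auto simp: less_top[symmetric])
    have "((\<lambda>t. if t \<in> {0..t1} then l (D t) else 0) has_integral ?\<Delta>) UNIV"
      using FTC by (simp only: has_integral_restrict_UNIV)
    then have "(h has_integral ?\<Delta>) UNIV"
      by (rule has_integral_spike_finite[of "S \<union> {0, t1}", rotated 2])
        (use S(1) in \<open>auto simp: h_def E_def indicator_def\<close>)
    then have "integral\<^sup>L lborel h = ?\<Delta>"
      using has_integral_integral_lborel[OF int] has_integral_unique by blast
    then show ?thesis using integral_norm_bound_ennreal[OF int] by simp
  qed simp
  ultimately show ?thesis by (rule order_trans[rotated])
qed

text \<open>A curve that leaves the coordinate ball is already long up to its first exit.\<close>
lemma curve_stays_or_long:
  assumes \<gamma>: "piecewise_C1_curve M \<gamma>" and d: "d \<in> charts_at M (\<gamma> 0)"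
    and r: "0 < r" "cball (snd d (\<gamma> 0)) r \<subseteq> snd d ` fst d"
    and \<kappa>: "0 < \<kappa>" "\<And>x y. x \<in> cball (snd d (\<gamma> 0)) r \<Longrightarrow>
      \<kappa> * norm y \<le> sqrt (chart_metric M d (chart_inv d x) y y)"
  shows "\<gamma> ` {0..1} \<subseteq> chart_inv d ` ball (snd d (\<gamma> 0)) r \<or> ennreal (\<kappa> * r) \<le> curve_length M \<gamma>"
proof (cases "\<gamma> ` {0..1} \<subseteq> chart_inv d ` ball (snd d (\<gamma> 0)) r")
  case False
  note dM = charts_atD[OF d]
  let ?x0 = "snd d (\<gamma> 0)"
  let ?V = "chart_inv d ` ball ?x0 r" and ?K = "chart_inv d ` cball ?x0 r"
  have cont: "continuous_on {0..1} \<gamma>" using \<gamma> by (simp add: piecewise_C1_curve_def)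
  have "?V = fst d \<inter> snd d -` ball ?x0 r"
  proof (intro equalityI subsetI)
    fix q assume "q \<in> ?V"
    then obtain x where x: "x \<in> ball ?x0 r" "q = chart_inv d x" by blast
    then have "x \<in> snd d ` fst d" using r(2) by auto
    then show "q \<in> fst d \<inter> snd d -` ball ?x0 r" using x chart(6,7)[OF dM(1)] by simp
  next
    fix q assume "q \<in> fst d \<inter> snd d -` ball ?x0 r"
    then show "q \<in> ?V" using chart(5)[OF dM(1)] by (metis IntE image_eqI vimageD)
  qed
  then have V: "open ?V"
    using continuous_open_preimage[OF chart(3,1)[OF dM(1)] open_ball[of ?x0 r]] by simp
  have "compact ?K"
    by (intro compact_continuous_image continuous_on_subset[OF chart(4)[OF dM(1)] r(2)]) simp
  then have K: "closed ?K" by (rule compact_imp_closed)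
  let ?T = "{0..1} \<inter> \<gamma> -` (- ?V)"
  have "closed ?T" using cont V by (intro continuous_closed_preimage) auto
  then have "compact ?T" by (meson bounded_Int bounded_closed_interval compact_eq_bounded_closed)
  moreover have "?T \<noteq> {}" using False by auto
  ultimately obtain t1 where t1: "t1 \<in> ?T" "\<And>t. t \<in> ?T \<Longrightarrow> t1 \<le> t"
    using compact_attains_inf[of ?T] by blast
  have "\<gamma> 0 \<in> ?V" using r(1) chart(5)[OF dM] by (intro image_eqI[of _ _ ?x0]) auto
  then have "t1 \<noteq> 0" using t1(1) by auto
  then have t1': "0 < t1" "t1 \<le> 1" using t1(1) by auto
  have inV: "\<gamma> ` {0..<t1} \<subseteq> ?V"
    using t1(2) t1'(2) by (force simp: not_le[symmetric])
  \<comment> \<open>Before the exit time the curve runs in the open ball; continuity includes the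
    exit time itself at the price of the closed ball, whose image is closed as a compact set in a
    Hausdorff space.\<close>
  have "\<gamma> ` closure {0..<t1} \<subseteq> ?K"
  proof (rule image_closure_subset)
    show "continuous_on (closure {0..<t1}) \<gamma>"
      using cont t1' by (auto intro: continuous_on_subset)
    show "\<gamma> ` {0..<t1} \<subseteq> ?K" using inV ball_subset_cball by blast
  qed (rule K)
  then have inK: "\<gamma> ` {0..t1} \<subseteq> ?K" using t1' by simp
  have K': "q \<in> fst d \<and> snd d q \<in> cball ?x0 r \<and> chart_inv d (snd d q) = q" if "q \<in> ?K" for q
  proof -
    obtain x where x: "x \<in> cball ?x0 r" "q = chart_inv d x" using \<open>q \<in> ?K\<close> by blast
    then have "x \<in> snd d ` fst d" using r(2) by auto
    then show ?thesis using x chart(5-7)[OF dM(1)] by simp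
  qed
  define z where "z = snd d (\<gamma> t1) - ?x0"
  have t1K: "\<gamma> t1 \<in> ?K" using inK t1' by auto
  have "norm z = r"
  proof -
    have "snd d (\<gamma> t1) \<notin> ball ?x0 r"
      using t1(1) K'[OF t1K] by (metis IntE ComplD imageI vimageD)
    then show ?thesis using K'[OF t1K] by (auto simp: z_def dist_norm norm_minus_commute)
  qed
  \<comment> \<open>Projection onto the exit direction \<open>z\<close>, scaled so that \<bar>l
    y\<bar> is at most \<kappa> times the norm of y and l z = \<kappa> r.\<close>
  define l where "l y = \<kappa> * ((z \<bullet> y) / r)" for y
  have "ennreal \<bar>l (snd d (\<gamma> t1) - snd d (\<gamma> 0))\<bar> \<le> curve_length M \<gamma>"
  proof (rule curve_length_lower_bound[OF \<gamma> dM(1)])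
    show "\<gamma> ` {0..t1} \<subseteq> fst d" using inK K' by blast
    show "linear l" unfolding l_def by (intro linearI) (simp_all add: inner_simps add_divide_distrib distrib_left)
    fix t y assume t: "t \<in> {0..t1}"
    have "\<bar>z \<bullet> y\<bar> \<le> r * norm y" using Cauchy_Schwarz_ineq2[of z y] \<open>norm z = r\<close> by simp
    then have "\<bar>l y\<bar> \<le> \<kappa> * norm y"
      using r(1) \<kappa>(1) by (simp add: l_def abs_mult field_simps)
    also have "\<dots> \<le> sqrt (chart_metric M d (\<gamma> t) y y)"
    proof -
      have "\<gamma> t \<in> ?K" using inK t by blast
      from K'[OF this] show ?thesis using \<kappa>(2)[of "snd d (\<gamma> t)" y] by simp
    qed
    finally show "\<bar>l y\<bar> \<le> sqrt (chart_metric M d (\<gamma> t) y y)" .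
  qed (use t1' in auto)
  also have "l (snd d (\<gamma> t1) - snd d (\<gamma> 0)) = \<kappa> * r"
    using \<open>norm z = r\<close> r(1) by (simp add: l_def z_def[symmetric] power2_norm_eq_inner[symmetric] power2_eq_square)
  finally show ?thesis using r(1) \<kappa>(1) by simp
qed simp

text \<open>A curve from \<open>q\<close> either leaves the coordinate ball and then has length at
  least \<kappa> r, or it stays where the metric dominates \<open>l\<close> and the calibration
  applies. The minimum accounts for both alternatives.\<close>

lemma riem_dist_lower_bound:
  assumes d: "d \<in> charts_at M q"
    and r: "0 < r" "cball (snd d q) r \<subseteq> snd d ` fst d"
    and \<kappa>: "0 < \<kappa>" "\<And>x y. x \<in> cball (snd d q) r \<Longrightarrow>
      \<kappa> * norm y \<le> sqrt (chart_metric M d (chart_inv d x) y y)"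
  shows "q' \<notin> chart_inv d ` ball (snd d q) r \<Longrightarrow> ennreal (\<kappa> * r) \<le> riem_dist M q q'"
    and "linear l \<Longrightarrow> (\<And>x y. x \<in> cball (snd d q) r \<Longrightarrow>
        \<bar>l y\<bar> \<le> sqrt (chart_metric M d (chart_inv d x) y y)) \<Longrightarrow>
      min (ennreal (\<kappa> * r)) (ennreal \<bar>l (snd d q' - snd d q)\<bar>) \<le> riem_dist M q q'"
proof -
  note dM = charts_atD[OF d]
  have *: "\<gamma> ` {0..1} \<subseteq> chart_inv d ` ball (snd d q) r \<or> ennreal (\<kappa> * r) \<le> curve_length M \<gamma>"
    if "piecewise_C1_curve M \<gamma>" "\<gamma> 0 = q" for \<gamma>
    using curve_stays_or_long[OF that(1), of d r \<kappa>] d r \<kappa> that(2) by simp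
  show "ennreal (\<kappa> * r) \<le> riem_dist M q q'" if "q' \<notin> chart_inv d ` ball (snd d q) r"
    unfolding riem_dist_def
  proof (rule Inf_greatest)
    fix L assume "L \<in> curve_length M ` {\<gamma>. piecewise_C1_curve M \<gamma> \<and> \<gamma> 0 = q \<and> \<gamma> 1 = q'}"
    then obtain \<gamma> where \<gamma>: "piecewise_C1_curve M \<gamma>" "\<gamma> 0 = q" "\<gamma> 1 = q'" "L = curve_length M \<gamma>"
      by blast
    have "\<gamma> 1 \<in> \<gamma> ` {0..1}" by simp
    then show "ennreal (\<kappa> * r) \<le> L" using *[OF \<gamma>(1,2)] that \<gamma>(3,4) by blast
  qed
  show "min (ennreal (\<kappa> * r)) (ennreal \<bar>l (snd d q' - snd d q)\<bar>) \<le> riem_dist M q q'"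
    if l: "linear l" "\<And>x y. x \<in> cball (snd d q) r \<Longrightarrow> \<bar>l y\<bar> \<le> sqrt (chart_metric M d (chart_inv d x) y y)"
    unfolding riem_dist_def
  proof (rule Inf_greatest)
    fix L assume "L \<in> curve_length M ` {\<gamma>. piecewise_C1_curve M \<gamma> \<and> \<gamma> 0 = q \<and> \<gamma> 1 = q'}"
    then obtain \<gamma> where \<gamma>: "piecewise_C1_curve M \<gamma>" "\<gamma> 0 = q" "\<gamma> 1 = q'" "L = curve_length M \<gamma>"
      by blast
    show "min (ennreal (\<kappa> * r)) (ennreal \<bar>l (snd d q' - snd d q)\<bar>) \<le> L"
      using *[OF \<gamma>(1,2)]
    proof
      assume in_ball: "\<gamma> ` {0..1} \<subseteq> chart_inv d ` ball (snd d q) r"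
      have x: "\<exists>x\<in>cball (snd d q) r. \<gamma> t = chart_inv d x \<and> x \<in> snd d ` fst d" if "t \<in> {0..1}" for t
        using in_ball r(2) that by (fastforce simp: subset_iff image_iff)
      have "ennreal \<bar>l (snd d (\<gamma> 1) - snd d (\<gamma> 0))\<bar> \<le> curve_length M \<gamma>"
      proof (rule curve_length_lower_bound[OF \<gamma>(1) dM(1) _ _ _ l(1)])
        show "\<gamma> ` {0..1} \<subseteq> fst d"
        proof (rule image_subsetI)
          fix t :: real assume "t \<in> {0..1}"
          from x[OF this] obtain x where "\<gamma> t = chart_inv d x" "x \<in> snd d ` fst d" by blast
          then show "\<gamma> t \<in> fst d" using chart(7)[OF dM(1)] by (simp only:)
        qed
        show "\<bar>l y\<bar> \<le> sqrt (chart_metric M d (\<gamma> t) y y)" if "t \<in> {0..1}" for t y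
          using x[OF that] l(2) by auto
      qed auto
      then show ?thesis using \<gamma> by (simp add: min.coboundedI2)
    qed (simp add: \<gamma>(4) min.coboundedI1)
  qed
qed

text \<open>The coordinate segment from p to the target has constant coordinate velocity
  \<open>w\<close>, so its length is at most \<open>L\<close>.\<close>

lemma riem_dist_upper_bound:
  assumes c: "c \<in> charts_at M p"
    and r: "cball (snd c p) r \<subseteq> snd c ` fst c" and w: "norm w < r"
    and L: "0 \<le> L" "\<And>x. x \<in> cball (snd c p) r \<Longrightarrow> chart_metric M c (chart_inv c x) w w \<le> L\<^sup>2"
  shows "riem_dist M p (chart_inv c (snd c p + w)) \<le> ennreal L"
proof -
  note cM = charts_atD[OF c]
  let ?x0 = "snd c p"
  let ?line = "\<lambda>s. ?x0 + s *\<^sub>R w"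
  define \<gamma> where "\<gamma> s = chart_inv c (?line s)" for s
  have U: "open (snd c ` fst c)" by (rule chart(2)[OF cM(1)])
  have line: "?line s \<in> cball ?x0 r" if "s \<in> {0..1}" for s
  proof -
    have "norm (s *\<^sub>R w) \<le> 1 * norm w" using that unfolding norm_scaleR by (intro mult_right_mono) auto
    then show ?thesis using w by (simp add: dist_norm)
  qed
  have lineU: "?line s \<in> snd c ` fst c" if "s \<in> {0..1}" for s using line[OF that] r by auto
  have in_c: "\<gamma> s \<in> fst c" if "s \<in> {0..1}" for s
    unfolding \<gamma>_def by (rule chart(7)[OF cM(1) lineU[OF that]])
  have dline: "(?line has_vector_derivative w) (at s)" for s
    by (auto intro!: derivative_eq_intros)
  \<comment> \<open>The parameters for which the line stays in the chart form an open set around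
    {0..1}, so continuity and derivatives are two-sided at the end points as well.\<close>
  have openU: "open (?line -` snd c ` fst c)"
    by (intro open_vimage U continuous_intros)
  have contU: "continuous_on (?line -` snd c ` fst c) \<gamma>"
    unfolding \<gamma>_def by (rule continuous_on_compose2[OF chart(4)[OF cM(1)]]) (auto intro!: continuous_intros)
  have isCont: "isCont \<gamma> s" if "s \<in> {0..1}" for s
    using contU openU lineU[OF that] by (simp add: continuous_on_eq_continuous_at)
  have "piecewise_C1_curve M \<gamma>"
    unfolding piecewise_C1_curve_def
  proof (intro conjI ballI allI impI)
    show "continuous_on {0..1} \<gamma>"
      using isCont by (simp add: continuous_at_imp_continuous_on)
    \<comment> \<open>Regularity of a curve is demanded in every chart of the atlas; in
      \<open>e\<close> the segment is composed with the transition map.\<close>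
    fix e a b assume e: "e \<in> atlas M" and ab: "{a..b} \<subseteq> {0..1} \<and> \<gamma> ` {a..b} \<subseteq> fst e"
    let ?W = "snd c ` (fst c \<inter> fst e)"
    let ?F = "snd e \<circ> chart_inv c"
    have sm: "smooth_on ?W ?F" by (rule transition_smooth[OF cM(1) e])
    have lineW: "?line s \<in> ?W" if "s \<in> {a..b}" for s
    proof (rule image_eqI[of _ _ "\<gamma> s"])
      have s: "s \<in> {0..1}" using ab that by blast
      show "?line s = snd c (\<gamma> s)" unfolding \<gamma>_def by (rule chart(6)[OF cM(1) lineU[OF s], symmetric])
      show "\<gamma> s \<in> fst c \<inter> fst e" using in_c[OF s] ab that by blast
    qed
    have "((?F \<circ> ?line) has_vector_derivative frechet_derivative ?F (at (?line s)) w) (at s)"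
      if "s \<in> {a..b}" for s
    proof -
      have "(?F has_derivative frechet_derivative ?F (at (?line s))) (at (?line s))"
        using smooth_on_differentiable[OF sm lineW[OF that]] by (simp add: frechet_derivative_works)
      from vector_derivative_diff_chain_within[OF dline has_derivative_at_withinI[OF this]]
      show ?thesis .
    qed
    moreover have "continuous_on {a..b} (\<lambda>s. frechet_derivative ?F (at (?line s)) w)"
      using lineW by (intro continuous_on_compose2[OF smooth_on_derivative_continuous[OF sm]])
        (auto intro!: continuous_intros)
    moreover have "snd e \<circ> \<gamma> = ?F \<circ> ?line" by (simp add: fun_eq_iff \<gamma>_def)
    ultimately have "(snd e \<circ> \<gamma>) C1_differentiable_on {a..b}"
      unfolding C1_differentiable_on_def
      by (intro exI[of _ "\<lambda>s. frechet_derivative ?F (at (?line s)) w"]) simp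
    then show "(snd e \<circ> \<gamma>) piecewise_C1_differentiable_on {a..b}"
      by (rule C1_differentiable_imp_piecewise)
  qed
  moreover have "\<gamma> 0 = p" using chart(5)[OF cM] by (simp add: \<gamma>_def)
  moreover have "\<gamma> 1 = chart_inv c (?x0 + w)" by (simp add: \<gamma>_def)
  ultimately have "riem_dist M p (chart_inv c (?x0 + w)) \<le> curve_length M \<gamma>"
    unfolding riem_dist_def by (intro Inf_lower) auto
  also have "curve_length M \<gamma> \<le> (\<integral>\<^sup>+t\<in>{0..1::real}. ennreal L \<partial>lborel)"
    unfolding curve_length_def
  proof (rule nn_integral_mono)
    fix t :: real
    show "ennreal (sqrt (metric M (\<gamma> t) (velocity M \<gamma> t) (velocity M \<gamma> t))) * indicator {0..1} t
        \<le> ennreal L * indicator {0..1} t"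
    proof (cases "t \<in> {0..1}")
      case True
      have "((snd c \<circ> \<gamma>) has_vector_derivative w) (at t)"
        by (rule has_vector_derivative_transform_within_open[OF dline openU])
          (use lineU[OF True] chart(6)[OF cM(1)] in \<open>auto simp: \<gamma>_def\<close>)
      moreover have "c \<in> charts_at M (\<gamma> t)" using in_c[OF True] cM(1) by (simp add: charts_at_def)
      ultimately have "velocity M \<gamma> t = chart_vec M c (\<gamma> t) w"
        using velocity_eq_chart_vec isCont[OF True] by blast
      then have "sqrt (metric M (\<gamma> t) (velocity M \<gamma> t) (velocity M \<gamma> t)) \<le> L"
        using L(2)[OF line[OF True]] L(1) by (simp add: chart_metric_def \<gamma>_def real_le_lsqrt)
      then show ?thesis by (auto simp: indicator_def intro: ennreal_leI)
    qed simp
  qed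
  also have "\<dots> = ennreal L" by (simp add: nn_integral_cmult_indicator)
  finally show ?thesis .
qed

text \<open>Combines the two comparisons: the relative one with the form at p, and that of the form
  at p with the Euclidean norm, whose constants multiply to \<kappa>^2 = (1 - \<epsilon>) l.\<close>

lemma local_norm_lower_bound:
  assumes d: "d \<in> charts_at M p" and \<epsilon>: "0 < \<epsilon>" "\<epsilon> < 1" and W: "open W" "p \<in> W"
  obtains r \<kappa> where "0 < r" "cball (snd d p) r \<subseteq> snd d ` (fst d \<inter> W)" "0 < \<kappa>"
    "\<And>x y. x \<in> cball (snd d p) r \<Longrightarrow> \<kappa> * norm y \<le> sqrt (chart_metric M d (chart_inv d x) y y)"
    "\<And>x y. x \<in> cball (snd d p) r \<Longrightarrow>
       (1 - \<epsilon>) * chart_metric M d p y y \<le> chart_metric M d (chart_inv d x) y y"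
proof -
  obtain l where l: "0 < l" "\<And>y. l * (norm y)\<^sup>2 \<le> chart_metric M d p y y"
    by (rule inner_form_norm_equiv[OF inner_form_chart_metric[OF d]]) blast
  obtain r where r: "0 < r" "cball (snd d p) r \<subseteq> snd d ` (fst d \<inter> W)"
    "\<And>x y. x \<in> cball (snd d p) r \<Longrightarrow>
       \<bar>chart_metric M d (chart_inv d x) y y - chart_metric M d p y y\<bar> \<le> \<epsilon> * chart_metric M d p y y"
    by (rule local_metric_comparison[OF d \<epsilon>(1) W]) blast
  have lower: "(1 - \<epsilon>) * chart_metric M d p y y \<le> chart_metric M d (chart_inv d x) y y"
    if "x \<in> cball (snd d p) r" for x y
    using r(3)[OF that, of y] by (simp add: abs_le_iff algebra_simps)
  have "sqrt ((1 - \<epsilon>) * l) * norm y \<le> sqrt (chart_metric M d (chart_inv d x) y y)"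
    if "x \<in> cball (snd d p) r" for x y
  proof -
    have "sqrt ((1 - \<epsilon>) * l) * norm y = sqrt ((1 - \<epsilon>) * (l * (norm y)\<^sup>2))"
      by (simp add: real_sqrt_mult)
    also have "\<dots> \<le> sqrt ((1 - \<epsilon>) * chart_metric M d p y y)"
      using l(2)[of y] \<epsilon>(2) by (intro real_sqrt_le_mono mult_left_mono) auto
    also have "\<dots> \<le> sqrt (chart_metric M d (chart_inv d x) y y)"
      using lower[OF that] by (rule real_sqrt_le_mono)
    finally show ?thesis .
  qed
  with r l \<epsilon> lower show ?thesis
    by (intro that[of r "sqrt ((1 - \<epsilon>) * l)"]) auto
qed

end

section \<open>Continuity and differential of a Lipschitz map\<close>

context riem_map
begin

text \<open>Continuity refers to the given topologies, not to \<open>riem_dist\<close>, so both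
  sides pass through charts: points outside a neighbourhood of f p lie at distance at least \<kappa>
  r, whereas points with coordinates close to those of p are close in
  \<open>riem_dist\<close>.\<close>

lemma lipschitz_isCont:
  assumes lip: "riem_lipschitz_const M N f C"
  shows "isCont f p"
  unfolding isCont_def
proof (rule topological_tendstoI)
  fix W assume W: "open W" "f p \<in> W"
  have C: "0 \<le> C" "\<And>x y. riem_dist N (f x) (f y) \<le> ennreal C * riem_dist M x y"
    using lip by (auto simp: riem_lipschitz_const_def)
  obtain d where d: "d \<in> charts_at N (f p)" using N.charts_at_nonempty by blast
  obtain c where c: "c \<in> charts_at M p" using M.charts_at_nonempty by blast
  note dN = charts_atD[OF d] and cM = charts_atD[OF c]
  obtain r \<kappa> where r: "0 < r" "cball (snd d (f p)) r \<subseteq> snd d ` (fst d \<inter> W)" and \<kappa>: "0 < \<kappa>"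
    "\<And>x y. x \<in> cball (snd d (f p)) r \<Longrightarrow> \<kappa> * norm y \<le> sqrt (chart_metric N d (chart_inv d x) y y)"
    by (rule N.local_norm_lower_bound[OF d, of "1/2" W]) (use W in auto)
  have far: "ennreal (\<kappa> * r) \<le> riem_dist N (f p) q'"
    if "q' \<notin> chart_inv d ` ball (snd d (f p)) r" for q'
    using r(2) by (intro N.riem_dist_lower_bound(1)[OF d r(1) _ \<kappa> that]) auto
  have VW: "chart_inv d ` ball (snd d (f p)) r \<subseteq> W"
  proof (rule image_subsetI)
    fix x assume "x \<in> ball (snd d (f p)) r"
    then have "x \<in> snd d ` (fst d \<inter> W)" using r(2) ball_subset_cball by blast
    then obtain q where "q \<in> fst d" "q \<in> W" "x = snd d q" by blast
    then show "chart_inv d x \<in> W" by (simp add: N.chart(5)[OF dN(1)])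
  qed
  \<comment> \<open>With relative error 1 the metric at most doubles on the ball; this is the 2 in
    \<open>K\<close>.\<close>
  obtain \<rho> where \<rho>: "0 < \<rho>" "cball (snd c p) \<rho> \<subseteq> snd c ` (fst c \<inter> UNIV)"
    "\<And>x y. x \<in> cball (snd c p) \<rho> \<Longrightarrow>
       \<bar>chart_metric M c (chart_inv c x) y y - chart_metric M c p y y\<bar> \<le> 1 * chart_metric M c p y y"
    by (rule M.local_metric_comparison[OF c, of 1 UNIV]) auto
  obtain L where L: "0 < L" "\<And>y. chart_metric M c p y y \<le> L * (norm y)\<^sup>2"
    by (rule inner_form_norm_equiv[OF M.inner_form_chart_metric[OF c]]) blast
  define K where "K = C * sqrt (2 * L)"
  have K: "0 \<le> K" using C L by (simp add: K_def)
  \<comment> \<open>Dividing by K + 1 covers the case K = 0 and makes K \<delta> < \<kappa> r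
    strict.\<close>
  define \<delta> where "\<delta> = min \<rho> (\<kappa> * r / (K + 1))"
  have \<delta>: "0 < \<delta>" using \<rho>(1) \<kappa>(1) r(1) K by (simp add: \<delta>_def)
  have near: "f (chart_inv c (snd c p + w)) \<in> W" if w: "norm w < \<delta>" for w
  proof (rule ccontr)
    assume "f (chart_inv c (snd c p + w)) \<notin> W"
    then have "ennreal (\<kappa> * r) \<le> riem_dist N (f p) (f (chart_inv c (snd c p + w)))"
      using far VW by blast
    also have "\<dots> \<le> ennreal C * riem_dist M p (chart_inv c (snd c p + w))" by (rule C(2))
    also have "\<dots> \<le> ennreal C * ennreal (sqrt (2 * L) * norm w)"
    proof (intro mult_left_mono M.riem_dist_upper_bound[OF c])
      show "cball (snd c p) \<rho> \<subseteq> snd c ` fst c" using \<rho>(2) by simp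
      show "norm w < \<rho>" using w by (simp add: \<delta>_def)
      fix x assume "x \<in> cball (snd c p) \<rho>"
      from \<rho>(3)[OF this, of w] have "chart_metric M c (chart_inv c x) w w \<le> 2 * chart_metric M c p w w"
        by (simp add: abs_le_iff)
      also have "\<dots> \<le> 2 * (L * (norm w)\<^sup>2)" using L(2)[of w] by simp
      finally show "chart_metric M c (chart_inv c x) w w \<le> (sqrt (2 * L) * norm w)\<^sup>2"
        using L(1) by (simp add: power_mult_distrib)
    qed (use L in auto)
    also have "\<dots> = ennreal (K * norm w)"
      using C(1) L(1) by (simp add: K_def ennreal_mult[symmetric] mult_ac)
    finally have "\<kappa> * r \<le> K * norm w" using K by (simp add: ennreal_le_iff)
    also have "\<dots> \<le> K * \<delta>" using w K by (intro mult_left_mono) auto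
    also have "\<dots> < (K + 1) * \<delta>" using \<delta> by simp
    also have "\<dots> \<le> \<kappa> * r"
      using K mult_left_mono[of \<delta> "\<kappa> * r / (K + 1)" "K + 1"] by (simp add: \<delta>_def)
    finally show False by simp
  qed
  have "open (fst c \<inter> snd c -` ball (snd c p) \<delta>)"
    by (rule continuous_open_preimage[OF M.chart(3,1)[OF cM(1)] open_ball])
  moreover have "p \<in> fst c \<inter> snd c -` ball (snd c p) \<delta>" using cM(2) \<delta> by simp
  ultimately have "\<forall>\<^sub>F x in at p. x \<in> fst c \<inter> snd c -` ball (snd c p) \<delta>"
    by (rule eventually_at_in_open')
  then show "\<forall>\<^sub>F x in at p. f x \<in> W"
  proof eventually_elim
    case (elim x)
    then have "norm (snd c x - snd c p) < \<delta>" by (simp add: dist_norm norm_minus_commute)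
    from near[OF this] show ?case using elim M.chart(5)[OF cM(1), of x] by simp
  qed
qed

text \<open>A functional normed by w = A v near f p bounds distances in N from below, and the
  segment in direction v bounds those in M from above. The difference quotient of the functional
  along the image of the segment is thus at most C b, and so is its limit, (1 - \<epsilon>)^(1/2)
  times the length of w.\<close>

lemma differential_bound_eps:
  assumes lip: "riem_lipschitz_const M N f C" and c: "c \<in> charts_at M p" and d: "d \<in> charts_at N (f p)"
    and A: "((snd d \<circ> f \<circ> chart_inv c) has_derivative A) (at (snd c p))"
    and \<epsilon>: "0 < \<epsilon>" "\<epsilon> < 1"
  shows "(1 - \<epsilon>) * chart_metric N d (f p) (A v) (A v) \<le> C\<^sup>2 * ((1 + \<epsilon>) * chart_metric M c p v v)"
proof -
  have C: "0 \<le> C" "\<And>x y. riem_dist N (f x) (f y) \<le> ennreal C * riem_dist M x y"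
    using lip by (auto simp: riem_lipschitz_const_def)
  note dN = charts_atD[OF d] and cM = charts_atD[OF c]
  let ?H = "chart_metric N d (f p)" and ?G = "chart_metric M c p"
  note H = N.inner_form_chart_metric[OF d] and G = M.inner_form_chart_metric[OF c]
  define w where "w = A v"
  define a where "a = sqrt (?H w w)"
  define b where "b = sqrt ((1 + \<epsilon>) * ?G v v)"
  have Gv: "0 \<le> ?G v v" and Hw: "0 \<le> ?H w w" using inner_form_nonneg[OF G] inner_form_nonneg[OF H] by auto
  have b: "0 \<le> b" using Gv \<epsilon> by (simp add: b_def)
  show ?thesis
  proof (cases "a = 0")
    case True
    then have "?H w w = 0" by (simp add: a_def)
    then show ?thesis using Gv \<epsilon> by (simp add: w_def)
  next
    case False
    then have a: "0 < a" using Hw by (simp add: a_def less_le)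
    have a2: "a * a = ?H w w" using Hw by (simp add: a_def)
    obtain r \<kappa> where r: "0 < r" "cball (snd d (f p)) r \<subseteq> snd d ` (fst d \<inter> UNIV)" and \<kappa>: "0 < \<kappa>"
      "\<And>x y. x \<in> cball (snd d (f p)) r \<Longrightarrow> \<kappa> * norm y \<le> sqrt (chart_metric N d (chart_inv d x) y y)"
      and near: "\<And>x y. x \<in> cball (snd d (f p)) r \<Longrightarrow> (1 - \<epsilon>) * ?H y y \<le> chart_metric N d (chart_inv d x) y y"
      by (rule N.local_norm_lower_bound[OF d \<epsilon>, of UNIV]) auto
    obtain \<rho> where \<rho>: "0 < \<rho>" "cball (snd c p) \<rho> \<subseteq> snd c ` (fst c \<inter> UNIV)"
      "\<And>x y. x \<in> cball (snd c p) \<rho> \<Longrightarrow>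
         \<bar>chart_metric M c (chart_inv c x) y y - ?G y y\<bar> \<le> \<epsilon> * ?G y y"
      by (rule M.local_metric_comparison[OF c \<epsilon>(1), of UNIV]) auto
    \<comment> \<open>The unit functional in direction \<open>w\<close>, shrunk so that it stays
      below the metric on the whole ball and not only at its centre.\<close>
    define l where "l y = sqrt (1 - \<epsilon>) * (?H w y / a)" for y
    have lin: "linear l"
      unfolding l_def using linear_add[OF inner_form_linear_right[OF H]] linear_scale[OF inner_form_linear_right[OF H]]
      by (intro linearI) (simp_all add: add_divide_distrib distrib_left)
    have lbound: "\<bar>l y\<bar> \<le> sqrt (chart_metric N d (chart_inv d x) y y)"
      if "x \<in> cball (snd d (f p)) r" for x y
    proof -
      have "\<bar>?H w y\<bar> = sqrt ((?H w y)\<^sup>2)" by simp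
      also have "\<dots> \<le> sqrt (?H w w * ?H y y)"
        by (intro real_sqrt_le_mono inner_form_Cauchy_Schwarz[OF H])
      also have "\<dots> = a * sqrt (?H y y)" by (simp add: a_def real_sqrt_mult)
      finally have "\<bar>?H w y\<bar> / a \<le> sqrt (?H y y)" using a by (simp add: field_simps)
      from mult_left_mono[OF this, of "sqrt (1 - \<epsilon>)"]
      have "\<bar>l y\<bar> \<le> sqrt (1 - \<epsilon>) * sqrt (?H y y)"
        using \<epsilon> a by (simp add: l_def abs_mult)
      also have "\<dots> = sqrt ((1 - \<epsilon>) * ?H y y)" by (simp add: real_sqrt_mult)
      also have "\<dots> \<le> sqrt (chart_metric N d (chart_inv d x) y y)"
        using near[OF that] by (rule real_sqrt_le_mono)
      finally show ?thesis .
    qed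
    define \<phi> where "\<phi> t = l (snd d (f (chart_inv c (snd c p + t *\<^sub>R v))))" for t
    have "(\<phi> has_real_derivative l w) (at 0)"
    proof -
      have line: "((\<lambda>t. snd c p + t *\<^sub>R v) has_vector_derivative v) (at 0)"
        by (auto intro!: derivative_eq_intros)
      have "((snd d \<circ> f \<circ> chart_inv c) has_derivative A) (at (snd c p + 0 *\<^sub>R v))" using A by simp
      from vector_derivative_diff_chain_within[OF line has_derivative_at_withinI[OF this]]
      have "(((snd d \<circ> f \<circ> chart_inv c) \<circ> (\<lambda>t. snd c p + t *\<^sub>R v)) has_vector_derivative w) (at 0)"
        unfolding w_def .
      from bounded_linear.has_vector_derivative[OF lin[unfolded linear_conv_bounded_linear] this]
      show ?thesis by (simp add: \<phi>_def[abs_def] has_real_derivative_iff_has_vector_derivative o_def)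
    qed
    then have "((\<lambda>t. (\<phi> (0 + t) - \<phi> 0) / t) \<longlongrightarrow> l w) (at 0)" by (simp only: DERIV_def)
    then have lim: "((\<lambda>t. \<bar>(\<phi> t - \<phi> 0) / t\<bar>) \<longlongrightarrow> \<bar>l w\<bar>) (at_right 0)"
      by (intro tendsto_rabs) (auto intro: tendsto_mono[OF at_le])
    \<comment> \<open>The first bound keeps the segment inside the ball of radius \<rho>. The second
      makes C t b < \<kappa> r, so in the lower distance bound the minimum must be the term with
      \<open>l\<close>.\<close>
    define t0 where "t0 = min (\<rho> / (norm v + 1)) (\<kappa> * r / (C * b + 1))"
    have Cb: "0 \<le> C * b" using C(1) b by simp
    have t0: "0 < t0" using \<rho>(1) \<kappa>(1) r(1) Cb by (simp add: t0_def add_nonneg_pos)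
    have quot: "\<bar>(\<phi> t - \<phi> 0) / t\<bar> \<le> C * b" if t: "0 < t" "t < t0" for t
    proof -
      let ?p' = "chart_inv c (snd c p + t *\<^sub>R v)"
      have "t * (norm v + 1) < \<rho>"
        using t(2) by (simp add: t0_def pos_less_divide_eq add_nonneg_pos)
      then have tv: "norm (t *\<^sub>R v) < \<rho>" using t(1) by (simp add: algebra_simps)
      have "t * (C * b + 1) < \<kappa> * r"
        using t(2) Cb by (simp add: t0_def pos_less_divide_eq add_nonneg_pos)
      then have tCb: "C * (t * b) < \<kappa> * r" using t(1) by (simp add: algebra_simps)
      have "min (ennreal (\<kappa> * r)) (ennreal \<bar>l (snd d (f ?p') - snd d (f p))\<bar>) \<le> riem_dist N (f p) (f ?p')"
        using r(2) lbound by (intro N.riem_dist_lower_bound(2)[OF d r(1) _ \<kappa> lin]) auto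
      also have "\<dots> \<le> ennreal C * riem_dist M p ?p'" by (rule C(2))
      also have "\<dots> \<le> ennreal C * ennreal (t * b)"
      proof (intro mult_left_mono M.riem_dist_upper_bound[OF c _ tv])
        show "cball (snd c p) \<rho> \<subseteq> snd c ` fst c" using \<rho>(2) by simp
        fix x assume "x \<in> cball (snd c p) \<rho>"
        from \<rho>(3)[OF this, of v] have "chart_metric M c (chart_inv c x) v v \<le> (1 + \<epsilon>) * ?G v v"
          by (simp add: abs_le_iff algebra_simps)
        then have le: "t * (t * chart_metric M c (chart_inv c x) v v) \<le> t * (t * b\<^sup>2)"
          using t(1) Gv \<epsilon> by (intro mult_left_mono) (simp_all add: b_def)
        have cx: "c \<in> charts_at M (chart_inv c x)"
          using \<open>x \<in> cball (snd c p) \<rho>\<close> \<rho>(2) M.chart(7)[OF cM(1), of x] cM(1) by (auto simp: charts_at_def)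
        show "chart_metric M c (chart_inv c x) (t *\<^sub>R v) (t *\<^sub>R v) \<le> (t * b)\<^sup>2"
          using le linear_scale[OF inner_form_linear_left[OF M.inner_form_chart_metric[OF cx]]]
            linear_scale[OF inner_form_linear_right[OF M.inner_form_chart_metric[OF cx]]]
          by (simp add: power2_eq_square mult_ac)
      qed (use t b in auto)
      also have "\<dots> = ennreal (C * (t * b))" using C(1) t(1) b by (simp add: ennreal_mult)
      finally have "ennreal \<bar>l (snd d (f ?p') - snd d (f p))\<bar> \<le> ennreal (C * (t * b))"
        using tCb mult_pos_pos[OF \<kappa>(1) r(1)] by (auto simp: min_le_iff_disj ennreal_le_iff2)
      moreover have "0 \<le> C * (t * b)" using C(1) t(1) b by simp
      ultimately have "\<bar>l (snd d (f ?p') - snd d (f p))\<bar> \<le> C * (t * b)" by (simp add: ennreal_le_iff)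
      moreover have "\<phi> t - \<phi> 0 = l (snd d (f ?p') - snd d (f p))"
        using M.chart(5)[OF cM] by (simp add: \<phi>_def linear_diff[OF lin])
      ultimately show ?thesis using t(1) by (simp add: abs_divide pos_divide_le_eq mult_ac)
    qed
    have "\<bar>l w\<bar> \<le> C * b"
    proof (rule tendsto_upperbound[OF lim])
      show "\<forall>\<^sub>F t in at_right 0. \<bar>(\<phi> t - \<phi> 0) / t\<bar> \<le> C * b"
        unfolding eventually_at_right_field using t0 quot by blast
    qed simp
    moreover have "l w = sqrt (1 - \<epsilon>) * a" using a a2 by (simp add: l_def field_simps flip: a2)
    ultimately have "(sqrt (1 - \<epsilon>) * a)\<^sup>2 \<le> (C * b)\<^sup>2"
      using a \<epsilon> by (intro power_mono) auto
    then show ?thesis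
      using \<epsilon> Hw Gv by (simp add: power_mult_distrib a_def b_def w_def)
  qed
qed

lemma differential_bound:
  assumes lip: "riem_lipschitz_const M N f C" and c: "c \<in> charts_at M p" and d: "d \<in> charts_at N (f p)"
    and A: "((snd d \<circ> f \<circ> chart_inv c) has_derivative A) (at (snd c p))"
  shows "chart_metric N d (f p) (A v) (A v) \<le> C\<^sup>2 * chart_metric M c p v v"
proof (rule tendsto_le)
  let ?h = "chart_metric N d (f p) (A v) (A v)" and ?g = "chart_metric M c p v v"
  show "((\<lambda>\<epsilon>. C\<^sup>2 * ((1 + \<epsilon>) * ?g)) \<longlongrightarrow> C\<^sup>2 * ?g) (at_right 0)"
    by (auto intro!: tendsto_eq_intros)
  show "((\<lambda>\<epsilon>. (1 - \<epsilon>) * ?h) \<longlongrightarrow> ?h) (at_right 0)"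
    by (auto intro!: tendsto_eq_intros)
  show "\<forall>\<^sub>F \<epsilon> in at_right 0. (1 - \<epsilon>) * ?h \<le> C\<^sup>2 * ((1 + \<epsilon>) * ?g)"
    unfolding eventually_at_right_field
    using differential_bound_eps[OF lip c d A] zero_less_one by blast
qed simp

lemma lipschitz_constant_nonneg:
  assumes "riem_lipschitz M N f" shows "0 \<le> lipschitz_constant M N f"
  unfolding lipschitz_constant_def
  by (rule cInf_greatest) (use assms in \<open>auto simp: riem_lipschitz_def riem_lipschitz_const_def\<close>)

text \<open>After taking square roots the estimate is linear in the constant and passes to the
  infimum; division by the length of v separates the case where this length is 0.\<close>

lemma lipschitz_constant_bound:
  assumes lip: "riem_lipschitz M N f" and c: "c \<in> charts_at M p" and d: "d \<in> charts_at N (f p)"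
    and A: "((snd d \<circ> f \<circ> chart_inv c) has_derivative A) (at (snd c p))"
  shows "chart_metric N d (f p) (A v) (A v) \<le> (lipschitz_constant M N f)\<^sup>2 * chart_metric M c p v v"
proof -
  let ?S = "{C. riem_lipschitz_const M N f C}"
  let ?h = "chart_metric N d (f p) (A v) (A v)" and ?g = "chart_metric M c p v v"
  have ne: "?S \<noteq> {}" using lip by (auto simp: riem_lipschitz_def)
  have nonneg: "0 \<le> C" if "C \<in> ?S" for C using that by (simp add: riem_lipschitz_const_def)
  have g: "0 \<le> ?g" using inner_form_nonneg[OF M.inner_form_chart_metric[OF c]] .
  have h: "0 \<le> ?h" using inner_form_nonneg[OF N.inner_form_chart_metric[OF d]] .
  have bound: "sqrt ?h \<le> C * sqrt ?g" if "C \<in> ?S" for C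
    using real_sqrt_le_mono[OF differential_bound[OF _ c d A, of C v]] that nonneg[OF that]
    by (simp add: real_sqrt_mult)
  have "sqrt ?h \<le> lipschitz_constant M N f * sqrt ?g"
  proof (cases "?g = 0")
    case True
    then show ?thesis using bound ne by auto
  next
    case False
    then have pos: "0 < sqrt ?g" using g by simp
    have "sqrt ?h / sqrt ?g \<le> lipschitz_constant M N f"
      unfolding lipschitz_constant_def using bound pos
      by (intro cInf_greatest[OF ne]) (simp add: pos_divide_le_eq)
    then show ?thesis using pos by (simp add: pos_divide_le_eq)
  qed
  then have "(sqrt ?h)\<^sup>2 \<le> (lipschitz_constant M N f * sqrt ?g)\<^sup>2"
    using h by (intro power_mono) auto
  then show ?thesis
    using h g by (simp add: power_mult_distrib)
qed

end

section \<open>Measurability of the derivative of a continuous map\<close>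

lemma has_vector_derivative_quotient_tendsto:
  assumes "(f has_vector_derivative D) (at 0)"
  shows "((\<lambda>t. (f t - f 0) /\<^sub>R t) \<longlongrightarrow> D) (at 0)"
proof (rule tendstoI)
  fix e :: real assume "0 < e"
  then have "0 < e / 2" by simp
  with assms[unfolded has_vector_derivative_def has_derivative_at_alt] obtain d where d: "0 < d"
    "\<And>t. norm (t - 0) < d \<Longrightarrow> norm (f t - f 0 - (t - 0) *\<^sub>R D) \<le> e / 2 * norm (t - 0)" by blast
  have "dist ((f t - f 0) /\<^sub>R t) D < e" if t: "t \<noteq> 0" "dist t 0 < d" for t
  proof -
    have "(f t - f 0) /\<^sub>R t - D = (f t - f 0 - t *\<^sub>R D) /\<^sub>R t"
      using t(1) by (simp add: scaleR_diff_right)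
    then have "dist ((f t - f 0) /\<^sub>R t) D = norm (f t - f 0 - t *\<^sub>R D) / \<bar>t\<bar>"
      by (simp add: dist_norm divide_inverse mult.commute)
    also have "\<dots> \<le> e / 2" using d(2)[of t] t by (simp add: pos_divide_le_eq)
    finally show ?thesis using \<open>0 < e\<close> by simp
  qed
  then show "\<forall>\<^sub>F t in at 0. dist ((f t - f 0) /\<^sub>R t) D < e"
    unfolding eventually_at using d(1) by blast
qed

text \<open>The candidate for the derivative is the linear map given by the limits of difference
  quotients along the basis; differentiability can then be tested on a countable dense set of
  increments.\<close>
lemma derivative_measurable:
  fixes F :: "'a::euclidean_space \<Rightarrow> 'b::euclidean_space"
  assumes W: "open W" and cont: "continuous_on W F"
  defines "S \<equiv> {x\<in>W. F differentiable (at x)}"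
  shows "(\<lambda>x. if x \<in> S then frechet_derivative F (at x) v else 0) \<in> borel_measurable borel"
proof -
  \<comment> \<open>Extension by 0 yields a Borel function on the whole space, so shifted arguments
    may leave \<open>W\<close>.\<close>
  define F0 where "F0 x = indicator W x *\<^sub>R F x" for x
  \<comment> \<open>Where the sequence diverges \<open>lim\<close> has a fixed unspecified value, so
    \<open>P b\<close> is Borel everywhere and not merely where the partial derivative
    exists.\<close>
  define P where "P b x = lim (\<lambda>n. real (Suc n) *\<^sub>R (F0 (x + inverse (real (Suc n)) *\<^sub>R b) - F0 x))" for b x
  define L where "L x h = (\<Sum>b\<in>Basis. (h \<bullet> b) *\<^sub>R P b x)" for x h
  have F0 [measurable]: "F0 \<in> borel_measurable borel"
    unfolding F0_def by (rule borel_measurable_continuous_on_indicator[OF borel_open[OF W] cont])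
  have [measurable]: "P b \<in> borel_measurable borel" for b
    unfolding P_def by measurable
  have L [measurable]: "(\<lambda>x. L x h) \<in> borel_measurable borel" for h
    unfolding L_def by measurable
  have linL: "bounded_linear (L x)" for x
    unfolding L_def by (intro bounded_linear_sum bounded_linear_scaleR_left[THEN bounded_linear_compose]
        bounded_linear_inner_left)
  have nbhd: "\<exists>e>0. \<forall>h. norm h < e \<longrightarrow> x + h \<in> W" if "x \<in> W" for x
  proof -
    obtain e where e: "0 < e" "ball x e \<subseteq> W" using W \<open>x \<in> W\<close> open_contains_ball_eq by blast
    have "x + h \<in> ball x e" if "norm h < e" for h using that by (simp add: dist_norm)
    then show ?thesis using e by blast
  qed
  have F0W: "F0 x = F x" if "x \<in> W" for x using that by (simp add: F0_def)
  have derL: "D = L x" if x: "x \<in> W" and D: "(F has_derivative D) (at x)" for x D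
  proof -
    have lim: "P b x = D b" for b
      unfolding P_def
    proof (rule limI)
      have "((\<lambda>t. x + t *\<^sub>R b) has_vector_derivative b) (at 0)"
        by (auto intro!: derivative_eq_intros)
      moreover have "(F has_derivative D) (at (x + 0 *\<^sub>R b))" using D by simp
      ultimately have "((F \<circ> (\<lambda>t. x + t *\<^sub>R b)) has_vector_derivative D b) (at 0)"
        by (metis vector_derivative_diff_chain_within has_derivative_at_withinI)
      then have lim: "((\<lambda>t. (F (x + t *\<^sub>R b) - F x) /\<^sub>R t) \<longlongrightarrow> D b) (at 0)"
        using has_vector_derivative_quotient_tendsto[of "F \<circ> (\<lambda>t. x + t *\<^sub>R b)"] by simp
      have seq: "filterlim (\<lambda>n. inverse (real (Suc n))) (at 0) sequentially"
        unfolding filterlim_at using LIMSEQ_inverse_real_of_nat by simp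
      have "(\<lambda>n. (F (x + inverse (real (Suc n)) *\<^sub>R b) - F x) /\<^sub>R inverse (real (Suc n))) \<longlonglongrightarrow> D b"
        using filterlim_compose[OF lim seq] .
      moreover have "\<forall>\<^sub>F n in sequentially. (F (x + inverse (real (Suc n)) *\<^sub>R b) - F x) /\<^sub>R inverse (real (Suc n))
          = real (Suc n) *\<^sub>R (F0 (x + inverse (real (Suc n)) *\<^sub>R b) - F0 x)"
      proof -
        obtain e where e: "0 < e" "\<And>h. norm h < e \<Longrightarrow> x + h \<in> W" using nbhd[OF x] by blast
        have "(\<lambda>n. norm (inverse (real (Suc n)) *\<^sub>R b)) \<longlonglongrightarrow> norm (0 *\<^sub>R b)"
          by (intro tendsto_intros LIMSEQ_inverse_real_of_nat)
        then have "\<forall>\<^sub>F n in sequentially. norm (inverse (real (Suc n)) *\<^sub>R b) < e"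
          using e(1) by (intro order_tendstoD) auto
        then show ?thesis
        proof eventually_elim
          case (elim n)
          then show ?case using F0W[OF e(2)[OF elim]] F0W[OF x] by simp
        qed
      qed
      ultimately show "(\<lambda>n. real (Suc n) *\<^sub>R (F0 (x + inverse (real (Suc n)) *\<^sub>R b) - F0 x)) \<longlonglongrightarrow> D b"
        by (rule Lim_transform_eventually)
    qed
    have linD: "linear D" using D by (rule has_derivative_linear)
    show ?thesis
    proof
      fix h
      have "D h = D (\<Sum>b\<in>Basis. (h \<bullet> b) *\<^sub>R b)" by (simp add: euclidean_representation)
      then show "D h = L x h" by (simp add: L_def lim linear_sum[OF linD] linear_scale[OF linD])
    qed
  qed
  obtain Q :: "'a set" where Q: "countable Q" "\<And>X. open X \<Longrightarrow> X \<noteq> {} \<Longrightarrow> \<exists>q\<in>Q. q \<in> X"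
    using countable_dense_exists by blast
  then have "Q \<noteq> {}" using open_UNIV by blast
  define q where "q = from_nat_into Q"
  have q: "range q = Q" unfolding q_def using \<open>Q \<noteq> {}\<close> Q(1) by (rule range_from_nat_into)
  \<comment> \<open>The definition of the derivative with tolerance 1/(k+1), radius 1/(j+1) and
    increments from the dense sequence \<open>q\<close>: only countable quantifiers remain, so the
    set is Borel.\<close>
  let ?test = "\<lambda>x. \<forall>k::nat. \<exists>j::nat. \<forall>n::nat. norm (q n) < inverse (real (Suc j)) \<longrightarrow>
      norm (F0 (x + q n) - F0 x - L x (q n)) \<le> inverse (real (Suc k)) * norm (q n)"
  have S: "S = {x\<in>W. ?test x}"
  proof (intro set_eqI iffI)
    fix x assume "x \<in> S"
    then obtain D where x: "x \<in> W" and "(F has_derivative D) (at x)" by (auto simp: S_def differentiable_def)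
    then have "(F has_derivative L x) (at x)" using derL by blast
    then have der: "\<And>e. 0 < e \<Longrightarrow> \<exists>d>0. \<forall>y. norm (y - x) < d \<longrightarrow> norm (F y - F x - L x (y - x)) \<le> e * norm (y - x)"
      unfolding has_derivative_at_alt by blast
    obtain e where e: "0 < e" "\<And>h. norm h < e \<Longrightarrow> x + h \<in> W" using nbhd[OF x] by blast
    have "?test x"
    proof
      fix k
      have "0 < inverse (real (Suc k))" by simp
      from der[OF this] obtain d where d: "0 < d"
        "\<And>y. norm (y - x) < d \<Longrightarrow> norm (F y - F x - L x (y - x)) \<le> inverse (real (Suc k)) * norm (y - x)" by blast
      obtain j where j: "inverse (real (Suc j)) < min d e"
        using reals_Archimedean[of "min d e"] d(1) e(1) by auto
      have "norm (F0 (x + h) - F0 x - L x h) \<le> inverse (real (Suc k)) * norm h"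
        if h: "norm h < inverse (real (Suc j))" for h
      proof -
        have "norm h < e" "norm ((x + h) - x) < d" using h j by auto
        then show ?thesis using d(2)[of "x + h"] F0W[OF e(2), of h] F0W[OF x] by simp
      qed
      then show "\<exists>j. \<forall>n. norm (q n) < inverse (real (Suc j)) \<longrightarrow>
          norm (F0 (x + q n) - F0 x - L x (q n)) \<le> inverse (real (Suc k)) * norm (q n)" by blast
    qed
    then show "x \<in> {x\<in>W. ?test x}" using x by simp
  next
    fix x assume "x \<in> {x\<in>W. ?test x}"
    then have x: "x \<in> W" and test: "?test x" by auto
    obtain e where e: "0 < e" "\<And>h. norm h < e \<Longrightarrow> x + h \<in> W" using nbhd[OF x] by blast
    have "(F has_derivative L x) (at x)"
      unfolding has_derivative_at_alt
    proof (intro conjI allI impI linL)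
      fix \<epsilon> :: real assume "0 < \<epsilon>"
      then obtain k where k: "inverse (real (Suc k)) < \<epsilon>" using reals_Archimedean by blast
      from test obtain j where j: "\<And>n. norm (q n) < inverse (real (Suc j)) \<Longrightarrow>
          norm (F0 (x + q n) - F0 x - L x (q n)) \<le> inverse (real (Suc k)) * norm (q n)" by blast
      define d where "d = min e (inverse (real (Suc j)))"
      have d: "0 < d" using e(1) by (simp add: d_def)
      have "norm (F (x + h) - F x - L x h) \<le> \<epsilon> * norm h" if h: "norm h < d" for h
      \<comment> \<open>A violation at h persists on an open set of increments by continuity of
        \<open>F\<close>; that set contains some \<open>q n\<close>, for which the test gives the
        stronger bound with 1/(k+1) < \<epsilon>.\<close>
      proof (rule ccontr)
        assume contra: "\<not> norm (F (x + h) - F x - L x h) \<le> \<epsilon> * norm h"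
        let ?g = "\<lambda>h. norm (F (x + h) - F x - L x h) - \<epsilon> * norm h"
        have "continuous_on (ball 0 d) (\<lambda>h. F (x + h))"
        proof (rule continuous_on_compose2[OF cont])
          show "(\<lambda>h. x + h) ` ball 0 d \<subseteq> W" using e(2) by (intro image_subsetI) (simp add: d_def)
        qed (intro continuous_intros)
        then have "continuous_on (ball 0 d) ?g"
          by (intro continuous_intros linear_continuous_on[OF linL])
        then have "open (ball 0 d \<inter> ?g -` {0<..})"
          by (intro continuous_open_preimage) auto
        moreover have "h \<in> ball 0 d \<inter> ?g -` {0<..}" using h contra by auto
        ultimately obtain n where n: "q n \<in> ball 0 d \<inter> ?g -` {0<..}" using Q(2) q by blast
        then have "norm (q n) < e" "norm (q n) < inverse (real (Suc j))" by (auto simp: d_def)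
        then have "norm (F (x + q n) - F x - L x (q n)) \<le> inverse (real (Suc k)) * norm (q n)"
          using j[of n] F0W[OF e(2)] F0W[OF x] by simp
        also have "\<dots> \<le> \<epsilon> * norm (q n)" using k by (intro mult_right_mono) auto
        finally show False using n by simp
      qed
      from this[of "y - x" for y] show "\<exists>d>0. \<forall>y. norm (y - x) < d \<longrightarrow> norm (F y - F x - L x (y - x)) \<le> \<epsilon> * norm (y - x)"
        using d by auto
    qed
    then show "x \<in> S" using x by (auto simp: S_def differentiable_def)
  qed
  have [measurable]: "W \<in> sets borel" using W by simp
  have "{x \<in> space borel. x \<in> W \<and> ?test x} \<in> sets borel" by measurable
  then have [measurable]: "S \<in> sets borel" by (simp add: S)
  have "(\<lambda>x. if x \<in> S then frechet_derivative F (at x) v else 0) = (\<lambda>x. if x \<in> S then L x v else 0)"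
  proof
    fix x
    show "(if x \<in> S then frechet_derivative F (at x) v else 0) = (if x \<in> S then L x v else 0)"
    proof (cases "x \<in> S")
      case True
      then have "(F has_derivative frechet_derivative F (at x)) (at x)" "x \<in> W"
        by (auto simp: S_def frechet_derivative_works)
      then show ?thesis using derL by simp
    qed simp
  qed
  then show ?thesis by simp
qed

section \<open>The pointwise norm of forms\<close>

context riem_mfd
begin

lemma alternating_coordinates:
  assumes a: "alternating_form M p \<alpha>" and c: "c \<in> charts_at M p"
  shows "alternating (\<lambda>ys. \<alpha> (map (chart_vec M c p) ys))"
  unfolding alternating_def multilin_def
proof (intro conjI allI impI)
  note T = chart_vec_in_tangent_space[OF c]
  fix us ws u v x y
  have "set (map (chart_vec M c p) us) \<union> set (map (chart_vec M c p) ws) \<union> {chart_vec M c p u, chart_vec M c p v} \<subseteq> tangent_space M p"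
    using T by auto
  then have "\<alpha> (map (chart_vec M c p) us @ tlin x (chart_vec M c p u) y (chart_vec M c p v) # map (chart_vec M c p) ws) =
     complex_of_real x * \<alpha> (map (chart_vec M c p) us @ chart_vec M c p u # map (chart_vec M c p) ws)
     + complex_of_real y * \<alpha> (map (chart_vec M c p) us @ chart_vec M c p v # map (chart_vec M c p) ws)"
    using a unfolding alternating_form_def by blast
  then show "\<alpha> (map (chart_vec M c p) (us @ (x *\<^sub>R u + y *\<^sub>R v) # ws)) =
     complex_of_real x * \<alpha> (map (chart_vec M c p) (us @ u # ws))
     + complex_of_real y * \<alpha> (map (chart_vec M c p) (us @ v # ws))"
    by (simp add: chart_vec_lin[OF c])
next
  fix vs :: "(real^'m) list" assume "\<not> distinct vs"
  then have "\<not> distinct (map (chart_vec M c p) vs)" by (simp add: distinct_map)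
  moreover have "set (map (chart_vec M c p) vs) \<subseteq> tangent_space M p"
    using chart_vec_in_tangent_space[OF c] by auto
  ultimately show "\<alpha> (map (chart_vec M c p) vs) = 0" using a unfolding alternating_form_def by blast
qed

lemma chart_metric_measurable:
  assumes "c \<in> atlas M"
  shows "(\<lambda>p. chart_metric M c p (axis i 1) (axis j 1)) \<in> borel_measurable (restrict_space borel (fst c))"
  by (intro borel_measurable_continuous_on_restrict continuous_on_chart_metric' assms)

lemma chart_frame:
  assumes c: "c \<in> atlas M"
  obtains e :: "'m \<Rightarrow> 'a \<Rightarrow> real^'m" where "\<And>i. e i \<in> borel_measurable (restrict_space borel (fst c))"
    and "\<And>p i j. p \<in> fst c \<Longrightarrow> chart_metric M c p (e i p) (e j p) = (if i = j then 1 else 0)"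
proof (rule measurable_orthonormal_frame[of "restrict_space borel (fst c)" "chart_metric M c"])
  show "inner_form (chart_metric M c p)" if "p \<in> space (restrict_space borel (fst c))" for p
    using that c by (intro inner_form_chart_metric) (auto simp: space_restrict_space charts_at_def)
qed (use chart_metric_measurable[OF c] that in \<open>auto simp: space_restrict_space\<close>)

lemma orthonormal_basis_exists: "\<exists>es. orthonormal_basis M p es"
proof -
  obtain c where c: "c \<in> charts_at M p" using charts_at_nonempty by blast
  obtain e :: "'m \<Rightarrow> 'a \<Rightarrow> real^'m"
    where e: "\<And>i j. chart_metric M c p (e i p) (e j p) = (if i = j then 1 else 0)"
    using chart_frame[OF charts_atD(1)[OF c]] charts_atD(2)[OF c] by metis
  obtain xs :: "'m list" where xs: "set xs = UNIV" "distinct xs"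
    using finite_distinct_list[of "UNIV :: 'm set"] by auto
  then have len: "length xs = CARD('m)" by (metis distinct_card)
  show ?thesis
    unfolding orthonormal_basis_def
    by (intro exI[of _ "map (\<lambda>i. chart_vec M c p (e i p)) xs"])
      (use xs in \<open>auto simp: len chart_vec_in_tangent_space[OF c] nth_eq_iff_index_eq e
        simp flip: chart_metric_def\<close>)
qed

text \<open>The tensor estimate for the identity map with constant 1, applied in both directions,
  makes the tensor norms of any two orthonormal bases equal. The basis picked by \<open>SOME\<close>
  can therefore be replaced by any convenient one.\<close>

lemma form_norm_sq_eq_tensor_norm:
  assumes a: "alternating_form M p \<alpha>" and c: "c \<in> charts_at M p"
    and e: "\<And>i j. chart_metric M c p (e i) (e j) = (if i = j then 1 else 0)"
  shows "form_norm_sq M p \<alpha> =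
    (\<Sum>k\<le>CARD('m). tensor_norm_sq (\<lambda>ys. \<alpha> (map (chart_vec M c p) ys)) (e :: 'm \<Rightarrow> _) UNIV k / fact k)"
proof -
  let ?a = "\<lambda>ys. \<alpha> (map (chart_vec M c p) ys)" and ?G = "chart_metric M c p"
  define es where "es = (SOME es. orthonormal_basis M p es)"
  have es: "orthonormal_basis M p es" unfolding es_def by (rule someI_ex[OF orthonormal_basis_exists])
  define fs where "fs = map (\<lambda>v. v c) es"
  have len: "length es = CARD('m)" "length fs = CARD('m)" using es by (simp_all add: orthonormal_basis_def fs_def)
  have tan: "set es \<subseteq> tangent_space M p" using es by (simp add: orthonormal_basis_def)
  have "map (chart_vec M c p) fs = map (\<lambda>v. v) es"
    unfolding fs_def map_map using tan chart_vec_of_tangent[OF c] by (intro map_cong) auto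
  then have nths: "?a (nths fs I) = \<alpha> (nths es I)" for I by (simp add: nths_map[symmetric])
  have fs: "?G (fs ! i) (fs ! j) = (if i = j then 1 else 0)" if "i \<in> {..<CARD('m)}" "j \<in> {..<CARD('m)}" for i j
  proof -
    have "es ! i \<in> tangent_space M p" "es ! j \<in> tangent_space M p" using that tan len by auto
    then have "?G (fs ! i) (fs ! j) = metric M p (es ! i) (es ! j)"
      using that len metric_eq_chart_metric[OF c] by (simp add: fs_def)
    then show ?thesis using es that by (simp add: orthonormal_basis_def)
  qed
  have alt: "alternating ?a" by (rule alternating_coordinates[OF a c])
  then have ml: "multilin ?a" by (simp add: alternating_def)
  note G = inner_form_chart_metric[OF c]
  have exp_e: "y = (\<Sum>j\<in>UNIV. ?G y (e j) *\<^sub>R e j)" for y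
    by (rule orthonormal_expansion[OF G]) (simp_all add: e)
  have exp_f: "y = (\<Sum>j\<in>{..<CARD('m)}. ?G y (fs ! j) *\<^sub>R fs ! j)" for y
    by (rule orthonormal_expansion[OF G]) (simp_all add: fs)
  have "tensor_norm_sq ?a ((!) fs) {..<CARD('m)} k = tensor_norm_sq ?a e UNIV k" for k
  proof (rule antisym)
    show "tensor_norm_sq ?a ((!) fs) {..<CARD('m)} k \<le> tensor_norm_sq ?a e UNIV k"
      using tensor_norm_sq_bound[OF G G linear_id, of 1 "{..<CARD('m)}" "(!) fs" UNIV e ?a k] fs e exp_e ml
      by simp
    show "tensor_norm_sq ?a e UNIV k \<le> tensor_norm_sq ?a ((!) fs) {..<CARD('m)} k"
      using tensor_norm_sq_bound[OF G G linear_id, of 1 UNIV e "{..<CARD('m)}" "(!) fs" ?a k] fs e exp_f ml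
      by simp
  qed
  moreover have "form_norm_sq M p \<alpha> = (\<Sum>I\<in>Pow {..<CARD('m)}. (cmod (?a (nths fs I)))\<^sup>2)"
    unfolding form_norm_sq_def es_def[symmetric] Let_def nths ..
  ultimately show ?thesis by (simp add: sum_nths_eq_tensor_norm_sq[OF alt len(2)])
qed

lemma form_norm_sq_nonneg: "0 \<le> form_norm_sq M p \<alpha>"
  unfolding form_norm_sq_def Let_def by (rule sum_nonneg) simp

lemma id_measurable_restrict:
  "(\<lambda>p. p) \<in> measurable (restrict_space (completion (rvol M)) U) (restrict_space borel U)"
  by (rule measurable_restrict_space3) (auto intro: measurable_completion)

text \<open>Over each chart domain the arbitrarily chosen bases are replaced by a measurable
  orthonormal frame; countably many charts cover the manifold.\<close>

lemma form_norm_sq_measurable: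
  assumes \<omega>: "\<omega> \<in> measurable_forms M"
  shows "(\<lambda>p. form_norm_sq M p (\<omega> p)) \<in> borel_measurable (completion (rvol M))"
proof -
  have alt: "alternating_form M p (\<omega> p)" for p using \<omega> by (simp add: measurable_forms_def)
  obtain C where C: "countable C" "C \<subseteq> atlas M" "(\<Union>c\<in>C. fst c) = UNIV" by (rule countable_atlas)
  show ?thesis
  proof (rule measurable_piecewise_restrict[of "fst ` C"])
    fix U assume "U \<in> fst ` C"
    then obtain c where c: "c \<in> atlas M" "U = fst c" using C(2) by blast
    let ?X = "restrict_space (completion (rvol M)) (fst c)"
    have at: "c \<in> charts_at M p" if "p \<in> space ?X" for p
      using that c(1) by (auto simp: space_restrict_space charts_at_def)
    obtain e :: "'m \<Rightarrow> 'a \<Rightarrow> real^'m" where e: "\<And>i. e i \<in> borel_measurable (restrict_space borel (fst c))"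
      and on: "\<And>p i j. p \<in> fst c \<Longrightarrow> chart_metric M c p (e i p) (e j p) = (if i = j then 1 else 0)"
      by (rule chart_frame[OF c(1)]) blast
    have e': "e i \<in> borel_measurable ?X" for i
      using measurable_compose[OF id_measurable_restrict e] .
    have meas: "(\<lambda>p. \<omega> p (map (chart_vec M c p) (map (\<lambda>j. e j p) js))) \<in> borel_measurable ?X" for js
    proof -
      have "(\<lambda>p. \<omega> p (map (chart_vec M c p) (map (\<lambda>v. v p) (map e js)))) \<in> borel_measurable ?X"
      proof (rule borel_measurable_multilin[where a = "\<lambda>p ys. \<omega> p (map (chart_vec M c p) ys)"])
        show "multilin (\<lambda>ys. \<omega> p (map (chart_vec M c p) ys))" if "p \<in> space ?X" for p
          using alternating_coordinates[OF alt at[OF that]] by (simp add: alternating_def)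
        show "(\<lambda>p. \<omega> p (map (chart_vec M c p) (map (\<lambda>j. axis j 1) is))) \<in> borel_measurable ?X" for "is"
        proof -
          have "(\<lambda>p. \<omega> p (map (\<lambda>i. coord_field M c i p) is)) \<in> borel_measurable ?X"
            using \<omega> c(1) unfolding measurable_forms_def by blast
          then show ?thesis by (simp add: coord_field_eq o_def)
        qed
      qed (use e' in auto)
      then show ?thesis by (simp add: o_def)
    qed
    have "(\<lambda>p. \<Sum>k\<le>CARD('m). tensor_norm_sq (\<lambda>ys. \<omega> p (map (chart_vec M c p) ys)) (\<lambda>i. e i p) UNIV k / fact k)
        \<in> borel_measurable ?X"
      unfolding tensor_norm_sq_def
      by (intro borel_measurable_sum borel_measurable_divide borel_measurable_power
          measurable_compose[OF meas borel_measurable_norm] borel_measurable_const)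
    also have "?this \<longleftrightarrow> (\<lambda>p. form_norm_sq M p (\<omega> p)) \<in> borel_measurable ?X"
    proof (rule measurable_cong)
      fix p assume p: "p \<in> space ?X"
      then have "p \<in> fst c" by (simp add: space_restrict_space)
      from form_norm_sq_eq_tensor_norm[OF alt at[OF p], of "\<lambda>i. e i p"] on[OF this]
      show "(\<Sum>k\<le>CARD('m). tensor_norm_sq (\<lambda>ys. \<omega> p (map (chart_vec M c p) ys)) (\<lambda>i. e i p) UNIV k / fact k)
          = form_norm_sq M p (\<omega> p)" by simp
    qed
    finally show "(\<lambda>p. form_norm_sq M p (\<omega> p)) \<in> borel_measurable (restrict_space (completion (rvol M)) U)"
      by (simp add: c(2))
  next
    fix U assume "U \<in> fst ` C"
    then have "U \<in> sets (rvol M)" using C(2) fst_chart_borel by auto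
    then show "U \<inter> space (completion (rvol M)) \<in> sets (completion (rvol M))"
      by (simp add: sets_completionI_sets)
  qed (use C in auto)
qed

end

section \<open>Pullback along R.-N.-Lipschitz maps\<close>

locale riem_lip = riem_map M N f
  for M :: "('a::{t2_space, second_countable_topology}, 'm::finite) riem"
    and N :: "('b::{t2_space, second_countable_topology}, 'n::finite) riem" and f +
  assumes rn: "RN_lipschitz M N f"
begin

lemma lip: "riem_lipschitz M N f"
  using rn by (simp add: RN_lipschitz_def)

lemma isCont_map: "isCont f p"
  using lip lipschitz_isCont by (auto simp: riem_lipschitz_def)

lemma continuous_map: "continuous_on UNIV f"
  by (simp add: continuous_at_imp_continuous_on isCont_map)

lemma borel_map: "f \<in> borel_measurable borel"
  by (rule borel_measurable_continuous_onI[OF continuous_map])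

text \<open>Set to 0 at points of non-differentiability, in accordance with
  \<open>differential\<close>, so that the coordinate formula, linearity and the norm bound hold at
  every point.\<close>

definition chart_deriv :: "('a, 'm) chart \<Rightarrow> ('b, 'n) chart \<Rightarrow> 'a \<Rightarrow> real^'m \<Rightarrow> real^'n" where
  "chart_deriv c d p = (if mfd_differentiable M N f p
     then frechet_derivative (snd d \<circ> f \<circ> chart_inv c) (at (snd c p)) else (\<lambda>_. 0))"

lemma chart_deriv:
  assumes c: "c \<in> charts_at M p" and d: "d \<in> charts_at N (f p)"
  shows "differential M N f p (chart_vec M c p x) = chart_vec N d (f p) (chart_deriv c d p x)"
    and "linear (chart_deriv c d p)"
    and "chart_metric N d (f p) (chart_deriv c d p x) (chart_deriv c d p x)
      \<le> (lipschitz_constant M N f)\<^sup>2 * chart_metric M c p x x"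
proof -
  show "differential M N f p (chart_vec M c p x) = chart_vec N d (f p) (chart_deriv c d p x)"
    by (simp add: chart_deriv_def differential_chart_vec[OF _ c d] differential_not_differentiable
        N.chart_vec_0[OF d])
  have der: "((snd d \<circ> f \<circ> chart_inv c) has_derivative chart_deriv c d p) (at (snd c p))"
    if "mfd_differentiable M N f p"
    using that c d by (simp add: chart_deriv_def mfd_differentiable_def frechet_derivative_works)
  show "linear (chart_deriv c d p)"
  proof (cases "mfd_differentiable M N f p")
    case True
    then show ?thesis using der has_derivative_linear by blast
  qed (simp add: chart_deriv_def linear_zero)
  show "chart_metric N d (f p) (chart_deriv c d p x) (chart_deriv c d p x)
      \<le> (lipschitz_constant M N f)\<^sup>2 * chart_metric M c p x x"
  proof (cases "mfd_differentiable M N f p")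
    case True
    then show ?thesis using lipschitz_constant_bound[OF lip c d der] by simp
  next
    case False
    then show ?thesis
      by (simp add: chart_deriv_def inner_form_zero[OF N.inner_form_chart_metric[OF d]]
          inner_form_nonneg[OF M.inner_form_chart_metric[OF c]])
  qed
qed

lemma differential_tangent:
  assumes "v \<in> tangent_space M p" shows "differential M N f p v \<in> tangent_space N (f p)"
proof -
  obtain c d where c: "c \<in> charts_at M p" and d: "d \<in> charts_at N (f p)"
    using M.charts_at_nonempty N.charts_at_nonempty by blast
  show ?thesis
    using chart_deriv(1)[OF c d, of "v c"] N.chart_vec_in_tangent_space[OF d]
    by (simp add: M.chart_vec_of_tangent[OF c assms])
qed

lemma differential_tlin:
  assumes "u \<in> tangent_space M p" "v \<in> tangent_space M p"
  shows "tlin a u b v \<in> tangent_space M p"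
    and "differential M N f p (tlin a u b v) = tlin a (differential M N f p u) b (differential M N f p v)"
proof -
  obtain c d where c: "c \<in> charts_at M p" and d: "d \<in> charts_at N (f p)"
    using M.charts_at_nonempty N.charts_at_nonempty by blast
  have uv: "chart_vec M c p (u c) = u" "chart_vec M c p (v c) = v"
    using assms M.chart_vec_of_tangent[OF c] by auto
  have *: "tlin a u b v = chart_vec M c p (a *\<^sub>R u c + b *\<^sub>R v c)"
    by (simp add: M.chart_vec_lin[OF c] uv)
  then show "tlin a u b v \<in> tangent_space M p" by (simp add: M.chart_vec_in_tangent_space[OF c])
  have "differential M N f p (tlin a u b v)
      = chart_vec N d (f p) (a *\<^sub>R chart_deriv c d p (u c) + b *\<^sub>R chart_deriv c d p (v c))"
    unfolding * chart_deriv(1)[OF c d]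
    using chart_deriv(2)[OF c d] by (simp add: linear_add linear_scale)
  also have "\<dots> = tlin a (differential M N f p u) b (differential M N f p v)"
    unfolding N.chart_vec_lin[OF d] chart_deriv(1)[OF c d, symmetric] uv ..
  finally show "differential M N f p (tlin a u b v) = tlin a (differential M N f p u) b (differential M N f p v)" .
qed

lemma pullback_alternating:
  assumes \<omega>: "alternating_form N (f p) (\<omega> (f p))"
  shows "alternating_form M p (pullback M N f \<omega> p)"
  unfolding alternating_form_def
proof (intro conjI allI impI)
  let ?d = "differential M N f p"
  have T: "set (map ?d vs) \<subseteq> tangent_space N (f p)" if "set vs \<subseteq> tangent_space M p" for vs
    using that differential_tangent by auto
  show "pullback M N f \<omega> p vs = 0" if "\<not> set vs \<subseteq> tangent_space M p" for vs
    using that by (simp add: pullback_def)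
  show "pullback M N f \<omega> p vs = 0" if "set vs \<subseteq> tangent_space M p \<and> \<not> distinct vs" for vs
  proof -
    have "\<not> distinct (map ?d vs)" using that by (simp add: distinct_map)
    then have "\<omega> (f p) (map ?d vs) = 0" using T that \<omega> unfolding alternating_form_def by blast
    then show ?thesis by (simp add: pullback_def)
  qed
  fix us ws u v a b
  assume t: "set us \<union> set ws \<union> {u, v} \<subseteq> tangent_space M p"
  then have uv: "u \<in> tangent_space M p" "v \<in> tangent_space M p" by auto
  have "set (map ?d us) \<union> set (map ?d ws) \<union> {?d u, ?d v} \<subseteq> tangent_space N (f p)"
    using t differential_tangent by auto
  then have "\<omega> (f p) (map ?d us @ tlin a (?d u) b (?d v) # map ?d ws) =
      complex_of_real a * \<omega> (f p) (map ?d us @ ?d u # map ?d ws)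
      + complex_of_real b * \<omega> (f p) (map ?d us @ ?d v # map ?d ws)"
    using \<omega> unfolding alternating_form_def by blast
  then show "pullback M N f \<omega> p (us @ tlin a u b v # ws) =
      complex_of_real a * pullback M N f \<omega> p (us @ u # ws)
      + complex_of_real b * pullback M N f \<omega> p (us @ v # ws)"
    using t differential_tlin[OF uv, of a b] by (simp add: pullback_def)
qed

section \<open>Pointwise norm estimate for the pullback\<close>

lemma pullback_coordinates:
  assumes c: "c \<in> charts_at M p" and d: "d \<in> charts_at N (f p)"
  shows "pullback M N f \<omega> p (map (chart_vec M c p) ys)
    = \<omega> (f p) (map (chart_vec N d (f p)) (map (chart_deriv c d p) ys))"
proof -
  have "set (map (chart_vec M c p) ys) \<subseteq> tangent_space M p"
    using M.chart_vec_in_tangent_space[OF c] by auto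
  then show ?thesis by (simp add: pullback_def o_def chart_deriv(1)[OF c d])
qed

lemma K_const_ge_1: "1 \<le> K_const M N f"
  by (simp add: K_const_def)

text \<open>Powers of C are monotone in the exponent, decreasing for C \<le> 1 and increasing
  otherwise, so they are bounded by the value at k = 0 or at k = n.\<close>

lemma K_const_power:
  assumes "k \<le> CARD('n)" shows "((lipschitz_constant M N f)\<^sup>2) ^ k \<le> (K_const M N f)\<^sup>2"
proof -
  let ?C = "lipschitz_constant M N f" and ?K = "K_const M N f"
  have C: "0 \<le> ?C" by (rule lipschitz_constant_nonneg[OF lip])
  have K: "?C ^ CARD('n) \<le> ?K" by (simp add: K_const_def)
  have "?C ^ k \<le> ?K"
  proof (cases "?C \<le> 1")
    case True
    then have "?C ^ k \<le> 1" using C by (simp add: power_le_one)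
    then show ?thesis using K_const_ge_1 by linarith
  next
    case False
    then have "?C ^ k \<le> ?C ^ CARD('n)" using assms by (intro power_increasing) auto
    then show ?thesis using K by linarith
  qed
  then have "(?C ^ k)\<^sup>2 \<le> ?K\<^sup>2" using C by (intro power_mono) auto
  then show ?thesis by (simp add: power_mult[symmetric] mult.commute)
qed

lemma pullback_norm_bound:
  assumes \<omega>: "alternating_form N (f p) (\<omega> (f p))"
  shows "form_norm_sq M p (pullback M N f \<omega> p) \<le> (K_const M N f)\<^sup>2 * form_norm_sq N (f p) (\<omega> (f p))"
proof -
  obtain c d where c: "c \<in> charts_at M p" and d: "d \<in> charts_at N (f p)"
    using M.charts_at_nonempty N.charts_at_nonempty by blast
  let ?m = "CARD('m)" and ?n = "CARD('n)" and ?C = "(lipschitz_constant M N f)\<^sup>2" and ?K = "(K_const M N f)\<^sup>2"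
  let ?a = "\<lambda>ys. \<omega> (f p) (map (chart_vec N d (f p)) ys)"
  obtain e :: "'m \<Rightarrow> 'a \<Rightarrow> real^'m" where e: "\<And>i j. chart_metric M c p (e i p) (e j p) = (if i = j then 1 else 0)"
    using M.chart_frame[OF charts_atD(1)[OF c]] charts_atD(2)[OF c] by metis
  obtain g :: "'n \<Rightarrow> 'b \<Rightarrow> real^'n" where g: "\<And>i j. chart_metric N d (f p) (g i (f p)) (g j (f p)) = (if i = j then 1 else 0)"
    using N.chart_frame[OF charts_atD(1)[OF d]] charts_atD(2)[OF d] by metis
  note G = M.inner_form_chart_metric[OF c] and H = N.inner_form_chart_metric[OF d]
  have alt: "alternating ?a" by (rule N.alternating_coordinates[OF \<omega> d])
  then have ml: "multilin ?a" by (simp add: alternating_def)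
  define t where "t k = tensor_norm_sq ?a (\<lambda>j. g j (f p)) UNIV k" for k
  have t: "0 \<le> t k" for k unfolding t_def tensor_norm_sq_def by (rule sum_nonneg) simp
  have t0: "t k = 0" if "?n < k" for k unfolding t_def by (rule tensor_norm_sq_eq_0[OF alt]) (use that in auto)
  have le: "tensor_norm_sq (\<lambda>ys. pullback M N f \<omega> p (map (chart_vec M c p) ys)) (\<lambda>i. e i p) UNIV k \<le> ?K * t k" for k
  proof -
    have "tensor_norm_sq (\<lambda>ys. ?a (map (chart_deriv c d p) ys)) (\<lambda>i. e i p) UNIV k \<le> ?C ^ k * t k"
      unfolding t_def
    proof (rule tensor_norm_sq_bound[OF G H chart_deriv(2)[OF c d] chart_deriv(3)[OF c d] finite _ finite])
      show "y = (\<Sum>j\<in>UNIV. chart_metric N d (f p) y (g j (f p)) *\<^sub>R g j (f p))" for y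
        by (rule orthonormal_expansion[OF H]) (simp_all add: g)
    qed (use e g ml in auto)
    \<comment> \<open>For k > n both sides are 0 because \<open>t k\<close> vanishes.\<close>
    also have "\<dots> \<le> ?K * t k"
      using K_const_power[of k] t0[of k] t[of k] by (cases "k \<le> ?n") (auto intro: mult_right_mono)
    finally show ?thesis unfolding pullback_coordinates[OF c d] .
  qed
  have "form_norm_sq M p (pullback M N f \<omega> p)
      = (\<Sum>k\<le>?m. tensor_norm_sq (\<lambda>ys. pullback M N f \<omega> p (map (chart_vec M c p) ys)) (\<lambda>i. e i p) UNIV k / fact k)"
    by (rule M.form_norm_sq_eq_tensor_norm[where e = "\<lambda>i. e i p", OF pullback_alternating[of p \<omega>, OF \<omega>] c e])
  also have "\<dots> \<le> (\<Sum>k\<le>?m. ?K * t k / fact k)"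
    by (intro sum_mono divide_right_mono le) simp
  \<comment> \<open>The norm on M sums up to dim M, that on N up to dim N. Passing to the larger
    range adds nonnegative terms, and all terms above n vanish.\<close>
  also have "\<dots> \<le> (\<Sum>k\<le>max ?m ?n. ?K * t k / fact k)"
    using t by (intro sum_mono2) auto
  also have "\<dots> = (\<Sum>k\<le>?n. ?K * t k / fact k)"
    by (intro sum.mono_neutral_right) (auto simp: t0)
  also have "\<dots> = ?K * (\<Sum>k\<le>?n. t k / fact k)" by (simp add: sum_distrib_left)
  also have "(\<Sum>k\<le>?n. t k / fact k) = form_norm_sq N (f p) (\<omega> (f p))"
    unfolding t_def by (rule N.form_norm_sq_eq_tensor_norm[where e = "\<lambda>j. g j (f p)", OF \<omega> d g, symmetric])
  finally show ?thesis .
qed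

section \<open>Composition with the map: null sets, measurability, Fiber Volume\<close>

lemma null_sets_map: "null_sets (rvol N) \<subseteq> null_sets (distr (rvol M) (rvol N) f)"
  using rn by (simp add: RN_lipschitz_def absolutely_continuous_def pushforward_measure_def)

lemma measurable_map: "f \<in> measurable (rvol M) (rvol N)"
  using borel_map by (simp cong: measurable_cong_sets)

text \<open>A set of the completion differs from a Borel set by part of a null set, and absolute
  continuity makes the preimage of the latter null.\<close>

lemma measurable_map_completion: "f \<in> measurable (completion (rvol M)) (completion (rvol N))"
  using complete_measure.measurable_completion2[OF completion.complete_measure_axioms
      measurable_completion[OF measurable_map]] null_sets_map
  by (simp add: distr_completion[OF measurable_map])

lemma AE_map:
  assumes "AE q in rvol N. P q" shows "AE p in rvol M. P (f p)"
proof -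
  have "AE q in distr (rvol M) (rvol N) f. P q"
    by (rule absolutely_continuous_AE[OF _ _ assms]) (simp_all add: absolutely_continuous_def null_sets_map)
  then show ?thesis by (rule AE_distrD[OF measurable_map])
qed

text \<open>In coordinates this is the measurability of the derivative of a continuous map on an
  open set; by \<open>mfd_differentiable_iff\<close> its differentiability set corresponds to that
  of \<open>f\<close>.\<close>

lemma chart_deriv_measurable:
  assumes c: "c \<in> atlas M" and d: "d \<in> atlas N"
  shows "(\<lambda>p. chart_deriv c d p v) \<in> borel_measurable (restrict_space borel (fst c \<inter> f -` fst d))"
proof -
  let ?V = "fst c \<inter> f -` fst d"
  let ?W = "snd c ` ?V" and ?F = "snd d \<circ> f \<circ> chart_inv c"
  have "open (f -` fst d)" using continuous_map N.chart(1)[OF d] by (simp add: open_vimage)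
  then have W: "open ?W" by (rule M.open_chart_image[OF c])
  have inv: "chart_inv c (snd c p) = p" if "p \<in> ?V" for p using that M.chart(5)[OF c] by blast
  have cont: "continuous_on ?W ?F"
  proof (intro continuous_on_compose)
    show "continuous_on ?W (chart_inv c)" by (rule continuous_on_subset[OF M.chart(4)[OF c]]) auto
    show "continuous_on (chart_inv c ` ?W) f" by (rule continuous_on_subset[OF continuous_map]) simp
    have "f ` chart_inv c ` ?W \<subseteq> fst d" using inv by auto
    then show "continuous_on (f ` chart_inv c ` ?W) (snd d)"
      by (rule continuous_on_subset[OF N.chart(3)[OF d]])
  qed
  define S where "S = {x \<in> ?W. ?F differentiable (at x)}"
  have m: "(\<lambda>x. if x \<in> S then frechet_derivative ?F (at x) v else 0) \<in> borel_measurable borel"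
    unfolding S_def by (rule derivative_measurable[OF W cont])
  have "snd c \<in> borel_measurable (restrict_space borel ?V)"
    by (intro borel_measurable_continuous_on_restrict continuous_on_subset[OF M.chart(3)[OF c]]) auto
  from measurable_compose[OF this m]
  have "(\<lambda>p. if snd c p \<in> S then frechet_derivative ?F (at (snd c p)) v else 0)
      \<in> borel_measurable (restrict_space borel ?V)" .
  also have "?this \<longleftrightarrow> (\<lambda>p. chart_deriv c d p v) \<in> borel_measurable (restrict_space borel ?V)"
  proof (rule measurable_cong)
    fix p assume "p \<in> space (restrict_space borel ?V)"
    then have p: "p \<in> ?V" by (simp add: space_restrict_space)
    then have "c \<in> charts_at M p" "d \<in> charts_at N (f p)" using c d by (auto simp: charts_at_def)
    from mfd_differentiable_iff[OF isCont_map this] have "snd c p \<in> S \<longleftrightarrow> mfd_differentiable M N f p"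
      using p by (auto simp: S_def)
    then show "(if snd c p \<in> S then frechet_derivative ?F (at (snd c p)) v else 0) = chart_deriv c d p v"
      by (simp add: chart_deriv_def)
  qed
  finally show ?thesis .
qed

lemma pullback_measurable_forms:
  assumes \<omega>: "\<omega> \<in> measurable_forms N"
  shows "pullback M N f \<omega> \<in> measurable_forms M"
proof -
  have alt: "alternating_form N q (\<omega> q)" for q using \<omega> by (simp add: measurable_forms_def)
  obtain D where D: "countable D" "D \<subseteq> atlas N" "(\<Union>d\<in>D. fst d) = UNIV" by (rule N.countable_atlas)
  have "(\<lambda>p. pullback M N f \<omega> p (map (\<lambda>i. coord_field M c i p) is))
      \<in> borel_measurable (restrict_space (completion (rvol M)) (fst c))"
    if c: "c \<in> atlas M" for c "is"
  proof (rule measurable_piecewise_restrict[of "(\<lambda>d. f -` fst d) ` D"])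
    fix U assume "U \<in> (\<lambda>d. f -` fst d) ` D"
    then obtain d where d: "d \<in> atlas N" "U = f -` fst d" using D(2) by blast
    let ?V = "fst c \<inter> f -` fst d"
    let ?X = "restrict_space (completion (rvol M)) ?V"
    have at: "c \<in> charts_at M p" "d \<in> charts_at N (f p)" if "p \<in> space ?X" for p
      using that c d(1) by (auto simp: space_restrict_space charts_at_def)
    have "(\<lambda>p. \<omega> (f p) (map (chart_vec N d (f p)) (map (\<lambda>v. v p) (map (\<lambda>i p. chart_deriv c d p (axis i 1)) is))))
        \<in> borel_measurable ?X"
    proof (rule borel_measurable_multilin[where a = "\<lambda>p ys. \<omega> (f p) (map (chart_vec N d (f p)) ys)"])
      show "multilin (\<lambda>ys. \<omega> (f p) (map (chart_vec N d (f p)) ys))" if "p \<in> space ?X" for p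
        using N.alternating_coordinates[OF alt at(2)[OF that]] by (simp add: alternating_def)
      show "(\<lambda>p. \<omega> (f p) (map (chart_vec N d (f p)) (map (\<lambda>j. axis j 1) js))) \<in> borel_measurable ?X" for js
      proof -
        have "(\<lambda>q. \<omega> q (map (\<lambda>j. coord_field N d j q) js)) \<in> borel_measurable (restrict_space (completion (rvol N)) (fst d))"
          using \<omega> d(1) unfolding measurable_forms_def by blast
        moreover have "f \<in> measurable ?X (restrict_space (completion (rvol N)) (fst d))"
          by (rule measurable_restrict_space3[OF measurable_map_completion]) auto
        ultimately have "(\<lambda>p. \<omega> (f p) (map (\<lambda>j. coord_field N d j (f p)) js)) \<in> borel_measurable ?X"
          by (rule measurable_compose[rotated])
        then show ?thesis by (simp add: coord_field_eq o_def)
      qed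
      fix v assume "v \<in> set (map (\<lambda>i p. chart_deriv c d p (axis i 1)) is)"
      then obtain i where "v = (\<lambda>p. chart_deriv c d p (axis i 1))" by auto
      then show "v \<in> borel_measurable ?X"
        using measurable_compose[OF M.id_measurable_restrict chart_deriv_measurable[OF c d(1)]] by simp
    qed
    also have "?this \<longleftrightarrow> (\<lambda>p. pullback M N f \<omega> p (map (\<lambda>i. coord_field M c i p) is)) \<in> borel_measurable ?X"
    proof (rule measurable_cong)
      fix p assume p: "p \<in> space ?X"
      show "\<omega> (f p) (map (chart_vec N d (f p)) (map (\<lambda>v. v p) (map (\<lambda>i p. chart_deriv c d p (axis i 1)) is)))
          = pullback M N f \<omega> p (map (\<lambda>i. coord_field M c i p) is)"
        using pullback_coordinates[OF at[OF p], of \<omega> "map (\<lambda>i. axis i 1) is"]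
        by (simp add: coord_field_eq o_def)
    qed
    finally show "(\<lambda>p. pullback M N f \<omega> p (map (\<lambda>i. coord_field M c i p) is))
        \<in> borel_measurable (restrict_space (restrict_space (completion (rvol M)) (fst c)) U)"
      unfolding d(2) by (subst restrict_restrict_space)
        (use M.fst_chart_borel[OF c] open_vimage[OF N.chart(1)[OF d(1)] continuous_map]
          in \<open>auto intro: sets_completionI_sets\<close>)
  next
    fix U assume "U \<in> (\<lambda>d. f -` fst d) ` D"
    then obtain d where d: "d \<in> atlas N" "U = f -` fst d" using D(2) by blast
    have "open U" using continuous_map N.chart(1)[OF d(1)] by (simp add: d(2) open_vimage)
    then have "U \<in> sets (completion (rvol M))" by (intro sets_completionI_sets) simp
    then show "U \<inter> space (restrict_space (completion (rvol M)) (fst c)) \<in> sets (restrict_space (completion (rvol M)) (fst c))"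
      by (auto simp: space_restrict_space sets_restrict_space Int_commute)
  next
    show "space (restrict_space (completion (rvol M)) (fst c)) \<subseteq> \<Union>((\<lambda>d. f -` fst d) ` D)"
    proof
      fix p
      have "f p \<in> (\<Union>d\<in>D. fst d)" unfolding D(3) by simp
      then show "p \<in> \<Union>((\<lambda>d. f -` fst d) ` D)" by blast
    qed
  qed (use D(1) in simp)
  then show ?thesis
    using pullback_alternating alt by (simp add: measurable_forms_def)
qed

text \<open>After replacing \<open>h\<close> by an almost everywhere equal Borel function, the left
  side is an integral for the pushforward, hence one with density the Fiber Volume, which is almost
  everywhere at most its essential supremum.\<close>

lemma nn_integral_map_le:
  assumes h: "h \<in> borel_measurable (completion (rvol N))"
  shows "(\<integral>\<^sup>+p. h (f p) \<partial>completion (rvol M)) \<le> ennreal (C_Vol M N f) * (\<integral>\<^sup>+q. h q \<partial>completion (rvol N))"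
proof -
  let ?D = "pushforward_measure M N f"
  obtain h' where h': "h' \<in> borel_measurable (rvol N)" "AE q in rvol N. h q = h' q"
    using completion_ex_borel_measurable[OF h] by blast
  \<comment> \<open>\<open>C_Vol\<close> is a real number obtained by \<open>enn2real\<close>;
    finiteness of the essential supremum ensures that nothing is lost.\<close>
  have fin: "esssup (rvol N) (fiber_volume M N f) = ennreal (C_Vol M N f)"
    using rn by (simp add: RN_lipschitz_def C_Vol_def)
  have "(\<integral>\<^sup>+p. h (f p) \<partial>completion (rvol M)) = (\<integral>\<^sup>+p. h' (f p) \<partial>completion (rvol M))"
    by (intro nn_integral_cong_AE AE_completion AE_map h'(2))
  also have "\<dots> = (\<integral>\<^sup>+p. h' (f p) \<partial>rvol M)"
    by (rule nn_integral_completion)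
  also have "\<dots> = (\<integral>\<^sup>+q. h' q \<partial>?D)"
    unfolding pushforward_measure_def using measurable_map h'(1) by (subst nn_integral_distr) simp_all
  also have "\<dots> = (\<integral>\<^sup>+q. fiber_volume M N f q * h' q \<partial>rvol N)"
    unfolding fiber_volume_def
    using rn h'(1)
    by (intro sigma_finite_measure.RN_deriv_nn_integral N.sigma_finite_rvol)
      (auto simp: RN_lipschitz_def pushforward_measure_def)
  also have "\<dots> \<le> (\<integral>\<^sup>+q. ennreal (C_Vol M N f) * h' q \<partial>rvol N)"
    using esssup_AE[of "fiber_volume M N f" "rvol N"]
    unfolding fin by (intro nn_integral_mono_AE) (auto elim!: eventually_mono intro!: mult_right_mono)
  also have "\<dots> = ennreal (C_Vol M N f) * (\<integral>\<^sup>+q. h' q \<partial>rvol N)"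
    by (rule nn_integral_cmult[OF h'(1)])
  also have "(\<integral>\<^sup>+q. h' q \<partial>rvol N) = (\<integral>\<^sup>+q. h q \<partial>completion (rvol N))"
    unfolding nn_integral_completion using h'(2) by (intro nn_integral_cong_AE) auto
  finally show ?thesis .
qed

lemma pullback_energy:
  assumes \<omega>: "\<omega> \<in> measurable_forms N"
  shows "form_energy M (pullback M N f \<omega>) \<le> ennreal ((K_const M N f)\<^sup>2 * C_Vol M N f) * form_energy N \<omega>"
proof -
  let ?K = "(K_const M N f)\<^sup>2"
  let ?h = "\<lambda>q. ennreal (form_norm_sq N q (\<omega> q))"
  have alt: "alternating_form N q (\<omega> q)" for q using \<omega> by (simp add: measurable_forms_def)
  have h: "?h \<in> borel_measurable (completion (rvol N))" using N.form_norm_sq_measurable[OF \<omega>] by simp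
  have "form_energy M (pullback M N f \<omega>) \<le> (\<integral>\<^sup>+p. ennreal ?K * ?h (f p) \<partial>completion (rvol M))"
    unfolding form_energy_def
    using pullback_norm_bound[of _ \<omega>, OF alt]
    by (intro nn_integral_mono) (simp add: ennreal_mult[symmetric] N.form_norm_sq_nonneg ennreal_leI)
  also have "\<dots> = ennreal ?K * (\<integral>\<^sup>+p. ?h (f p) \<partial>completion (rvol M))"
    by (rule nn_integral_cmult) (rule measurable_compose[OF measurable_map_completion h])
  also have "\<dots> \<le> ennreal ?K * (ennreal (C_Vol M N f) * form_energy N \<omega>)"
    unfolding form_energy_def by (intro mult_left_mono nn_integral_map_le h) simp
  also have "\<dots> = ennreal (?K * C_Vol M N f) * form_energy N \<omega>"
    by (simp add: ennreal_mult C_Vol_def mult.assoc)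
  finally show ?thesis .
qed

end

section \<open>The Hilbert spaces of square integrable forms\<close>

lemma alternating_form_add:
  assumes "alternating_form M p \<alpha>" "alternating_form M p \<beta>"
  shows "alternating_form M p (\<lambda>vs. \<alpha> vs + \<beta> vs)"
  unfolding alternating_form_def
proof (intro conjI allI impI)
  fix us ws u v a b
  assume "set us \<union> set ws \<union> {u, v} \<subseteq> tangent_space M p"
  then have "\<gamma> (us @ tlin a u b v # ws) = complex_of_real a * \<gamma> (us @ u # ws) + complex_of_real b * \<gamma> (us @ v # ws)"
    if "alternating_form M p \<gamma>" for \<gamma> using that unfolding alternating_form_def by blast
  from this[OF assms(1)] this[OF assms(2)]
  show "\<alpha> (us @ tlin a u b v # ws) + \<beta> (us @ tlin a u b v # ws) =
      complex_of_real a * (\<alpha> (us @ u # ws) + \<beta> (us @ u # ws))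
      + complex_of_real b * (\<alpha> (us @ v # ws) + \<beta> (us @ v # ws))"
    by (simp add: algebra_simps)
qed (use assms in \<open>auto simp: alternating_form_def\<close>)

lemma alternating_form_scale:
  assumes "alternating_form M p \<alpha>"
  shows "alternating_form M p (\<lambda>vs. z * \<alpha> vs)"
  unfolding alternating_form_def
proof (intro conjI allI impI)
  fix us ws u v a b
  assume "set us \<union> set ws \<union> {u, v} \<subseteq> tangent_space M p"
  then have "\<alpha> (us @ tlin a u b v # ws) = complex_of_real a * \<alpha> (us @ u # ws) + complex_of_real b * \<alpha> (us @ v # ws)"
    using assms unfolding alternating_form_def by blast
  then show "z * \<alpha> (us @ tlin a u b v # ws) =
      complex_of_real a * (z * \<alpha> (us @ u # ws)) + complex_of_real b * (z * \<alpha> (us @ v # ws))"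
    by (simp add: algebra_simps)
qed (use assms in \<open>auto simp: alternating_form_def\<close>)

text \<open>Both norms at p use the same chosen basis, so the scalar inequality applies termwise.
  The factor 2 is harmless: the estimate serves only to keep energies of sums finite.\<close>

lemma form_norm_sq_add_le:
  "form_norm_sq M p (\<lambda>vs. \<alpha> vs + \<beta> vs) \<le> 2 * form_norm_sq M p \<alpha> + 2 * form_norm_sq M p \<beta>"
proof -
  have "(cmod (x + y))\<^sup>2 \<le> 2 * (cmod x)\<^sup>2 + 2 * (cmod y)\<^sup>2" for x y
  proof -
    have "(cmod (x + y))\<^sup>2 \<le> (cmod x + cmod y)\<^sup>2" by (intro power_mono norm_triangle_ineq) simp
    also have "\<dots> \<le> 2 * (cmod x)\<^sup>2 + 2 * (cmod y)\<^sup>2"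
      using sum_squares_bound[of "cmod x" "cmod y"] by (simp add: power2_sum)
    finally show ?thesis .
  qed
  then show ?thesis
    unfolding form_norm_sq_def Let_def sum_distrib_left sum.distrib[symmetric] by (intro sum_mono)
qed

lemma form_norm_sq_scale: "form_norm_sq M p (\<lambda>vs. z * \<alpha> vs) = (cmod z)\<^sup>2 * form_norm_sq M p \<alpha>"
  by (simp add: form_norm_sq_def Let_def norm_mult power_mult_distrib sum_distrib_left)

context riem_mfd
begin

lemma measurable_forms_add:
  assumes "\<omega> \<in> measurable_forms M" "\<eta> \<in> measurable_forms M"
  shows "(\<lambda>p vs. \<omega> p vs + \<eta> p vs) \<in> measurable_forms M"
  using assms unfolding measurable_forms_def
  by (intro CollectI conjI allI ballI alternating_form_add borel_measurable_add) blast+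

lemma measurable_forms_scale:
  assumes "\<omega> \<in> measurable_forms M"
  shows "(\<lambda>p vs. z * \<omega> p vs) \<in> measurable_forms M"
  using assms unfolding measurable_forms_def
  by (intro CollectI conjI allI ballI alternating_form_scale borel_measurable_times borel_measurable_const) blast+

lemma sq_int_forms_add:
  assumes "\<omega> \<in> sq_int_forms M" "\<eta> \<in> sq_int_forms M"
  shows "(\<lambda>p vs. \<omega> p vs + \<eta> p vs) \<in> sq_int_forms M"
proof -
  let ?n = "\<lambda>\<omega> p. ennreal (form_norm_sq M p (\<omega> p))"
  have m: "\<omega> \<in> measurable_forms M" "\<eta> \<in> measurable_forms M" using assms by (auto simp: sq_int_forms_def)
  have n: "?n \<omega> \<in> borel_measurable (completion (rvol M))" "?n \<eta> \<in> borel_measurable (completion (rvol M))"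
    using form_norm_sq_measurable m by auto
  have "form_energy M (\<lambda>p vs. \<omega> p vs + \<eta> p vs) \<le> (\<integral>\<^sup>+p. 2 * ?n \<omega> p + 2 * ?n \<eta> p \<partial>completion (rvol M))"
    unfolding form_energy_def
  proof (rule nn_integral_mono)
    fix p
    have "ennreal (form_norm_sq M p (\<lambda>vs. \<omega> p vs + \<eta> p vs))
        \<le> ennreal (2 * form_norm_sq M p (\<omega> p) + 2 * form_norm_sq M p (\<eta> p))"
      by (intro ennreal_leI form_norm_sq_add_le)
    also have "\<dots> = 2 * ?n \<omega> p + 2 * ?n \<eta> p"
      by (simp add: ennreal_plus ennreal_mult form_norm_sq_nonneg)
    finally show "ennreal (form_norm_sq M p (\<lambda>vs. \<omega> p vs + \<eta> p vs)) \<le> 2 * ?n \<omega> p + 2 * ?n \<eta> p" .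
  qed
  also have "\<dots> = 2 * form_energy M \<omega> + 2 * form_energy M \<eta>"
    using n by (simp add: form_energy_def nn_integral_add nn_integral_cmult)
  also have "\<dots> < \<infinity>" using assms by (simp add: sq_int_forms_def ennreal_mult_less_top)
  finally show ?thesis using measurable_forms_add[OF m] by (simp add: sq_int_forms_def)
qed

lemma sq_int_forms_scale:
  assumes "\<omega> \<in> sq_int_forms M"
  shows "(\<lambda>p vs. z * \<omega> p vs) \<in> sq_int_forms M"
proof -
  let ?n = "\<lambda>p. ennreal (form_norm_sq M p (\<omega> p))"
  have m: "\<omega> \<in> measurable_forms M" using assms by (auto simp: sq_int_forms_def)
  then have n: "?n \<in> borel_measurable (completion (rvol M))" using form_norm_sq_measurable by auto
  have "form_energy M (\<lambda>p vs. z * \<omega> p vs) = ennreal ((cmod z)\<^sup>2) * form_energy M \<omega>"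
    unfolding form_energy_def form_norm_sq_scale
    by (simp add: ennreal_mult form_norm_sq_nonneg nn_integral_cmult[OF n])
  also have "\<dots> < \<infinity>" using assms by (simp add: sq_int_forms_def ennreal_mult_less_top)
  finally show ?thesis using measurable_forms_scale[OF m] by (simp add: sq_int_forms_def)
qed

lemma ae_eq_iff: "(\<omega>, \<eta>) \<in> ae_eq M \<longleftrightarrow>
    \<omega> \<in> sq_int_forms M \<and> \<eta> \<in> sq_int_forms M \<and> (AE p in rvol M. \<omega> p = \<eta> p)"
  by (simp add: ae_eq_def AE_completion_iff)

lemma equiv_ae_eq: "equiv (sq_int_forms M) (ae_eq M)"
proof (rule equivI)
  show "refl_on (sq_int_forms M) (ae_eq M)" by (auto simp: refl_on_def ae_eq_iff)
  show "ae_eq M \<subseteq> sq_int_forms M \<times> sq_int_forms M" by (auto simp: ae_eq_iff)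
  show "sym (ae_eq M)" by (auto intro!: symI simp: ae_eq_iff elim: eventually_mono)
  show "trans (ae_eq M)"
  proof (rule transI)
    fix \<omega> \<eta> \<theta> assume 1: "(\<omega>, \<eta>) \<in> ae_eq M" and 2: "(\<eta>, \<theta>) \<in> ae_eq M"
    then have "AE p in rvol M. \<omega> p = \<eta> p" "AE p in rvol M. \<eta> p = \<theta> p" by (auto simp: ae_eq_iff)
    then have "AE p in rvol M. \<omega> p = \<theta> p" by eventually_elim simp
    then show "(\<omega>, \<theta>) \<in> ae_eq M" using 1 2 by (simp add: ae_eq_iff)
  qed
qed

lemma L2_class_eq: "(\<omega>, \<eta>) \<in> ae_eq M \<Longrightarrow> L2_class M \<omega> = L2_class M \<eta>"
  unfolding L2_class_def by (rule equiv_class_eq[OF equiv_ae_eq])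

lemma mem_L2_class: "\<eta> \<in> L2_class M \<omega> \<longleftrightarrow> (\<omega>, \<eta>) \<in> ae_eq M"
  by (simp add: L2_class_def)

lemma self_mem_L2_class: "\<omega> \<in> sq_int_forms M \<Longrightarrow> \<omega> \<in> L2_class M \<omega>"
  by (simp add: mem_L2_class ae_eq_iff)

lemma L2_class_in_L2: "\<omega> \<in> sq_int_forms M \<Longrightarrow> L2_class M \<omega> \<in> L2 M"
  unfolding L2_class_def L2_def by (rule quotientI)

lemma L2E:
  assumes "X \<in> L2 M" obtains \<omega> where "\<omega> \<in> sq_int_forms M" "X = L2_class M \<omega>"
  using assms unfolding L2_def L2_class_def by (rule quotientE) blast

text \<open>\<open>L2_add\<close> is a union over all representatives; all of them give the same
  class, so the union collapses.\<close>

lemma L2_add_class: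
  assumes "\<omega> \<in> sq_int_forms M" "\<eta> \<in> sq_int_forms M"
  shows "L2_add M (L2_class M \<omega>) (L2_class M \<eta>) = L2_class M (\<lambda>p vs. \<omega> p vs + \<eta> p vs)"
proof -
  have "L2_class M (\<lambda>p vs. \<omega>' p vs + \<eta>' p vs) = L2_class M (\<lambda>p vs. \<omega> p vs + \<eta> p vs)"
    if "\<omega>' \<in> L2_class M \<omega>" "\<eta>' \<in> L2_class M \<eta>" for \<omega>' \<eta>'
  proof (rule L2_class_eq[symmetric])
    have "AE p in rvol M. \<omega> p = \<omega>' p" "AE p in rvol M. \<eta> p = \<eta>' p"
      using that by (auto simp: mem_L2_class ae_eq_iff)
    then have "AE p in rvol M. (\<lambda>vs. \<omega> p vs + \<eta> p vs) = (\<lambda>vs. \<omega>' p vs + \<eta>' p vs)"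
      by eventually_elim simp
    then show "((\<lambda>p vs. \<omega> p vs + \<eta> p vs), (\<lambda>p vs. \<omega>' p vs + \<eta>' p vs)) \<in> ae_eq M"
      using that by (auto simp: mem_L2_class ae_eq_iff intro: sq_int_forms_add)
  qed
  then show ?thesis
    unfolding L2_add_def using self_mem_L2_class assms by blast
qed

lemma L2_scale_class:
  assumes "\<omega> \<in> sq_int_forms M"
  shows "L2_scale M z (L2_class M \<omega>) = L2_class M (\<lambda>p vs. z * \<omega> p vs)"
proof -
  have "L2_class M (\<lambda>p vs. z * \<omega>' p vs) = L2_class M (\<lambda>p vs. z * \<omega> p vs)"
    if "\<omega>' \<in> L2_class M \<omega>" for \<omega>'
  proof (rule L2_class_eq[symmetric])
    have "AE p in rvol M. \<omega> p = \<omega>' p" using that by (auto simp: mem_L2_class ae_eq_iff)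
    then have "AE p in rvol M. (\<lambda>vs. z * \<omega> p vs) = (\<lambda>vs. z * \<omega>' p vs)"
      by eventually_elim simp
    then show "((\<lambda>p vs. z * \<omega> p vs), (\<lambda>p vs. z * \<omega>' p vs)) \<in> ae_eq M"
      using that by (auto simp: mem_L2_class ae_eq_iff intro: sq_int_forms_scale)
  qed
  then show ?thesis
    unfolding L2_scale_def using self_mem_L2_class assms by blast
qed

text \<open>The energy is constant on a class, so the image in \<open>L2_norm\<close> is a singleton
  and \<open>the_elem\<close> is meaningful.\<close>

lemma L2_norm_class:
  assumes "\<omega> \<in> sq_int_forms M"
  shows "L2_norm M (L2_class M \<omega>) = sqrt (enn2real (form_energy M \<omega>))"
proof -
  have energy: "form_energy M \<eta> = form_energy M \<omega>" if "\<eta> \<in> L2_class M \<omega>" for \<eta>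
  proof -
    have "AE p in completion (rvol M). \<omega> p = \<eta> p" using that by (simp add: mem_L2_class ae_eq_def)
    then have "AE p in completion (rvol M). ennreal (form_norm_sq M p (\<eta> p)) = ennreal (form_norm_sq M p (\<omega> p))"
      by (rule eventually_mono) (simp only:)
    then show ?thesis unfolding form_energy_def by (rule nn_integral_cong_AE)
  qed
  have "sqrt (enn2real (form_energy M \<eta>)) \<in> {sqrt (enn2real (form_energy M \<omega>))}"
    if "\<eta> \<in> L2_class M \<omega>" for \<eta>
    unfolding energy[OF that] by simp
  then have "(\<lambda>\<omega>. sqrt (enn2real (form_energy M \<omega>))) ` L2_class M \<omega> = {sqrt (enn2real (form_energy M \<omega>))}"
    using self_mem_L2_class[OF assms] by blast
  then show ?thesis by (simp add: L2_norm_def)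
qed

end

section \<open>The pullback operator\<close>

context riem_lip
begin

lemma pullback_sq_int:
  assumes "\<omega> \<in> sq_int_forms N" shows "pullback M N f \<omega> \<in> sq_int_forms M"
proof -
  have "form_energy M (pullback M N f \<omega>) \<le> ennreal ((K_const M N f)\<^sup>2 * C_Vol M N f) * form_energy N \<omega>"
    using assms by (intro pullback_energy) (simp add: sq_int_forms_def)
  also have "\<dots> < \<infinity>" using assms by (simp add: sq_int_forms_def ennreal_mult_less_top)
  finally show ?thesis using assms pullback_measurable_forms by (simp add: sq_int_forms_def)
qed

text \<open>Representatives that agree outside a null set of N have pullbacks that agree outside its
  preimage, a null set of M by absolute continuity.\<close>

lemma L2_pullback_class:
  assumes "\<omega> \<in> sq_int_forms N"
  shows "L2_pullback M N f (L2_class N \<omega>) = L2_class M (pullback M N f \<omega>)"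
proof -
  have "L2_class M (pullback M N f \<eta>) = L2_class M (pullback M N f \<omega>)" if "\<eta> \<in> L2_class N \<omega>" for \<eta>
  proof (rule M.L2_class_eq[symmetric])
    have \<eta>: "\<eta> \<in> sq_int_forms N" "AE q in rvol N. \<omega> q = \<eta> q"
      using that by (auto simp: N.mem_L2_class N.ae_eq_iff)
    from AE_map[OF \<eta>(2)] have "AE p in rvol M. pullback M N f \<omega> p = pullback M N f \<eta> p"
      by eventually_elim (simp add: pullback_def fun_eq_iff)
    then show "(pullback M N f \<omega>, pullback M N f \<eta>) \<in> ae_eq M"
      using assms \<eta>(1) by (simp add: M.ae_eq_iff pullback_sq_int)
  qed
  then show ?thesis
    unfolding L2_pullback_def using N.self_mem_L2_class[OF assms] by blast
qed

lemma pullback_add: "pullback M N f (\<lambda>q vs. \<omega> q vs + \<eta> q vs) = (\<lambda>p vs. pullback M N f \<omega> p vs + pullback M N f \<eta> p vs)"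
  by (simp add: pullback_def fun_eq_iff)

lemma pullback_scale: "pullback M N f (\<lambda>q vs. z * \<omega> q vs) = (\<lambda>p vs. z * pullback M N f \<omega> p vs)"
  by (simp add: pullback_def fun_eq_iff)

lemma L2_pullback_norm:
  assumes "X \<in> L2 N"
  shows "L2_norm M (L2_pullback M N f X) \<le> K_const M N f * sqrt (C_Vol M N f) * L2_norm N X"
proof -
  from assms obtain \<omega> where \<omega>: "\<omega> \<in> sq_int_forms N" "X = L2_class N \<omega>" by (rule N.L2E)
  have K: "0 \<le> K_const M N f" using K_const_ge_1 by simp
  have V: "0 \<le> C_Vol M N f" by (simp add: C_Vol_def)
  have fin: "form_energy N \<omega> < \<infinity>" and "\<omega> \<in> measurable_forms N"
    using \<omega>(1) by (auto simp: sq_int_forms_def)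
  \<comment> \<open>\<open>enn2real\<close> sends infinity to 0, so its monotonicity relies on the
    finiteness of the right side.\<close>
  have "enn2real (form_energy M (pullback M N f \<omega>))
      \<le> enn2real (ennreal ((K_const M N f)\<^sup>2 * C_Vol M N f) * form_energy N \<omega>)"
    using fin pullback_energy[OF \<open>\<omega> \<in> measurable_forms N\<close>]
    by (intro enn2real_mono) (auto simp: ennreal_mult_less_top)
  also have "\<dots> = (K_const M N f)\<^sup>2 * C_Vol M N f * enn2real (form_energy N \<omega>)"
    using V by (simp add: enn2real_mult)
  finally have "sqrt (enn2real (form_energy M (pullback M N f \<omega>)))
      \<le> sqrt ((K_const M N f)\<^sup>2 * C_Vol M N f * enn2real (form_energy N \<omega>))"
    by (rule real_sqrt_le_mono)
  also have "\<dots> = K_const M N f * sqrt (C_Vol M N f) * sqrt (enn2real (form_energy N \<omega>))"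
    using K by (simp add: real_sqrt_mult)
  finally show ?thesis
    unfolding \<omega>(2) L2_pullback_class[OF \<omega>(1)] M.L2_norm_class[OF pullback_sq_int[OF \<omega>(1)]]
      N.L2_norm_class[OF \<omega>(1)] .
qed

lemma L2_pullback_bounded_operator: "L2_bounded_operator N M (L2_pullback M N f)"
  unfolding L2_bounded_operator_def
proof (intro conjI ballI allI)
  fix X assume "X \<in> L2 N"
  then obtain \<omega> where \<omega>: "\<omega> \<in> sq_int_forms N" "X = L2_class N \<omega>" by (rule N.L2E)
  show "L2_pullback M N f X \<in> L2 M"
    by (simp add: \<omega>(2) L2_pullback_class[OF \<omega>(1)] M.L2_class_in_L2 pullback_sq_int \<omega>(1))
  show "L2_pullback M N f (L2_scale N z X) = L2_scale M z (L2_pullback M N f X)" for z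
    by (simp add: \<omega>(2) L2_pullback_class N.L2_scale_class M.L2_scale_class pullback_scale
        N.sq_int_forms_scale pullback_sq_int \<omega>(1))
  fix Y assume "Y \<in> L2 N"
  then obtain \<eta> where \<eta>: "\<eta> \<in> sq_int_forms N" "Y = L2_class N \<eta>" by (rule N.L2E)
  show "L2_pullback M N f (L2_add N X Y) = L2_add M (L2_pullback M N f X) (L2_pullback M N f Y)"
    by (simp add: \<omega>(2) \<eta>(2) L2_pullback_class N.L2_add_class M.L2_add_class pullback_add
        N.sq_int_forms_add pullback_sq_int \<omega>(1) \<eta>(1))
next
  show "\<exists>B. \<forall>X\<in>L2 N. L2_norm M (L2_pullback M N f X) \<le> B * L2_norm N X"
    using L2_pullback_norm by blast
qed

lemma L2_pullback_onorm: "L2_onorm N M (L2_pullback M N f) \<le> K_const M N f * sqrt (C_Vol M N f)"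
  unfolding L2_onorm_def
proof (rule cInf_lower)
  have "0 \<le> K_const M N f * sqrt (C_Vol M N f)" using K_const_ge_1 by (simp add: C_Vol_def)
  then show "K_const M N f * sqrt (C_Vol M N f)
      \<in> {B. 0 \<le> B \<and> (\<forall>X\<in>L2 N. L2_norm M (L2_pullback M N f X) \<le> B * L2_norm N X)}"
    using L2_pullback_norm by simp
  show "bdd_below {B. 0 \<le> B \<and> (\<forall>X\<in>L2 N. L2_norm M (L2_pullback M N f X) \<le> B * L2_norm N X)}"
    by (rule bdd_belowI[of _ 0]) simp
qed

end

theorem proposition1p3p8:
  fixes M :: "('a::{t2_space, second_countable_topology}, 'm::finite) riem"
    and N :: "('b::{t2_space, second_countable_topology}, 'n::finite) riem"
    and f :: "'a \<Rightarrow> 'b"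
  assumes "riemannian_manifold M"
    and "riemannian_manifold N"
    and "RN_lipschitz M N f"
  shows "(\<forall>\<omega>\<in>sq_int_forms N. pullback M N f \<omega> \<in> sq_int_forms M \<and>
            L2_pullback M N f (L2_class N \<omega>) = L2_class M (pullback M N f \<omega>)) \<and>
         L2_bounded_operator N M (L2_pullback M N f) \<and>
         L2_onorm N M (L2_pullback M N f) \<le> K_const M N f * sqrt (C_Vol M N f)"
proof -
  interpret riem_lip M N f by unfold_locales (fact assms)+
  show ?thesis
    using pullback_sq_int L2_pullback_class L2_pullback_bounded_operator L2_pullback_onorm by blast
qed

end
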